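(* Let $G$ be of type $C_2$ over $k$ of characteristic $2$, and let $\lambda \in X_\tau(T)=\{0,\omega_1\}$. Then there are isomorphisms of $G$-modules $$\mathrm{H}^1(G_\tau,\mathrm{H}^0(\lambda))^{(-\tau)} \cong \begin{cases} \mathrm{H}^0(\omega_1)\cong L(\omega_1) & \text{if } \lambda=0,\\ 0 & \text{otherwise.}\end{cases}$$
   Context: $k$ is an algebraically closed field of characteristic $p=2$; $G$ is the simple, simply connected algebraic group over $k$ with root system $\Phi$ of type $C_2$, with maximal torus $T$ and Borel subgroup $B\supset T$ corresponding to the negative roots. Simple roots are in Bourbaki ordering: $\alpha_1$ short, $\alpha_2$ long; $\omega_1,\omega_2$ are the fundamental dominant weights. $X(T)=\mathbb{Z}\omega_1\oplus\mathbb{Z}\omega_2$, $X(T)_+$ is the set of dominant weights. For $\lambda\in X(T)_+$, $\mathrm{H}^0(\lambda)=\mathrm{Ind}_B^G\lambda$ is the induced module and $L(\lambda)$ the simple module of highest weight $\lambda$. $\tau:G\to G$ is the fixed purely inseparable (special) isogeny with $\tau^2=F$ the Frobenius endomorphism, stabilizing $T$ and $B$; the induced map on $X(T)$, also denoted $\tau$, is $\mathbb{Z}$-linear with $\tau(\omega_1)=\omega_2$, $\tau(\omega_2)=2\omega_1$. $G_\tau$ is the scheme-theoretic kernel of $\tau$. The set $X_\tau(T)$ of $\tau$-restricted weights (the $p$-restricted dominant weights orthogonal to the long simple roots) is $\{0,\omega_1\}$. For a $G$-module $M$, $M^{(\tau)}$ is its twist by precomposing the action with $\tau$; if $G_\tau$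 acts trivially on $M$, $M^{(-\tau)}$ is the untwist, i.e. the module with $(M^{(-\tau)})^{(\tau)}=M$. $\mathrm{H}^1(G_\tau,-)$ of a $G$-module is a $G$-module on which $G_\tau$ acts trivially. *)

theory Defs
  imports
    "HOL-Analysis.Analysis"
    "HOL-Algebra.Ideal"
    "HOL-Algebra.Module"
begin

section \<open>The group \<open>Sp\<^sub>4\<close>\<close>

text \<open>
  The simple simply connected group of type \<open>C\<^sub>2\<close> is \<open>Sp\<^sub>4\<close>. Since the field is algebraically
  closed and \<open>Sp\<^sub>4\<close>, its Borel subgroup and its torus are smooth, these groups are represented by
  their groups of rational points, and \<open>k[Sp\<^sub>4]\<close>, \<open>k[Sp\<^sub>4 \<times> Sp\<^sub>4]\<close> by functions on points.
  In the index type \<open>4\<close> the numeral \<open>4\<close> equals \<open>0\<close>, so the order of this type is not used.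
\<close>

type_synonym 'k mat4 = "'k ^ 4 ^ 4"

definition symp_form :: "'k::field mat4" where
  "symp_form = vector [vector [0, 0, 0, 1], vector [0, 0, 1, 0],
                       vector [0, - 1, 0, 0], vector [- 1, 0, 0, 0]]"

definition Sp4 :: "'k::field mat4 monoid" where
  "Sp4 = \<lparr>carrier = {A. transpose A ** symp_form ** A = symp_form}, mult = (**), one = mat 1\<rparr>"

definition torus :: "'k::field mat4 set" where
  "torus = {A \<in> carrier Sp4. \<forall>i j. i \<noteq> j \<longrightarrow> A $ i $ j = 0}"

text \<open>
  The torus consists of the \<open>diag(t\<^sub>1, t\<^sub>2, t\<^sub>2\<^sup>-\<^sup>1, t\<^sub>1\<^sup>-\<^sup>1)\<close>. With \<open>\<epsilon>\<^sub>i\<close> the character \<open>t\<^sub>i\<close>, the simple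
  roots are \<open>\<alpha>\<^sub>1 = \<epsilon>\<^sub>1 - \<epsilon>\<^sub>2\<close> (short) and \<open>\<alpha>\<^sub>2 = 2\<epsilon>\<^sub>2\<close> (long). The positive root subgroups are upper
  triangular, so the Borel subgroup of the negative roots is the lower triangular one.
\<close>

definition borel :: "'k::field mat4 set" where
  "borel = {A \<in> carrier Sp4. A $ 1 $ 2 = 0 \<and> A $ 1 $ 3 = 0 \<and> A $ 1 $ 4 = 0 \<and>
                             A $ 2 $ 3 = 0 \<and> A $ 2 $ 4 = 0 \<and> A $ 3 $ 4 = 0}"

inductive_set poly_funs :: "('k::field mat4 \<Rightarrow> 'k) set" where
  const: "(\<lambda>_. c) \<in> poly_funs"
| entry: "(\<lambda>A. A $ i $ j) \<in> poly_funs"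
| add: "f \<in> poly_funs \<Longrightarrow> h \<in> poly_funs \<Longrightarrow> (\<lambda>A. f A + h A) \<in> poly_funs"
| mult: "f \<in> poly_funs \<Longrightarrow> h \<in> poly_funs \<Longrightarrow> (\<lambda>A. f A * h A) \<in> poly_funs"

text \<open>
  The coordinate ring \<open>k[Sp\<^sub>4]\<close>. As \<open>Sp\<^sub>4\<close> is closed in the space of matrices, all regular functions
  are restrictions of polynomial functions.
\<close>

definition coord_ring :: "('k::field mat4 \<Rightarrow> 'k) ring" where
  "coord_ring =
    \<lparr>carrier = (\<lambda>f. restrict f (carrier Sp4)) ` poly_funs,
     mult = (\<lambda>f h. \<lambda>g\<in>carrier Sp4. f g * h g),
     one = (\<lambda>g\<in>carrier Sp4. 1),
     zero = (\<lambda>g\<in>carrier Sp4. 0),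
     add = (\<lambda>f h. \<lambda>g\<in>carrier Sp4. f g + h g)\<rparr>"


section \<open>Weights\<close>

text \<open>
  The pair \<open>(a, b)\<close> stands for the weight \<open>a\<omega>\<^sub>1 + b\<omega>\<^sub>2\<close>, where \<open>\<omega>\<^sub>1 = \<epsilon>\<^sub>1\<close> and \<open>\<omega>\<^sub>2 = \<epsilon>\<^sub>1 + \<epsilon>\<^sub>2\<close>. Its
  coordinates are the pairings with the simple coroots.
\<close>

type_synonym weight = "int \<times> int"

definition \<omega>\<^sub>1 :: weight where "\<omega>\<^sub>1 = (1, 0)"
definition \<omega>\<^sub>2 :: weight where "\<omega>\<^sub>2 = (0, 1)"
definition \<alpha>\<^sub>1 :: weight where "\<alpha>\<^sub>1 = (2, - 1)"
definition \<alpha>\<^sub>2 :: weight where "\<alpha>\<^sub>2 = (- 2, 2)"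

text \<open>
  Evaluation of a weight. On the Borel subgroup this is the inflation along the projection to the
  torus, which takes a lower triangular matrix to its diagonal.
\<close>

definition weight_char :: "weight \<Rightarrow> 'k::field mat4 \<Rightarrow> 'k" where
  "weight_char w A = (A $ 1 $ 1) powi fst w * (A $ 1 $ 1 * A $ 2 $ 2) powi snd w"

definition weight_le :: "weight \<Rightarrow> weight \<Rightarrow> bool" where
  "weight_le v w \<longleftrightarrow> (\<exists>m n :: nat. w = (fst v + int m * fst \<alpha>\<^sub>1 + int n * fst \<alpha>\<^sub>2,
                                      snd v + int m * snd \<alpha>\<^sub>1 + int n * snd \<alpha>\<^sub>2))"

text \<open>
  The \<open>\<tau>\<close>-restricted weights: dominant, \<open>2\<close>-restricted, and orthogonal to the long simple root
  \<open>\<alpha>\<^sub>2\<close>.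
\<close>

definition tau_restricted :: "weight set" where
  "tau_restricted = {(a, b). 0 \<le> a \<and> a < 2 \<and> 0 \<le> b \<and> b < 2 \<and> b = 0}"

lemma tau_restricted_eq: "tau_restricted = {0, \<omega>\<^sub>1}"
  by (auto simp: tau_restricted_def \<omega>\<^sub>1_def zero_prod_def)


section \<open>Rational modules\<close>

text \<open>The base field as a ring record.\<close>

definition base_field :: "'k::field ring" where
  "base_field = \<lparr>carrier = UNIV, mult = (*), one = 1, zero = 0, add = (+)\<rparr>"

text \<open>The fields \<open>mult\<close> and \<open>one\<close> inherited from rings are irrelevant for modules.\<close>

record ('k, 'v) gmodule = "('k, 'v) module" +
  act :: "'k mat4 \<Rightarrow> 'v \<Rightarrow> 'v"

text \<open>
  For a set \<open>S\<close> of functions on \<open>X\<close>, this is the space \<open>M \<otimes> span S\<close> of maps from \<open>X\<close> to \<open>M\<close>.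
  For \<open>S = k[X]\<close> it consists of the morphisms from \<open>X\<close> to \<open>M\<close>.
\<close>

definition tensor_maps ::
    "'x set \<Rightarrow> ('x \<Rightarrow> 'k::field) set \<Rightarrow> ('k, 'v, 'z) module_scheme \<Rightarrow> ('x \<Rightarrow> 'v) set" where
  "tensor_maps X S M =
    {\<lambda>x\<in>X. \<Oplus>\<^bsub>M\<^esub>i\<in>{..<n}. a i x \<odot>\<^bsub>M\<^esub> v i | n a v.
      \<forall>i<(n::nat). a i \<in> S \<and> v i \<in> carrier M}"

text \<open>
  The last condition says that orbit maps are morphisms, that is, \<open>M\<close> is a \<open>k[Sp\<^sub>4]\<close>-comodule.
\<close>

definition is_gmodule :: "('k::field, 'v) gmodule \<Rightarrow> bool" where
  "is_gmodule M \<longleftrightarrow> Module.module base_field M \<and>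
    (\<forall>g\<in>carrier Sp4. \<forall>v\<in>carrier M. act M g v \<in> carrier M) \<and>
    (\<forall>g\<in>carrier Sp4. \<forall>v\<in>carrier M. \<forall>w\<in>carrier M.
      act M g (v \<oplus>\<^bsub>M\<^esub> w) = act M g v \<oplus>\<^bsub>M\<^esub> act M g w) \<and>
    (\<forall>g\<in>carrier Sp4. \<forall>c. \<forall>v\<in>carrier M. act M g (c \<odot>\<^bsub>M\<^esub> v) = c \<odot>\<^bsub>M\<^esub> act M g v) \<and>
    (\<forall>v\<in>carrier M. act M \<one>\<^bsub>Sp4\<^esub> v = v) \<and>
    (\<forall>g\<in>carrier Sp4. \<forall>h\<in>carrier Sp4. \<forall>v\<in>carrier M.
      act M (g \<otimes>\<^bsub>Sp4\<^esub> h) v = act M g (act M h v)) \<and>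
    (\<forall>v\<in>carrier M.
      (\<lambda>g\<in>carrier Sp4. act M g v) \<in> tensor_maps (carrier Sp4) (carrier coord_ring) M)"

definition gmodule_iso :: "('k::field, 'v) gmodule \<Rightarrow> ('k, 'w) gmodule \<Rightarrow> bool" (infix "\<cong>\<^sub>G" 50) where
  "M \<cong>\<^sub>G N \<longleftrightarrow> is_gmodule M \<and> is_gmodule N \<and>
    (\<exists>\<phi>. bij_betw \<phi> (carrier M) (carrier N) \<and>
      (\<forall>v\<in>carrier M. \<forall>w\<in>carrier M. \<phi> (v \<oplus>\<^bsub>M\<^esub> w) = \<phi> v \<oplus>\<^bsub>N\<^esub> \<phi> w) \<and>
      (\<forall>c. \<forall>v\<in>carrier M. \<phi> (c \<odot>\<^bsub>M\<^esub> v) = c \<odot>\<^bsub>N\<^esub> \<phi> v) \<and>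
      (\<forall>g\<in>carrier Sp4. \<forall>v\<in>carrier M. \<phi> (act M g v) = act N g (\<phi> v)))"

definition zero_gmodule :: "('k::field, unit) gmodule" where
  "zero_gmodule = \<lparr>carrier = UNIV, mult = (\<lambda>_ _. ()), one = (), zero = (), add = (\<lambda>_ _. ()),
                   smult = (\<lambda>_ _. ()), act = (\<lambda>_ _. ())\<rparr>"

definition gsubmodule :: "'v set \<Rightarrow> ('k::field, 'v) gmodule \<Rightarrow> bool" where
  "gsubmodule N M \<longleftrightarrow> submodule N base_field M \<and> (\<forall>g\<in>carrier Sp4. \<forall>v\<in>N. act M g v \<in> N)"

definition simple_gmodule :: "('k::field, 'v) gmodule \<Rightarrow> bool" where
  "simple_gmodule M \<longleftrightarrow> is_gmodule M \<and> carrier M \<noteq> {\<zero>\<^bsub>M\<^esub>} \<and>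
    (\<forall>N. gsubmodule N M \<longrightarrow> N = {\<zero>\<^bsub>M\<^esub>} \<or> N = carrier M)"

definition is_weight :: "weight \<Rightarrow> ('k::field, 'v) gmodule \<Rightarrow> bool" where
  "is_weight w M \<longleftrightarrow> (\<exists>v\<in>carrier M. v \<noteq> \<zero>\<^bsub>M\<^esub> \<and>
    (\<forall>t\<in>torus. act M t v = weight_char w t \<odot>\<^bsub>M\<^esub> v))"

text \<open>
  \<open>M\<close> is (a copy of) the simple module \<open>L(w)\<close>, which is determined up to isomorphism by being
  simple with highest weight \<open>w\<close>.
\<close>

definition is_L :: "weight \<Rightarrow> ('k::field, 'v) gmodule \<Rightarrow> bool" where
  "is_L w M \<longleftrightarrow> simple_gmodule M \<and> is_weight w M \<and> (\<forall>v. is_weight v M \<longrightarrow> weight_le v w)"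

text \<open>
  The induced module \<open>H\<^sup>0(w)\<close>: functions \<open>f\<close> with \<open>f(gb) = w(b)\<^sup>-\<^sup>1 f(g)\<close>, with left translation.
\<close>

definition H0 :: "weight \<Rightarrow> ('k::field, 'k mat4 \<Rightarrow> 'k) gmodule" where
  "H0 w =
    \<lparr>carrier = {f \<in> carrier coord_ring. \<forall>g\<in>carrier Sp4. \<forall>b\<in>borel.
                  f (g \<otimes>\<^bsub>Sp4\<^esub> b) = inverse (weight_char w b) * f g},
     mult = mult coord_ring, one = one coord_ring,
     zero = zero coord_ring, add = add coord_ring,
     smult = (\<lambda>c f. \<lambda>g\<in>carrier Sp4. c * f g),
     act = (\<lambda>x f. \<lambda>g\<in>carrier Sp4. f (inv\<^bsub>Sp4\<^esub> x \<otimes>\<^bsub>Sp4\<^esub> g))\<rparr>"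

text \<open>On the elements of \<open>a_rcosets\<^bsub>M\<^esub> N\<close>, scalars and \<open>Sp\<^sub>4\<close> act through representatives.\<close>

definition quot_gmodule :: "('k::field, 'v) gmodule \<Rightarrow> 'v set \<Rightarrow> ('k, 'v set) gmodule" where
  "quot_gmodule M N =
    \<lparr>carrier = a_rcosets\<^bsub>M\<^esub> N, mult = undefined, one = undefined,
     zero = N, add = set_add M,
     smult = (\<lambda>c C. \<Union>v\<in>C. N +>\<^bsub>M\<^esub> (c \<odot>\<^bsub>M\<^esub> v)),
     act = (\<lambda>g C. \<Union>v\<in>C. N +>\<^bsub>M\<^esub> act M g v)\<rparr>"


section \<open>The special isogeny and its kernel\<close>

definition frobenius :: "'k::field mat4 \<Rightarrow> 'k mat4" where
  "frobenius A = (\<chi> i j. (A $ i $ j) ^ 2)"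

text \<open>
  The last two conditions say that composition with \<open>\<tau>\<close> takes \<open>\<omega>\<^sub>1\<close> to \<open>\<omega>\<^sub>2\<close> and \<open>\<omega>\<^sub>2\<close> to \<open>2\<omega>\<^sub>1\<close>.
  That \<open>\<tau>\<close> is a purely inseparable isogeny follows from \<open>\<tau>\<^sup>2\<close> being the Frobenius map. In
  characteristic 2 an example sends \<open>A\<close> to the matrix of its 2 by 2 minors on the rows and columns
  \<open>{1,2}\<close>, \<open>{1,3}\<close>, \<open>{2,4}\<close>, \<open>{3,4}\<close>.
\<close>

definition special_isogeny :: "('k::field mat4 \<Rightarrow> 'k mat4) \<Rightarrow> bool" where
  "special_isogeny \<tau> \<longleftrightarrow>
    \<tau> \<in> hom Sp4 Sp4 \<and>
    (\<forall>i j. (\<lambda>g\<in>carrier Sp4. \<tau> g $ i $ j) \<in> carrier coord_ring) \<and>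
    (\<forall>g\<in>carrier Sp4. \<tau> (\<tau> g) = frobenius g) \<and>
    \<tau> ` torus \<subseteq> torus \<and> \<tau> ` borel \<subseteq> borel \<and>
    (\<forall>t\<in>torus. weight_char \<omega>\<^sub>1 (\<tau> t) = weight_char \<omega>\<^sub>2 t) \<and>
    (\<forall>t\<in>torus. weight_char \<omega>\<^sub>2 (\<tau> t) = weight_char (2, 0) t)"

text \<open>
  The ideal of the scheme-theoretic kernel \<open>G\<^sub>\<tau>\<close>, generated by the comorphism image of the
  augmentation ideal; \<open>k[G\<^sub>\<tau>]\<close> is the quotient of \<open>k[Sp\<^sub>4]\<close> by it.
\<close>

definition ker_ideal :: "('k::field mat4 \<Rightarrow> 'k mat4) \<Rightarrow> ('k mat4 \<Rightarrow> 'k) set" where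
  "ker_ideal \<tau> = Idl\<^bsub>coord_ring\<^esub>
    {\<lambda>g\<in>carrier Sp4. f (\<tau> g) | f. f \<in> carrier coord_ring \<and> f \<one>\<^bsub>Sp4\<^esub> = 0}"

text \<open>The ideal of \<open>G\<^sub>\<tau> \<times> G\<^sub>\<tau>\<close> in \<open>k[Sp\<^sub>4 \<times> Sp\<^sub>4]\<close> is \<open>I \<otimes> k[Sp\<^sub>4] + k[Sp\<^sub>4] \<otimes> I\<close>, spanned by these products.\<close>

definition ker_ideal2_gens ::
    "('k::field mat4 \<Rightarrow> 'k mat4) \<Rightarrow> ('k mat4 \<times> 'k mat4 \<Rightarrow> 'k) set" where
  "ker_ideal2_gens \<tau> = {\<lambda>(g, h). a g * b h | a b.
    a \<in> carrier coord_ring \<and> b \<in> carrier coord_ring \<and> (a \<in> ker_ideal \<tau> \<or> b \<in> ker_ideal \<tau>)}"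

text \<open>
  The twist by \<open>\<tau>\<close> and its inverse operation. As \<open>\<tau>\<close> is bijective on points, the untwist is always
  an action of the abstract group; it is rational if \<open>G\<^sub>\<tau>\<close> acts trivially.
\<close>

definition twist :: "('k::field mat4 \<Rightarrow> 'k mat4) \<Rightarrow> ('k, 'v) gmodule \<Rightarrow> ('k, 'v) gmodule" where
  "twist \<tau> M = M\<lparr>act := \<lambda>g. act M (\<tau> g)\<rparr>"

definition untwist :: "('k::field mat4 \<Rightarrow> 'k mat4) \<Rightarrow> ('k, 'v) gmodule \<Rightarrow> ('k, 'v) gmodule" where
  "untwist \<tau> M = M\<lparr>act := \<lambda>g. act M (inv_into (carrier Sp4) \<tau> g)\<rparr>"

lemma frobenius_inj:
  assumes "CHAR('k::field) = 2"
  shows "inj (frobenius :: 'k mat4 \<Rightarrow> 'k mat4)"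
proof (rule injI)
  have char2: "(2 :: 'k) = 0"
    using of_nat_CHAR[where 'a = 'k] assms by simp
  have sq: "x = y" if "x ^ 2 = y ^ 2" for x y :: 'k
  proof -
    have "(x - y) ^ 2 = x ^ 2 - y ^ 2 + 2 * (y ^ 2 - x * y)"
      by (simp add: power2_eq_square algebra_simps)
    then show ?thesis using that char2 by simp
  qed
  fix A B :: "'k mat4"
  assume "frobenius A = frobenius B"
  then show "A = B"
    by (auto simp: frobenius_def vec_eq_iff intro: sq)
qed

lemma special_isogeny_inj_on:
  assumes "CHAR('k::field) = 2" "special_isogeny (\<tau> :: 'k mat4 \<Rightarrow> 'k mat4)"
  shows "inj_on \<tau> (carrier Sp4)"
  using assms injD[OF frobenius_inj[OF assms(1)]]
  by (intro inj_onI) (metis special_isogeny_def)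

lemma act_twist_untwist:
  assumes "CHAR('k::field) = 2" "special_isogeny (\<tau> :: 'k mat4 \<Rightarrow> 'k mat4)" "g \<in> carrier Sp4"
  shows "act (twist \<tau> (untwist \<tau> M)) g = act M g"
  using inv_into_f_f[OF special_isogeny_inj_on[OF assms(1,2)] assms(3)]
  by (simp add: twist_def untwist_def)


section \<open>First cohomology of the kernel\<close>

text \<open>
  Hochschild cohomology. The \<open>n\<close>-cochains of \<open>G\<^sub>\<tau>\<close> with values in \<open>M\<close> are \<open>M \<otimes> k[G\<^sub>\<tau>]\<^bsup>\<otimes>n\<^esup>\<close>; they are
  written as morphisms from \<open>Sp\<^sub>4\<^sup>n\<close> to \<open>M\<close> modulo those with coefficients in the ideal of \<open>G\<^sub>\<tau>\<^sup>n\<close>, and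
  the differentials are induced by those of \<open>Sp\<^sub>4\<close>. The action of \<open>Sp\<^sub>4\<close> comes from conjugation on
  \<open>G\<^sub>\<tau>\<close> and the given action on \<open>M\<close>.
\<close>

definition cochains1 :: "('k::field, 'v) gmodule \<Rightarrow> ('k, 'k mat4 \<Rightarrow> 'v) gmodule" where
  "cochains1 M =
    \<lparr>carrier = tensor_maps (carrier Sp4) (carrier coord_ring) M,
     mult = undefined, one = undefined,
     zero = (\<lambda>g\<in>carrier Sp4. \<zero>\<^bsub>M\<^esub>),
     add = (\<lambda>f h. \<lambda>g\<in>carrier Sp4. f g \<oplus>\<^bsub>M\<^esub> h g),
     smult = (\<lambda>c f. \<lambda>g\<in>carrier Sp4. c \<odot>\<^bsub>M\<^esub> f g),
     act = (\<lambda>x f. \<lambda>g\<in>carrier Sp4. act M x (f (inv\<^bsub>Sp4\<^esub> x \<otimes>\<^bsub>Sp4\<^esub> g \<otimes>\<^bsub>Sp4\<^esub> x)))\<rparr>"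

definition diff0 :: "('k::field, 'v) gmodule \<Rightarrow> 'v \<Rightarrow> 'k mat4 \<Rightarrow> 'v" where
  "diff0 M v = (\<lambda>g\<in>carrier Sp4. act M g v \<ominus>\<^bsub>M\<^esub> v)"

definition diff1 ::
    "('k::field, 'v) gmodule \<Rightarrow> ('k mat4 \<Rightarrow> 'v) \<Rightarrow> 'k mat4 \<times> 'k mat4 \<Rightarrow> 'v" where
  "diff1 M f = (\<lambda>(g, h)\<in>carrier Sp4 \<times> carrier Sp4.
    act M g (f h) \<ominus>\<^bsub>M\<^esub> f (g \<otimes>\<^bsub>Sp4\<^esub> h) \<oplus>\<^bsub>M\<^esub> f g)"

text \<open>
  The cocycles and coboundaries of \<open>G\<^sub>\<tau>\<close>, as their preimages in the morphisms from \<open>Sp\<^sub>4\<close> to \<open>M\<close>.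
\<close>

definition cocycles1 ::
    "('k::field mat4 \<Rightarrow> 'k mat4) \<Rightarrow> ('k, 'v) gmodule \<Rightarrow> ('k mat4 \<Rightarrow> 'v) set" where
  "cocycles1 \<tau> M = {f \<in> carrier (cochains1 M).
    diff1 M f \<in> tensor_maps (carrier Sp4 \<times> carrier Sp4) (ker_ideal2_gens \<tau>) M}"

definition coboundaries1 ::
    "('k::field mat4 \<Rightarrow> 'k mat4) \<Rightarrow> ('k, 'v) gmodule \<Rightarrow> ('k mat4 \<Rightarrow> 'v) set" where
  "coboundaries1 \<tau> M =
    diff0 M ` carrier M <+>\<^bsub>cochains1 M\<^esub> tensor_maps (carrier Sp4) (ker_ideal \<tau>) M"

definition H1_ker ::
    "('k::field mat4 \<Rightarrow> 'k mat4) \<Rightarrow> ('k, 'v) gmodule \<Rightarrow> ('k, ('k mat4 \<Rightarrow> 'v) set) gmodule" where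
  "H1_ker \<tau> M = quot_gmodule ((cochains1 M)\<lparr>carrier := cocycles1 \<tau> M\<rparr>) (coboundaries1 \<tau> M)"

end

theory Submission
  imports Defs
begin

text \<open>
  A special isogeny is determined by its values on root subgroups: up to conjugation by the torus it
  is the map \<open>minors\<close> given by the action of \<open>Sp\<^sub>4\<close> on the four-dimensional subquotient of
  \<open>\<Lambda>\<^sup>2V\<close>. Hence the ideal \<open>I\<close> of \<open>G\<^sub>\<tau>\<close> is generated by the entries of \<open>minors g - 1\<close>. The four left
  invariant derivations along the short roots preserve \<open>I\<close>, and so does their commutator, the Euler
  derivation, which comes from the central \<open>\<mu>\<^sub>2\<close> in \<open>G\<^sub>\<tau>\<close>. Modulo \<open>I\<close> every regular function is a
  polynomial in five entries of the generic matrix, and a function that these derivations send into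
  \<open>I\<close> is constant modulo \<open>I\<close>.

  For trivial coefficients a cocycle \<open>f\<close> is additive modulo \<open>I\<close>, so its derivatives are constant
  modulo \<open>I\<close>. The remaining minors \<open>phi j\<close> describe the extension of the subquotient by the invariant
  line in \<open>\<Lambda>\<^sup>2V\<close>. They are additive modulo \<open>I\<close> and dual to the four derivations, hence a basis of the
  cohomology; conjugation acts on them through \<open>minors\<close>, that is, by the twisted natural module.
  For coefficients in \<open>H\<^sup>0(\<omega>\<^sub>1)\<close>, the natural module, the central \<open>\<mu>\<^sub>2\<close> acts by its nontrivial character:
  applying the Euler derivation to the cocycle identity in either variable shows that the cocycle is
  a coboundary.
\<close>

section \<open>Polynomial functions in one variable\<close>

text \<open>The identity is the only point of the kernel, so its functions cannot be studied through
  their values and every argument is a congruence modulo \<open>I\<close>. Functions on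
  \<open>Sp4\<close> are lifted to polynomials on all matrices, where derivations are plain
  directional derivatives; \<open>kid\<close> is the lift of \<open>I\<close>. The Lie algebra of
  the kernel has dimension five: four short root vectors and the commutator of an opposite pair,
  \<open>diag(1,-1,1,-1)\<close>, which is the identity matrix in characteristic 2. This matches the
  five generators. Each squares to a constant modulo \<open>I\<close>, so the quotient has dimension
  at most 32, and this bound suffices: the generators are eliminated one at a time, each by a
  derivation that kills the remaining ones and sends this one to a unit. The induced modules must be
  computed as well. The weights 0 and \<open>\<omega>\<^sub>1\<close> are orthogonal to the long
  simple root, so an element of \<open>H0\<close> depends only on the last column of its argument.
  It becomes a homogeneous function of degree 0 or 1 on nonzero vectors, and restriction to
  projective lines shows that it is constant or linear.\<close>

lemma infinite_alg_closed: "infinite (UNIV :: 'k::alg_closed_field set)"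
proof
  assume fin: "finite (UNIV :: 'k set)"
  define p :: "'k poly" where "p = (\<Prod>a\<in>UNIV. [:- a, 1:]) + 1"
  have deg: "degree (\<Prod>a\<in>(UNIV::'k set). [:- a, 1:]) = card (UNIV :: 'k set)"
    by (subst degree_prod_eq_sum_degree) auto
  have "card (UNIV :: 'k set) > 0" using fin by (simp add: card_gt_0_iff)
  then have "degree p > 0" unfolding p_def by (subst degree_add_eq_left) (auto simp: deg)
  then obtain x where "poly p x = 0" using alg_closed_imp_poly_has_root by blast
  moreover have "poly p x = 1" using fin by (auto simp: p_def poly_prod intro!: prod_zero)
  ultimately show False by simp
qed

lemma alg_closed_square_root: "\<exists>y::'k::alg_closed_field. y ^ 2 = x"
  using nth_root_exists[of 2 x] by auto

lemma poly_eqI_infinite: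
  fixes p q :: "'k::idom poly"
  assumes "infinite A" "\<And>x. x \<in> A \<Longrightarrow> poly p x = poly q x"
  shows "p = q"
proof (rule ccontr)
  assume "p \<noteq> q"
  then have "finite {x. poly (p - q) x = 0}" by (intro poly_roots_finite) auto
  moreover have "A \<subseteq> {x. poly (p - q) x = 0}" using assms(2) by auto
  ultimately show False using assms(1) finite_subset by blast
qed

lemma poly_eqI_nonzero:
  fixes p q :: "'k::alg_closed_field poly"
  assumes "\<And>x. x \<noteq> 0 \<Longrightarrow> poly p x = poly q x"
  shows "p = q"
  by (rule poly_eqI_infinite[of "- {0}"])
     (use assms infinite_alg_closed in \<open>auto simp: Compl_eq_Diff_UNIV\<close>)

definition polyfun :: "('k::alg_closed_field \<Rightarrow> 'k) \<Rightarrow> bool" where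
  "polyfun u \<longleftrightarrow> (\<exists>p. \<forall>t. u t = poly p t)"

text \<open>The derivative at 0. The choice is harmless on polynomial functions: over an infinite
  field the function determines its polynomial.\<close>

definition dcoef :: "('k::alg_closed_field \<Rightarrow> 'k) \<Rightarrow> 'k" where
  "dcoef u = coeff (SOME p. \<forall>t. u t = poly p t) 1"

lemma dcoef_poly [simp]: "dcoef (poly p) = coeff p 1"
proof -
  have "(SOME q. \<forall>t. poly p t = poly q t) = p"
    by (rule some_equality) (auto intro: poly_eqI_nonzero)
  then show ?thesis by (simp add: dcoef_def)
qed

lemma polyfunE:
  assumes "polyfun u" obtains p where "u = poly p"
  using assms by (auto simp: polyfun_def)

lemma polyfun_poly [simp, intro]: "polyfun (poly p)"
  by (auto simp: polyfun_def)

lemma polyfun_const [simp, intro]: "polyfun (\<lambda>_. c)"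
  unfolding polyfun_def by (rule exI[of _ "[:c:]"]) simp

lemma polyfun_linear [simp, intro]: "polyfun (\<lambda>t. a + t * b)"
  unfolding polyfun_def by (rule exI[of _ "[:a, b:]"]) simp

lemma polyfun_id [simp, intro]: "polyfun (\<lambda>t. t)"
  using polyfun_linear[of 0 1] by simp

lemma polyfun_add [intro]: "polyfun u \<Longrightarrow> polyfun v \<Longrightarrow> polyfun (\<lambda>t. u t + v t)"
  by (auto simp: polyfun_def simp flip: poly_add)

lemma polyfun_mult [intro]: "polyfun u \<Longrightarrow> polyfun v \<Longrightarrow> polyfun (\<lambda>t. u t * v t)"
  by (auto simp: polyfun_def simp flip: poly_mult)

lemma polyfun_sum [intro]:
  "(\<And>i. i \<in> A \<Longrightarrow> polyfun (u i)) \<Longrightarrow> polyfun (\<lambda>t. \<Sum>i\<in>A. u i t)"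
  by (induction A rule: infinite_finite_induct) (auto intro: polyfun_add)

lemma dcoef_const [simp]: "dcoef (\<lambda>_. c) = 0"
proof -
  have "(\<lambda>_. c) = poly [:c:]" by auto
  then show ?thesis by (metis dcoef_poly coeff_pCons_Suc One_nat_def coeff_0)
qed

lemma dcoef_linear [simp]: "dcoef (\<lambda>t. a + t * b) = b"
proof -
  have "(\<lambda>t. a + t * b) = poly [:a, b:]" by auto
  then show ?thesis using dcoef_poly[of "[:a, b:]"] by simp
qed

lemma dcoef_add:
  assumes "polyfun u" "polyfun v"
  shows "dcoef (\<lambda>t. u t + v t) = dcoef u + dcoef v"
proof -
  obtain p q where "u = poly p" "v = poly q" using assms by (meson polyfunE)
  moreover have "(\<lambda>t. poly p t + poly q t) = poly (p + q)" by auto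
  ultimately show ?thesis by simp
qed

lemma dcoef_mult:
  assumes "polyfun u" "polyfun v"
  shows "dcoef (\<lambda>t. u t * v t) = u 0 * dcoef v + dcoef u * v 0"
proof -
  obtain p q where pq: "u = poly p" "v = poly q" using assms by (meson polyfunE)
  have "(\<lambda>t. u t * v t) = poly (p * q)" by (auto simp: pq)
  then show ?thesis by (simp add: pq coeff_mult poly_0_coeff_0)
qed

lemma dcoef_cmult:
  assumes "polyfun u"
  shows "dcoef (\<lambda>t. c * u t) = c * dcoef u"
  using dcoef_mult[of "\<lambda>_. c" u] assms by simp

lemma dcoef_sum:
  assumes "\<And>i. i \<in> A \<Longrightarrow> polyfun (u i)"
  shows "dcoef (\<lambda>t. \<Sum>i\<in>A. u i t) = (\<Sum>i\<in>A. dcoef (u i))"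
  using assms
proof (induction A rule: infinite_finite_induct)
  case (insert x A)
  then show ?case by (simp add: dcoef_add polyfun_sum)
qed auto

section \<open>Derivations of polynomial functions on matrices\<close>

definition shift :: "'k::field mat4 \<Rightarrow> 'k mat4 \<Rightarrow> 'k \<Rightarrow> 'k mat4" where
  "shift A Y t = (\<chi> i j. A $ i $ j + t * Y $ i $ j)"

text \<open>The directional derivative at \<open>A\<close> along \<open>Y\<close>. It depends only
  on values along the line, so functions that agree on \<open>Sp4\<close> have equal derivatives
  whenever the line stays inside \<open>Sp4\<close>.\<close>

definition lin :: "('k::alg_closed_field mat4 \<Rightarrow> 'k) \<Rightarrow> 'k mat4 \<Rightarrow> 'k mat4 \<Rightarrow> 'k" where
  "lin f A Y = dcoef (\<lambda>t. f (shift A Y t))"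

lemma shift_nth [simp]: "shift A Y t $ i $ j = A $ i $ j + t * Y $ i $ j"
  by (simp add: shift_def)

lemma shift_0 [simp]: "shift A Y 0 = A"
  by (simp add: vec_eq_iff)

lemma matrix_mult_nth: "(A ** B) $ i $ j = (\<Sum>l\<in>UNIV. A $ i $ l * B $ l $ j)"
  by (simp add: matrix_matrix_mult_def)

lemma shift_mult_left: "C ** shift A Y t = shift (C ** A) (C ** Y) t"
  by (simp add: vec_eq_iff matrix_mult_nth sum.distrib sum_distrib_left algebra_simps)

lemma shift_mult_right: "shift A Y t ** C = shift (A ** C) (Y ** C) t"
  by (simp add: vec_eq_iff matrix_mult_nth sum.distrib sum_distrib_left algebra_simps)

lemma poly_funs_sum:
  "(\<And>i. i \<in> I \<Longrightarrow> u i \<in> poly_funs) \<Longrightarrow> (\<lambda>A. \<Sum>i\<in>I. u i A) \<in> poly_funs"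
  by (induction I rule: infinite_finite_induct) (auto intro: poly_funs.intros)

lemma poly_funs_cmult: "u \<in> poly_funs \<Longrightarrow> (\<lambda>A. c * u A) \<in> poly_funs"
  by (auto intro: poly_funs.intros)

lemma poly_funs_uminus: "u \<in> poly_funs \<Longrightarrow> (\<lambda>A. - u A) \<in> poly_funs"
  using poly_funs_cmult[of u "- 1"] by simp

lemma poly_funs_diff: "u \<in> poly_funs \<Longrightarrow> v \<in> poly_funs \<Longrightarrow> (\<lambda>A. u A - v A) \<in> poly_funs"
  using poly_funs.add[OF _ poly_funs_uminus, of u v] by simp

lemma poly_funs_compose:
  assumes "f \<in> poly_funs" "\<And>i j. (\<lambda>A. u A $ i $ j) \<in> poly_funs"
  shows "(\<lambda>A. f (u A)) \<in> poly_funs"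
  using assms(1) by induction (auto intro: poly_funs.intros assms(2))

lemma polyfun_curve:
  assumes "f \<in> poly_funs" "\<And>i j. polyfun (\<lambda>t. c t $ i $ j)"
  shows "polyfun (\<lambda>t. f (c t))"
  using assms(1) by induction (auto intro: assms(2))

lemma polyfun_shift [simp, intro]: "f \<in> poly_funs \<Longrightarrow> polyfun (\<lambda>t. f (shift A Y t))"
  by (rule polyfun_curve) auto

lemma lin_const [simp]: "lin (\<lambda>_. c) A Y = 0"
  and lin_entry [simp]: "lin (\<lambda>A. A $ i $ j) A Y = Y $ i $ j"
  by (simp_all add: lin_def)

lemma lin_add [simp]:
  "f \<in> poly_funs \<Longrightarrow> h \<in> poly_funs \<Longrightarrow> lin (\<lambda>A. f A + h A) A Y = lin f A Y + lin h A Y"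
  by (simp add: lin_def dcoef_add)

lemma lin_mult [simp]:
  "f \<in> poly_funs \<Longrightarrow> h \<in> poly_funs \<Longrightarrow>
    lin (\<lambda>A. f A * h A) A Y = f A * lin h A Y + lin f A Y * h A"
  by (simp add: lin_def dcoef_mult)

lemma lin_cmult: "f \<in> poly_funs \<Longrightarrow> lin (\<lambda>A. c * f A) A Y = c * lin f A Y"
  by (simp add: poly_funs.const)

lemma lin_diff:
  "f \<in> poly_funs \<Longrightarrow> h \<in> poly_funs \<Longrightarrow> lin (\<lambda>A. f A - h A) A Y = lin f A Y - lin h A Y"
  using lin_add[of f "\<lambda>A. - 1 * h A" A Y] by (simp add: lin_cmult poly_funs_cmult poly_funs_uminus
    del: lin_add lin_mult) (use lin_cmult[of h "-1"] in simp)

lemma lin_sum: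
  "(\<And>i. i \<in> I \<Longrightarrow> u i \<in> poly_funs) \<Longrightarrow>
    lin (\<lambda>A. \<Sum>i\<in>I. u i A) A Y = (\<Sum>i\<in>I. lin (u i) A Y)"
  by (simp add: lin_def dcoef_sum)

lemma lin_mult_left: "lin (\<lambda>A. f (C ** A)) A Y = lin f (C ** A) (C ** Y)"
  and lin_mult_right: "lin (\<lambda>A. f (A ** C)) A Y = lin f (A ** C) (Y ** C)"
  by (simp_all add: lin_def shift_mult_left shift_mult_right)

text \<open>The left invariant derivation that corresponds to the tangent vector \<open>X\<close> at the identity.\<close>

definition lderiv :: "'k::alg_closed_field mat4 \<Rightarrow> ('k mat4 \<Rightarrow> 'k) \<Rightarrow> 'k mat4 \<Rightarrow> 'k" where
  "lderiv X f A = lin f A (A ** X)"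

lemma lderiv_simps [simp]:
  "lderiv X (\<lambda>_. c) = (\<lambda>A. 0)"
  "lderiv X (\<lambda>A. A $ i $ j) = (\<lambda>A. (A ** X) $ i $ j)"
  "f \<in> poly_funs \<Longrightarrow> h \<in> poly_funs \<Longrightarrow>
    lderiv X (\<lambda>A. f A + h A) = (\<lambda>A. lderiv X f A + lderiv X h A)"
  "f \<in> poly_funs \<Longrightarrow> h \<in> poly_funs \<Longrightarrow>
    lderiv X (\<lambda>A. f A * h A) = (\<lambda>A. f A * lderiv X h A + lderiv X f A * h A)"
  by (auto simp: lderiv_def)

lemma lderiv_sum:
  "(\<And>i. i \<in> I \<Longrightarrow> u i \<in> poly_funs) \<Longrightarrow>
    lderiv X (\<lambda>A. \<Sum>i\<in>I. u i A) = (\<lambda>A. \<Sum>i\<in>I. lderiv X (u i) A)"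
  by (auto simp: lderiv_def lin_sum)

lemma poly_funs_matrix_mult_left: "(\<lambda>A. (C ** A) $ i $ j) \<in> poly_funs"
  and poly_funs_matrix_mult_right: "(\<lambda>A. (A ** C) $ i $ j) \<in> poly_funs"
  unfolding matrix_mult_nth by (intro poly_funs_sum poly_funs.intros)+

lemma lderiv_in_poly_funs [simp, intro]: "f \<in> poly_funs \<Longrightarrow> lderiv X f \<in> poly_funs"
  by (induction rule: poly_funs.induct)
     (auto intro: poly_funs.intros poly_funs_matrix_mult_right)

text \<open>Left invariance: multiplication by \<open>C\<close> carries the line through
  \<open>A\<close> along \<open>A ** X\<close> to the line through \<open>C ** A\<close> along
  \<open>C ** A ** X\<close>.\<close>

lemma lderiv_left_mult: "lderiv X (\<lambda>A. f (C ** A)) A = lderiv X f (C ** A)"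
  by (simp add: lderiv_def lin_mult_left matrix_mul_assoc)

text \<open>A commutator of derivations is a derivation, because the mixed terms in the product rule
  cancel. It therefore suffices to compare both sides on matrix entries.\<close>

lemma lderiv_commutator:
  assumes "f \<in> poly_funs"
  shows "lderiv X (lderiv Y f) A - lderiv Y (lderiv X f) A = lderiv (X ** Y - Y ** X) f A"
  using assms
proof induction
  case (entry i j)
  have *: "lderiv X (\<lambda>A. (A ** Y) $ i $ j) A = (A ** X ** Y) $ i $ j" for X Y
    by (simp add: lderiv_def lin_def shift_mult_right)
  have "A ** X ** Y - A ** Y ** X = A ** (X ** Y - Y ** X)"
    by (simp add: vec_eq_iff matrix_mult_nth matrix_mul_assoc[symmetric] sum_subtractf algebra_simps)
  then show ?case by (simp add: *) (metis vector_minus_component)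
next
  case (add f h)
  then show ?case by (simp add: algebra_simps)
next
  case (mult f h)
  then show ?case by (simp add: algebra_simps poly_funs.intros)
qed auto

section \<open>The symplectic group in characteristic 2\<close>

definition mk4 :: "'a::zero list list \<Rightarrow> 'a ^ 4 ^ 4" where
  "mk4 rs = vector (map vector rs)"

lemma vector_4 [simp]:
  "(vector [a, b, c, d] :: 'a::zero ^ 4) $ 1 = a" "(vector [a, b, c, d] :: 'a::zero ^ 4) $ 2 = b"
  "(vector [a, b, c, d] :: 'a::zero ^ 4) $ 3 = c" "(vector [a, b, c, d] :: 'a::zero ^ 4) $ 4 = d"
  unfolding vector_def by auto

lemma mk4_simps [simp]:
  "mk4 [r1, r2, r3, r4] $ 1 = vector r1" "mk4 [r1, r2, r3, r4] $ 2 = vector r2"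
  "mk4 [r1, r2, r3, r4] $ 3 = vector r3" "mk4 [r1, r2, r3, r4] $ 4 = vector r4"
  by (simp_all add: mk4_def)

lemma mat4_eq_iff:
  "(A :: 'a mat4) = B \<longleftrightarrow> (\<forall>i. A $ i $ 1 = B $ i $ 1 \<and> A $ i $ 2 = B $ i $ 2 \<and>
     A $ i $ 3 = B $ i $ 3 \<and> A $ i $ 4 = B $ i $ 4)"
  by (simp add: vec_eq_iff forall_4)

lemma mult4: "((A :: 'a::semiring_1 mat4) ** B) $ i $ j =
    A $ i $ 1 * B $ 1 $ j + A $ i $ 2 * B $ 2 $ j + A $ i $ 3 * B $ 3 $ j + A $ i $ 4 * B $ 4 $ j"
  by (simp add: matrix_mult_nth sum_4 add.assoc)

lemma mat_nth: "(mat c :: 'a::zero ^ 'n ^ 'n) $ i $ j = (if i = j then c else 0)"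
  by (simp add: mat_def)

section \<open>Two by two minors and the exterior square\<close>

definition minor :: "4 \<Rightarrow> 4 \<Rightarrow> 4 \<Rightarrow> 4 \<Rightarrow> 'k::field mat4 \<Rightarrow> 'k" where
  "minor a b c d A = A $ a $ c * A $ b $ d - A $ a $ d * A $ b $ c"

text \<open>The Cauchy-Binet formula, with the four pairs of \<open>pfst\<close> and
  \<open>psnd\<close> first and the pairs 14 and 23 last.\<close>

lemma minor_mult:
  "minor a b c d (A ** B) =
    minor a b 1 2 A * minor 1 2 c d B + minor a b 1 3 A * minor 1 3 c d B +
    minor a b 2 4 A * minor 2 4 c d B + minor a b 3 4 A * minor 3 4 c d B +
    minor a b 1 4 A * minor 1 4 c d B + minor a b 2 3 A * minor 2 3 c d B"
  by (simp add: minor_def mult4 algebra_simps)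

text \<open>
  Index pairs of the four-dimensional subquotient of the exterior square. The symplectic form vanishes
  on them, unlike on the remaining pairs 14 and 23.
\<close>

definition pfst :: "4 \<Rightarrow> 4" where "pfst i = (vector [1, 1, 2, 3] :: 4 ^ 4) $ i"
definition psnd :: "4 \<Rightarrow> 4" where "psnd i = (vector [2, 3, 4, 4] :: 4 ^ 4) $ i"

lemma pair_simps [simp]:
  "pfst 1 = 1" "pfst 2 = 1" "pfst 3 = 2" "pfst 4 = 3"
  "psnd 1 = 2" "psnd 2 = 3" "psnd 3 = 4" "psnd 4 = 4"
  by (simp_all add: pfst_def psnd_def)

definition minors :: "'k::field mat4 \<Rightarrow> 'k mat4" where
  "minors A = (\<chi> i j. minor (pfst i) (psnd i) (pfst j) (psnd j) A)"

definition phi :: "4 \<Rightarrow> 'k::field mat4 \<Rightarrow> 'k" where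
  "phi j A = minor 1 4 (pfst j) (psnd j) A"

lemma minors_nth: "minors A $ i $ j = minor (pfst i) (psnd i) (pfst j) (psnd j) A"
  by (simp add: minors_def)

lemma minor_in_poly_funs [simp, intro]: "minor a b c d \<in> poly_funs"
  unfolding minor_def[abs_def] by (intro poly_funs_diff poly_funs.mult poly_funs.entry)

lemma minors_in_poly_funs [simp, intro]: "(\<lambda>A. minors A $ i $ j) \<in> poly_funs"
  by (simp add: minors_nth)

lemma phi_in_poly_funs [simp, intro]: "phi j \<in> poly_funs"
  unfolding phi_def[abs_def] by simp

lemma distinct4 [simp]:
  "(1::4) \<noteq> 2" "(1::4) \<noteq> 3" "(1::4) \<noteq> 4" "(2::4) \<noteq> 3" "(2::4) \<noteq> 4" "(3::4) \<noteq> 4"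
  "(2::4) \<noteq> 1" "(3::4) \<noteq> 1" "(4::4) \<noteq> 1" "(3::4) \<noteq> 2" "(4::4) \<noteq> 2" "(4::4) \<noteq> 3"
  by simp_all

lemma symp_form_nth [simp]:
  "symp_form $ 1 = vector [0, 0, 0, 1]" "symp_form $ 2 = vector [0, 0, 1, 0]"
  "symp_form $ 3 = vector [0, - 1, 0, 0]" "symp_form $ 4 = vector [- 1, 0, 0, 0]"
  by (simp_all add: symp_form_def)

lemma Sp4_simps [simp]: "mult Sp4 = (**)" "one Sp4 = mat 1"
  by (simp_all add: Sp4_def)

lemma Sp4_mult [simp, intro]:
  "A \<in> carrier Sp4 \<Longrightarrow> B \<in> carrier Sp4 \<Longrightarrow> A ** B \<in> carrier (Sp4 :: 'k::field mat4 monoid)"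
  by (simp add: Sp4_def matrix_transpose_mul) (metis matrix_mul_assoc)

lemma Sp4_one [simp, intro]: "mat 1 \<in> carrier (Sp4 :: 'k::field mat4 monoid)"
  by (simp add: Sp4_def)

text \<open>The form pairs index 1 with 4 and 2 with 3, so each entry of
  \<open>transpose A ** symp_form ** A\<close> is a sum of two minors. Symplecticity is thus a
  linear condition on the exterior square.\<close>

lemma Sp4_columns_iff:
  "A \<in> carrier Sp4 \<longleftrightarrow> (\<forall>c d. minor 1 4 c d A + minor 2 3 c d A = symp_form $ c $ d)"
proof -
  have "(transpose A ** symp_form ** A) $ c $ d = minor 1 4 c d A + minor 2 3 c d A" for c d
    by (simp add: mult4 transpose_def minor_def algebra_simps)
  then show ?thesis by (simp add: Sp4_def vec_eq_iff)
qed

locale char2 =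
  fixes ty :: "'k::alg_closed_field itself"
  assumes CHAR2: "CHAR('k) = 2"
begin

lemma two_eq_0 [simp]: "(2 :: 'k) = 0"
  using of_nat_CHAR[where 'a = 'k] CHAR2 by simp

lemma add_self [simp]: "(x :: 'k) + x = 0"
  by (metis mult_2 mult_zero_left two_eq_0)

lemma add_self_left [simp]: "(x :: 'k) + (x + y) = y"
  by (simp flip: add.assoc)

lemma uminus_eq [simp]: "- (x :: 'k) = x"
  by (metis add_self minus_unique)

lemma minus_eq: "(x :: 'k) - y = x + y"
  by (metis add_uminus_conv_diff uminus_eq)

lemma add_eq_0 [simp]: "(x :: 'k) + y = 0 \<longleftrightarrow> x = y"
  by (metis minus_eq right_minus_eq)

lemma symp_form_sq: "symp_form ** symp_form = (mat 1 :: 'k mat4)"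
  by (simp add: vec_eq_iff mult4 forall_4 mat_nth)

lemma symp_form_sym: "transpose symp_form = (symp_form :: 'k mat4)"
  by (simp add: vec_eq_iff forall_4 transpose_def)

definition sinv :: "'k mat4 \<Rightarrow> 'k mat4" where
  "sinv A = symp_form ** transpose A ** symp_form"

lemma sinv_left: "A \<in> carrier Sp4 \<Longrightarrow> sinv A ** A = mat 1"
  by (simp add: Sp4_def sinv_def symp_form_sq flip: matrix_mul_assoc)

lemma sinv_right: "A \<in> carrier Sp4 \<Longrightarrow> A ** sinv A = mat 1"
  using sinv_left matrix_left_right_inverse by blast

text \<open>A left inverse of a square matrix is a right inverse. Multiplying the resulting identity
  by \<open>symp_form\<close>, an involution here, gives the relation for the transpose.\<close>

lemma Sp4_transpose:
  assumes "A \<in> carrier (Sp4 :: 'k mat4 monoid)" shows "transpose A \<in> carrier Sp4"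
proof -
  have "A ** symp_form ** transpose A ** symp_form = mat 1"
    using sinv_right[OF assms] by (simp add: sinv_def matrix_mul_assoc)
  then have "A ** symp_form ** transpose A ** (symp_form ** symp_form) = symp_form"
    by (simp add: matrix_mul_assoc)
  then show ?thesis by (simp add: Sp4_def symp_form_sq)
qed

lemma sinv_closed [simp, intro]: "A \<in> carrier Sp4 \<Longrightarrow> sinv A \<in> carrier (Sp4 :: 'k mat4 monoid)"
  by (simp add: sinv_def Sp4_mult Sp4_transpose)
     (intro Sp4_mult Sp4_transpose, auto simp: Sp4_def symp_form_sym symp_form_sq)

lemma Sp4_group: "group (Sp4 :: 'k mat4 monoid)"
  by (rule groupI) (auto simp: matrix_mul_assoc intro: sinv_left)

lemma Sp4_inv: "A \<in> carrier Sp4 \<Longrightarrow> inv\<^bsub>Sp4\<^esub> A = (sinv A :: 'k mat4)"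
  by (rule group.inv_equality[OF Sp4_group]) (auto intro: sinv_left)

text \<open>In characteristic 2 the inverse is the reflection in the antidiagonal, without
  signs.\<close>

lemma sinv_nth: "sinv A $ i $ j = 
   (vector [vector [A$4$4, A$3$4, A$2$4, A$1$4], vector [A$4$3, A$3$3, A$2$3, A$1$3],
    vector [A$4$2, A$3$2, A$2$2, A$1$2], vector [A$4$1, A$3$1, A$2$1, A$1$1]] :: 'k mat4) $ i $ j"
  using exhaust_4[of i] exhaust_4[of j]
  by (auto simp: sinv_def mult4 transpose_def)

lemma Sp4_columns: "A \<in> carrier Sp4 \<Longrightarrow> minor 1 4 c d A + minor 2 3 c d A = (symp_form :: 'k mat4) $ c $ d"
  by (simp add: Sp4_columns_iff)

lemma Sp4_rows:
  assumes "A \<in> carrier Sp4"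
  shows "minor a b 1 4 A + minor a b 2 3 A = (symp_form :: 'k mat4) $ a $ b"
  using Sp4_columns[OF Sp4_transpose[OF assms], of a b]
  by (simp add: minor_def transpose_def mult.commute)

text \<open>In Cauchy-Binet the row relation replaces the pair 23 of \<open>A\<close> by 14, and the
  column relation replaces the pair 14 of \<open>B\<close> by 23. The product of
  \<open>minor a b 1 4 A\<close> and \<open>minor 2 3 c d B\<close> then occurs twice and vanishes
  in characteristic 2. This is why the four-dimensional block is multiplicative up to values of the
  form.\<close>

lemma minor_mult_Sp4:
  fixes A B :: "'k mat4"
  assumes "A \<in> carrier Sp4" "B \<in> carrier Sp4"
  shows "minor a b c d (A ** B) = (\<Sum>l\<in>UNIV. minor a b (pfst l) (psnd l) A * minor (pfst l) (psnd l) c d B)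
    + minor a b 1 4 A * symp_form $ c $ d + symp_form $ a $ b * minor 2 3 c d B"
proof -
  have r: "minor a b 2 3 A = minor a b 1 4 A + symp_form $ a $ b"
    using Sp4_rows[OF assms(1), of a b] by (metis add_self_left)
  have c: "minor 1 4 c d B = minor 2 3 c d B + symp_form $ c $ d"
    using Sp4_columns[OF assms(2), of c d] by (metis add_self_left add.commute)
  show ?thesis
    by (simp add: minor_mult r c sum_4 algebra_simps)
qed

lemma minors_mult:
  fixes A B :: "'k mat4"
  assumes "A \<in> carrier Sp4" "B \<in> carrier Sp4"
  shows "minors (A ** B) = minors A ** minors B"
proof -
  have "symp_form $ pfst i $ psnd i = (0::'k)" for i
    using exhaust_4[of i] by auto
  then show ?thesis
    by (simp add: vec_eq_iff minors_nth minor_mult_Sp4[OF assms] matrix_mult_nth)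
qed

text \<open>The off-diagonal block of a block triangular representation satisfies a crossed
  homomorphism rule. Where \<open>minors\<close> is the identity, the rule becomes
  additivity.\<close>

lemma phi_mult:
  fixes A B :: "'k mat4"
  assumes "A \<in> carrier Sp4" "B \<in> carrier Sp4"
  shows "phi j (A ** B) = phi j B + (\<Sum>l\<in>UNIV. phi l A * minors B $ l $ j)"
proof -
  have "symp_form $ pfst j $ psnd j = (0::'k)" using exhaust_4[of j] by auto
  moreover from this have "minor 2 3 (pfst j) (psnd j) B = phi j B"
    using Sp4_columns[OF assms(2), of "pfst j" "psnd j"] by (simp add: phi_def)
  ultimately show ?thesis
    by (simp add: phi_def minors_nth minor_mult_Sp4[OF assms])
qed

lemma minors_one [simp]: "minors (mat 1) = (mat 1 :: 'k mat4)"
  by (simp add: vec_eq_iff forall_4 minors_nth minor_def mat_nth)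

lemma phi_one [simp]: "phi j (mat 1) = (0 :: 'k)"
  using exhaust_4[of j] by (auto simp: phi_def minor_def mat_nth)

subsection \<open>Generation by root subgroups\<close>

text \<open>Root subgroups of the short simple root (\<open>x1\<close>), the long simple root
  (\<open>x2\<close>) and their negatives (\<open>y1\<close>, \<open>y2\<close>).\<close>

definition x1 :: "'k \<Rightarrow> 'k mat4" where "x1 t = mk4 [[1,t,0,0],[0,1,0,0],[0,0,1,t],[0,0,0,1]]"
definition y1 :: "'k \<Rightarrow> 'k mat4" where "y1 t = mk4 [[1,0,0,0],[t,1,0,0],[0,0,1,0],[0,0,t,1]]"
definition x2 :: "'k \<Rightarrow> 'k mat4" where "x2 t = mk4 [[1,0,0,0],[0,1,t,0],[0,0,1,0],[0,0,0,1]]"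
definition y2 :: "'k \<Rightarrow> 'k mat4" where "y2 t = mk4 [[1,0,0,0],[0,1,0,0],[0,t,1,0],[0,0,0,1]]"
definition dg :: "'k \<Rightarrow> 'k \<Rightarrow> 'k mat4" where "dg s t = mk4 [[s,0,0,0],[0,t,0,0],[0,0,inverse t,0],[0,0,0,inverse s]]"

lemmas root_defs = x1_def y1_def x2_def y2_def

lemma mk4_Sp4:
  "mk4 [[a1,a2,a3,a4],[b1,b2,b3,b4],[c1,c2,c3,c4],[d1,d2,d3,d4]] \<in> carrier (Sp4 :: 'k mat4 monoid) \<longleftrightarrow>
   a1*d2 + a2*d1 + b1*c2 + b2*c1 = 0 \<and> a1*d3 + a3*d1 + b1*c3 + b3*c1 = 0 \<and>
   a1*d4 + a4*d1 + b1*c4 + b4*c1 = 1 \<and> a2*d3 + a3*d2 + b2*c3 + b3*c2 = 1 \<and>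
   a2*d4 + a4*d2 + b2*c4 + b4*c2 = 0 \<and> a3*d4 + a4*d3 + b3*c4 + b4*c3 = 0"
  by (simp add: Sp4_columns_iff forall_4 minor_def minus_eq add.assoc[symmetric] del: add_eq_0) (auto simp: algebra_simps)

lemma root_Sp4 [simp, intro]:
  "x1 t \<in> carrier Sp4" "y1 t \<in> carrier Sp4" "x2 t \<in> carrier Sp4" "y2 t \<in> carrier Sp4"
  by (simp_all add: root_defs mk4_Sp4)

lemma dg_Sp4 [simp, intro]: "s \<noteq> 0 \<Longrightarrow> t \<noteq> 0 \<Longrightarrow> dg s t \<in> carrier Sp4"
  by (simp add: dg_def mk4_Sp4)

text \<open>Words grow by one letter on the left, the shape wanted for induction; closure under
  products follows from \<open>gen_cancel\<close>.\<close>

inductive_set gen :: "'k mat4 set" where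
  one: "mat 1 \<in> gen"
| x1: "g \<in> gen \<Longrightarrow> x1 t ** g \<in> gen"
| y1: "g \<in> gen \<Longrightarrow> y1 t ** g \<in> gen"
| x2: "g \<in> gen \<Longrightarrow> x2 t ** g \<in> gen"
| y2: "g \<in> gen \<Longrightarrow> y2 t ** g \<in> gen"

lemma root_sq:
  "x1 t ** x1 t = mat 1" "y1 t ** y1 t = mat 1" "x2 t ** x2 t = mat 1" "y2 t ** y2 t = mat 1"
  by (simp_all add: root_defs mat4_eq_iff forall_4 mult4 mat_nth)

text \<open>In characteristic 2 every root element is an involution, so left multiplication by a
  letter can be undone by the same letter.\<close>

lemma gen_cancel:
  "h \<in> gen \<Longrightarrow> h ** g \<in> gen \<longleftrightarrow> g \<in> gen"
proof (induction rule: gen.induct)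
  have *: "a ** g \<in> gen \<longleftrightarrow> g \<in> gen" 
    if "\<And>g. g \<in> gen \<Longrightarrow> a ** g \<in> gen" "a ** a = mat 1" for a g
    using that by (metis matrix_mul_assoc matrix_mul_lid)
  { case (x1 h t) then show ?case using *[of "x1 t"] gen.x1 root_sq by (metis matrix_mul_assoc) }
  { case (x2 h t) then show ?case using *[of "x2 t"] gen.x2 root_sq by (metis matrix_mul_assoc) }
  { case (y1 h t) then show ?case using *[of "y1 t"] gen.y1 root_sq by (metis matrix_mul_assoc) }
  { case (y2 h t) then show ?case using *[of "y2 t"] gen.y2 root_sq by (metis matrix_mul_assoc) }
qed simp

lemma gen_mult: "h \<in> gen \<Longrightarrow> g \<in> gen \<Longrightarrow> h ** g \<in> gen"
  by (simp add: gen_cancel)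

lemma gen_roots: "x1 t \<in> gen" "y1 t \<in> gen" "x2 t \<in> gen" "y2 t \<in> gen"
  using gen.intros by (metis matrix_mul_rid)+

text \<open>Representatives of the two simple reflections; no signs are needed in characteristic
  2.\<close>

definition w1 :: "'k mat4" where "w1 = mk4 [[0,1,0,0],[1,0,0,0],[0,0,0,1],[0,0,1,0]]"
definition w2 :: "'k mat4" where "w2 = mk4 [[1,0,0,0],[0,0,1,0],[0,1,0,0],[0,0,0,1]]"

lemma w1_eq: "w1 = x1 1 ** y1 1 ** x1 1" and w2_eq: "w2 = x2 1 ** y2 1 ** x2 1"
  by (simp_all add: root_defs w1_def w2_def mat4_eq_iff forall_4 mult4)

lemma w_gen: "w1 \<in> gen" "w2 \<in> gen"
  unfolding w1_eq w2_eq by (intro gen_mult gen_roots)+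

lemma dg_gen:
  assumes "s \<noteq> 0" "t \<noteq> 0"
  shows "dg s t \<in> gen"
proof -
  \<comment> \<open>With \<open>n(s) = x(s) y(1/s) x(s)\<close>, the coroot of a simple root has
    value \<open>n(s) n(1)\<close> at \<open>s\<close>. The first coroot at \<open>s\<close> is
    \<open>dg s (1/s)\<close>, the second at \<open>s*t\<close> is \<open>dg 1 (s*t)\<close>, and
    their product is \<open>dg s t\<close>.\<close>
  have "dg s t = x1 s ** y1 (inverse s) ** x1 s ** w1 ** (x2 (s*t) ** y2 (inverse (s*t)) ** x2 (s*t) ** w2)"
    using assms by (simp add: root_defs w1_def w2_def dg_def mat4_eq_iff forall_4 mult4 field_simps)
  then show ?thesis by (auto intro!: gen_mult gen_roots w_gen)
qed

text \<open>The remaining roots: \<open>x12\<close> belongs to the short root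
  \<open>\<epsilon>\<^sub>1 + \<epsilon>\<^sub>2\<close>, \<open>x11\<close> to the long root
  \<open>2\<epsilon>\<^sub>1\<close>, and \<open>y12\<close>, \<open>y11\<close> to their
  negatives.\<close>

definition x12 :: "'k \<Rightarrow> 'k mat4" where "x12 t = mk4 [[1,0,t,0],[0,1,0,t],[0,0,1,0],[0,0,0,1]]"
definition y12 :: "'k \<Rightarrow> 'k mat4" where "y12 t = mk4 [[1,0,0,0],[0,1,0,0],[t,0,1,0],[0,t,0,1]]"
definition x11 :: "'k \<Rightarrow> 'k mat4" where "x11 t = mk4 [[1,0,0,t],[0,1,0,0],[0,0,1,0],[0,0,0,1]]"
definition y11 :: "'k \<Rightarrow> 'k mat4" where "y11 t = mk4 [[1,0,0,0],[0,1,0,0],[0,0,1,0],[t,0,0,1]]"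

lemmas root_defs' = x12_def y12_def x11_def y11_def

lemma root_gen': "x12 t \<in> gen" "y12 t \<in> gen" "x11 t \<in> gen" "y11 t \<in> gen"
proof -
  have "x12 t = w2 ** x1 t ** w2" "y12 t = w2 ** y1 t ** w2"
    "x11 t = w1 ** x2 t ** w1" "y11 t = w1 ** y2 t ** w1"
    by (simp_all add: root_defs root_defs' w1_def w2_def mat4_eq_iff forall_4 mult4)
  then show "x12 t \<in> gen" "y12 t \<in> gen" "x11 t \<in> gen" "y11 t \<in> gen"
    by (simp_all add: gen_mult gen_roots w_gen)
qed

lemma gen_Sp4: "g \<in> gen \<Longrightarrow> g \<in> carrier Sp4"
  by (induction rule: gen.induct) auto

definition block2 :: "'k \<Rightarrow> 'k \<Rightarrow> 'k \<Rightarrow> 'k \<Rightarrow> 'k mat4" where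
  "block2 p q r s = mk4 [[1,0,0,0],[0,p,q,0],[0,r,s,0],[0,0,0,1]]"

text \<open>The upper-diagonal-lower factorization of the middle \<open>SL2\<close> block, with the
  lower right entry as pivot.\<close>

lemma block2_factor:
  assumes "p * s + q * r = 1" "s \<noteq> 0"
  shows "block2 p q r s = x2 (q / s) ** dg 1 (inverse s) ** y2 (r / s)"
proof -
  have "p = (1 + q * r) / s" using assms by (metis add_self_left add.commute nonzero_eq_divide_eq)
  then show ?thesis using assms(2)
    by (simp add: block2_def root_defs dg_def mat4_eq_iff forall_4 mult4 field_simps)
qed

lemma block2_gen:
  assumes "p * s + q * r = 1"
  shows "block2 p q r s \<in> gen"
proof (cases "s = 0")
  case False
  then show ?thesis using block2_factor[OF assms] gen_mult gen_roots dg_gen by simp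
next
  case True
  then have "q \<noteq> 0" "r * q + s * p = 1" using assms by (auto simp: mult.commute)
  \<comment> \<open>Exchanging the two middle rows moves the nonzero entry \<open>q\<close> to the
    pivot position.\<close>
  then have "block2 r s p q \<in> gen"
    using block2_factor[of r q s p] gen_mult gen_roots dg_gen by simp
  moreover have "block2 r s p q = w2 ** block2 p q r s"
    by (simp add: block2_def w2_def mat4_eq_iff forall_4 mult4)
  ultimately show ?thesis using gen_cancel[OF w_gen(2)] by simp
qed

text \<open>A symplectic matrix that fixes the last basis vector also preserves the functional that
  pairs with it, and this functional is the first coordinate.\<close>

lemma Sp4_last_column:
  assumes "g \<in> carrier Sp4" "g $ 1 $ 4 = 0" "g $ 2 $ 4 = 0" "g $ 3 $ 4 = 0" "g $ 4 $ 4 = (1::'k)"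
  shows "g $ 1 $ 1 = 1" "g $ 1 $ 2 = 0" "g $ 1 $ 3 = 0"
  using Sp4_columns[OF assms(1), of 1 4] Sp4_columns[OF assms(1), of 2 4] Sp4_columns[OF assms(1), of 3 4] assms(2-)
  by (simp_all add: minor_def)

text \<open>The stabilizer of the last basis vector is a unipotent radical times \<open>SL2\<close>.
  The three root elements clear the first column, and the symplectic relations then clear the last
  row.\<close>

lemma Sp4_last_column_factor:
  assumes "g \<in> carrier Sp4" "g $ 1 $ 4 = 0" "g $ 2 $ 4 = 0" "g $ 3 $ 4 = 0" "g $ 4 $ 4 = (1::'k)"
  shows "\<exists>a b c p q r s. y11 a ** y12 b ** y1 c ** g = block2 p q r s \<and> p * s + q * r = 1"
proof -
  note row1 = Sp4_last_column[OF assms]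
  define c b where "c = g $ 2 $ 1" and "b = g $ 3 $ 1"
  \<comment> \<open>The factor \<open>y1 c\<close> adds \<open>c\<close> times row 3 to row 4, so
    the corner entry already contains the extra \<open>c * b\<close> when \<open>y11 a\<close>
    acts.\<close>
  define a where "a = g $ 4 $ 1 + c * b"
  define h where "h = y11 a ** y12 b ** y1 c ** g"
  have h: "h \<in> carrier Sp4" unfolding h_def 
    using assms(1) gen_Sp4[OF root_gen'(4)] gen_Sp4[OF root_gen'(2)] by auto
  have e: "h $ 1 $ 1 = 1" "h $ 1 $ 2 = 0" "h $ 1 $ 3 = 0" "h $ 1 $ 4 = 0"
    "h $ 2 $ 1 = 0" "h $ 3 $ 1 = 0" "h $ 4 $ 1 = 0" "h $ 2 $ 4 = 0" "h $ 3 $ 4 = 0" "h $ 4 $ 4 = 1"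
    using assms row1 by (simp_all add: h_def mult4 root_defs root_defs' a_def b_def c_def algebra_simps)
  have e': "h $ 4 $ 2 = 0" "h $ 4 $ 3 = 0"
    using Sp4_columns[OF h, of 1 2] Sp4_columns[OF h, of 1 3] e by (simp_all add: minor_def)
  have "h $ 2 $ 2 * h $ 3 $ 3 + h $ 2 $ 3 * h $ 3 $ 2 = 1"
    using Sp4_columns[OF h, of 2 3] e e' by (simp add: minor_def minus_eq)
  moreover have "h = block2 (h $ 2 $ 2) (h $ 2 $ 3) (h $ 3 $ 2) (h $ 3 $ 3)"
    using e e' by (simp add: block2_def mat4_eq_iff forall_4)
  ultimately show ?thesis unfolding h_def by blast
qed

lemma Sp4_gen_last_column:
  assumes "g \<in> carrier Sp4" "g $ 1 $ 4 = 0" "g $ 2 $ 4 = 0" "g $ 3 $ 4 = 0" "g $ 4 $ 4 = (1::'k)"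
  shows "g \<in> gen"
proof -
  obtain a b c p q r s where *: "y11 a ** y12 b ** y1 c ** g = block2 p q r s" "p * s + q * r = 1"
    using Sp4_last_column_factor[OF assms] by blast
  then show ?thesis
    using gen_cancel[of "y11 a ** y12 b ** y1 c" g] block2_gen root_gen' gen_roots gen_mult by metis
qed

text \<open>With a nonzero pivot in position 44, root elements clear the last column and a torus
  element normalizes the pivot.\<close>

lemma Sp4_gen_4_4:
  assumes g: "g \<in> carrier Sp4" and ne: "g $ 4 $ 4 \<noteq> (0::'k)"
  shows "g \<in> gen"
proof -
  define d where "d = dg (g $ 4 $ 4) 1"
  define c where "c = g $ 3 $ 4 / g $ 4 $ 4"
  define b where "b = g $ 2 $ 4 / g $ 4 $ 4"
  define h where "h = x12 b ** x1 c ** g"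
  define a where "a = h $ 1 $ 4 / g $ 4 $ 4"
  have gens: "d ** (x11 a ** (x12 b ** x1 c)) \<in> gen"
    unfolding d_def using ne by (intro gen_mult root_gen' gen_roots dg_gen) auto
  have h: "h $ 2 $ 4 = 0" "h $ 3 $ 4 = 0" "h $ 4 $ 4 = g $ 4 $ 4"
    unfolding h_def using ne by (simp_all add: mult4 b_def c_def root_defs root_defs')
  have "d ** (x11 a ** h) \<in> carrier Sp4"
    using Sp4_mult[OF gen_Sp4[OF gens] g] by (simp add: h_def matrix_mul_assoc)
  moreover have "(d ** (x11 a ** h)) $ 1 $ 4 = 0" "(d ** (x11 a ** h)) $ 2 $ 4 = 0"
    "(d ** (x11 a ** h)) $ 3 $ 4 = 0" "(d ** (x11 a ** h)) $ 4 $ 4 = 1"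
    using ne h by (simp_all add: mult4 d_def a_def root_defs' dg_def)
  ultimately have "d ** (x11 a ** h) \<in> gen"
    by (rule Sp4_gen_last_column)
  then show ?thesis using gen_cancel[OF gens, of g] by (simp add: h_def matrix_mul_assoc)
qed

lemma Sp4_column_nonzero:
  assumes "g \<in> carrier (Sp4 :: 'k mat4 monoid)" shows "\<exists>i. g $ i $ j \<noteq> 0"
proof (rule ccontr)
  assume "\<not> ?thesis"
  then have "g $ i $ j = 0" for i by blast
  then have "(sinv g ** g) $ j $ j = 0" unfolding matrix_mult_nth by simp
  then show False unfolding sinv_left[OF assms] mat_nth by simp
qed

text \<open>A column of an invertible matrix is nonzero, and a product of simple reflections moves a
  nonzero entry of the last column to position 44.\<close>

lemma Sp4_gen:
  assumes g: "g \<in> carrier (Sp4 :: 'k mat4 monoid)" shows "g \<in> gen"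
proof -
  have *: "g \<in> gen" if "h \<in> gen" "(h ** g) $ 4 $ 4 \<noteq> 0" for h
    using Sp4_gen_4_4[of "h ** g"] that g gen_Sp4 gen_cancel by blast
  obtain i where i: "g $ i $ 4 \<noteq> 0" using Sp4_column_nonzero[OF g] by blast
  consider "i = 1" | "i = 2" | "i = 3" | "i = 4" using exhaust_4[of i] by blast
  then show ?thesis
  proof cases
    case 1 then show ?thesis using i by (intro *[of "w1 ** w2 ** w1"] gen_mult w_gen) (simp add: mult4 w1_def w2_def)
  next
    case 2 then show ?thesis using i by (intro *[of "w1 ** w2"] gen_mult w_gen) (simp add: mult4 w1_def w2_def)
  next
    case 3 then show ?thesis using i by (intro *[of "w1"] gen_mult w_gen) (simp add: mult4 w1_def w2_def)
  next
    case 4 then show ?thesis using Sp4_gen_4_4 g i by blast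
  qed
qed

text \<open>Identities compatible with products then need checking only on the root subgroups of the
  simple roots and their negatives.\<close>

theorem Sp4_induct [consumes 1, case_names one x1 y1 x2 y2]:
  assumes "g \<in> carrier (Sp4 :: 'k mat4 monoid)"
    and "P (mat 1)"
    and "\<And>g t. g \<in> carrier Sp4 \<Longrightarrow> P g \<Longrightarrow> P (x1 t ** g)" "\<And>g t. g \<in> carrier Sp4 \<Longrightarrow> P g \<Longrightarrow> P (y1 t ** g)"
    and "\<And>g t. g \<in> carrier Sp4 \<Longrightarrow> P g \<Longrightarrow> P (x2 t ** g)" "\<And>g t. g \<in> carrier Sp4 \<Longrightarrow> P g \<Longrightarrow> P (y2 t ** g)"
  shows "P g"
  using Sp4_gen[OF assms(1)] by induction (auto intro: assms gen_Sp4)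

end

section \<open>Special isogenies\<close>

lemma coord_ringE:
  assumes "f \<in> carrier coord_ring"
  obtains f' where "f' \<in> poly_funs" "f = restrict f' (carrier Sp4)"
  using assms by (auto simp: coord_ring_def)

lemma restrict_in_coord_ring [intro]: "f \<in> poly_funs \<Longrightarrow> restrict f (carrier Sp4) \<in> carrier coord_ring"
  by (auto simp: coord_ring_def)

context char2
begin

lemma polyfun_power: "polyfun (\<lambda>a::'k. a ^ m)"
  by (induction m) (auto intro: polyfun_mult)

text \<open>A torus parameter that separates weights: by \<open>sq_eq_1_iff\<close> it also differs
  from its inverse.\<close>

lemma exists_generic: "\<exists>s::'k. s \<noteq> 0 \<and> s \<noteq> 1"
proof -
  have "infinite (- {0, 1::'k})"
    using infinite_alg_closed[where 'k = 'k] by (simp add: Compl_eq_Diff_UNIV)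
  then have "- {0, 1::'k} \<noteq> {}" by (rule infinite_imp_nonempty)
  then show ?thesis by auto
qed

lemma sq_eq_1_iff: "(s::'k) * s = 1 \<longleftrightarrow> s = 1"
proof
  assume "s * s = 1"
  then have "(s + 1) * (s + 1) = 0" by (simp add: algebra_simps)
  then show "s = 1" by simp
qed simp

lemma polyfun_const_off_0:
  fixes u :: "'k \<Rightarrow> 'k"
  assumes "polyfun u" "\<And>a. a \<noteq> 0 \<Longrightarrow> u a = c"
  shows "u a = c"
proof -
  obtain p where p: "u = poly p" using assms(1) by (rule polyfunE)
  have "p = [:c:]" by (rule poly_eqI_nonzero) (use assms(2) p in auto)
  then show ?thesis by (simp add: p)
qed

text \<open>
  Conjugation by a one-parameter subgroup of the torus scales the parameter of a root subgroup. Hence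
  an entry of the image of the root subgroup is a monomial whose degree is given by the weights.
\<close>

lemma weight_curve:
  fixes u :: "'k \<Rightarrow> 'k"
  assumes poly: "polyfun u"
    and scale: "\<And>t a. t \<noteq> 0 \<Longrightarrow> u (t^2 * a) = r t * u a * inverse (r' t)"
    and r: "\<And>t. t \<noteq> 0 \<Longrightarrow> r t \<noteq> 0 \<and> r' t \<noteq> 0"
  shows "(\<And>t. t \<noteq> 0 \<Longrightarrow> r t = r' t) \<Longrightarrow> u a = u 0"
    and "(\<And>t. t \<noteq> 0 \<Longrightarrow> r' t = (t^2) ^ m * r t) \<Longrightarrow> m > 0 \<Longrightarrow> u a = 0"
    and "(\<And>t. t \<noteq> 0 \<Longrightarrow> r t = (t^2) ^ m * r' t) \<Longrightarrow> u 0 = 0 \<Longrightarrow> m > 0 \<Longrightarrow> u a = a ^ m * u 1"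
proof -
  assume *: "\<And>t. t \<noteq> 0 \<Longrightarrow> r t = r' t"
  have "u a = u 1" if a: "a \<noteq> 0" for a
  proof -
    \<comment> \<open>The torus scales the curve parameter by squares, so a square root of
      \<open>a\<close> links the values at \<open>a\<close> and at 1.\<close>
    obtain t where t: "t ^ 2 = a" using alg_closed_square_root by blast
    then have "t \<noteq> 0" using a by auto
    then show ?thesis using scale[of t 1] * r t by simp
  qed
  from polyfun_const_off_0[OF poly this] show "u a = u 0" by metis
next
  assume *: "\<And>t. t \<noteq> 0 \<Longrightarrow> r' t = (t^2) ^ m * r t" and m: "m > 0"
  have "a ^ m * u a = u 1" if a: "a \<noteq> 0" for a
  proof -
    obtain t where t: "t ^ 2 = a" using alg_closed_square_root by blast
    then have t0: "t \<noteq> 0" using a by auto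
    have "u a = r t * u 1 * inverse (a ^ m * r t)" using scale[OF t0, of 1] *[OF t0] t by simp
    then show ?thesis using r[OF t0] a by (simp add: field_simps)
  qed
  moreover have "polyfun (\<lambda>a. a ^ m * u a)"
    by (intro polyfun_mult polyfun_power poly)
  ultimately have all: "a ^ m * u a = u 1" for a using polyfun_const_off_0 by blast
  from all[of 0] m have "u 1 = 0" by (simp add: zero_power)
  then have "u a = 0" if "a \<noteq> 0" for a using all[of a] that by simp
  from polyfun_const_off_0[OF poly this] show "u a = 0" .
next
  assume *: "\<And>t. t \<noteq> 0 \<Longrightarrow> r t = (t^2) ^ m * r' t" and 0: "u 0 = 0" and m: "m > 0"
  show "u a = a ^ m * u 1"
  proof (cases "a = 0")
    case False
    obtain t where t: "t ^ 2 = a" using alg_closed_square_root by blast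
    then have t0: "t \<noteq> 0" using False by auto
    then show ?thesis using scale[OF t0, of 1] *[OF t0] t r[OF t0] by simp
  qed (use 0 m in simp)
qed

text \<open>A torus element that centralizes the curve forces the matrix entries between different
  eigenvalues of its image to vanish.\<close>

lemma weight_curve_zero:
  fixes x :: 'k
  assumes "x = q * x * inverse q'" "q \<noteq> q'" "q' \<noteq> 0"
  shows "x = 0"
proof -
  have "(q - q') * x = 0" using assms by (simp add: field_simps)
  then show ?thesis using assms(2) by simp
qed

lemma dg_mult: "dg s t ** dg s' t' = dg (s * s') (t * t')"
  by (simp add: dg_def mat4_eq_iff forall_4 mult4 mult.commute)

lemma dg_one: "dg 1 1 = mat 1"
  by (simp add: dg_def mat4_eq_iff forall_4 mat_nth)

text \<open>Short roots go to long ones with squared parameter, long roots to short ones linearly.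
  Any special isogeny shows this pattern up to constants.\<close>

lemma minors_roots:
  "minors (x1 t) = x2 (t^2)" "minors (y1 t) = y2 (t^2)" "minors (x2 t) = x1 t" "minors (y2 t) = y1 t"
  by (simp_all add: mat4_eq_iff forall_4 minors_nth minor_def root_defs power2_eq_square)

end

section \<open>A special isogeny on the torus and on root subgroups\<close>

locale special = char2 ty for ty :: "'k::alg_closed_field itself" +
  fixes \<tau> :: "'k mat4 \<Rightarrow> 'k mat4"
  assumes special: "special_isogeny \<tau>"
begin

lemma tau_Sp4 [simp, intro]: "g \<in> carrier Sp4 \<Longrightarrow> \<tau> g \<in> carrier Sp4"
  using special by (auto simp: special_isogeny_def hom_def)

lemma tau_mult: "g \<in> carrier Sp4 \<Longrightarrow> h \<in> carrier Sp4 \<Longrightarrow> \<tau> (g ** h) = \<tau> g ** \<tau> h"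
  using special by (auto simp: special_isogeny_def hom_def)

lemma tau_tau: "g \<in> carrier Sp4 \<Longrightarrow> \<tau> (\<tau> g) = frobenius g"
  using special by (auto simp: special_isogeny_def)

lemma tau_one: "\<tau> (mat 1) = mat 1"
proof -
  have "\<tau> (mat 1) ** \<tau> (mat 1) = \<tau> (mat 1)" by (metis Sp4_one matrix_mul_lid tau_mult)
  then show ?thesis by (metis Sp4_one sinv_left matrix_mul_assoc matrix_mul_lid tau_Sp4)
qed

lemma tau_poly: "\<exists>f\<in>poly_funs. \<forall>g\<in>carrier Sp4. \<tau> g $ i $ j = f g"
proof -
  have "(\<lambda>g\<in>carrier Sp4. \<tau> g $ i $ j) \<in> carrier coord_ring"
    using special by (auto simp: special_isogeny_def)
  then obtain f where "f \<in> poly_funs" "(\<lambda>g\<in>carrier Sp4. \<tau> g $ i $ j) = restrict f (carrier Sp4)"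
    by (rule coord_ringE)
  then have "\<tau> g $ i $ j = f g" if "g \<in> carrier Sp4" for g
    using that by (auto dest: fun_cong[of _ _ g])
  then show ?thesis using \<open>f \<in> poly_funs\<close> by blast
qed

text \<open>The conditions on \<open>\<omega>\<^sub>1\<close> and \<open>\<omega>\<^sub>2\<close>
  say that the first diagonal entry is \<open>s*t\<close> and the product of the first two is
  \<open>s^2\<close>; the form fixes the other two.\<close>

lemma tau_dg:
  assumes "s \<noteq> 0" "t \<noteq> 0"
  shows "\<tau> (dg s t) = dg (s * t) (s / t)"
proof -
  let ?A = "\<tau> (dg s t)"
  have tor: "dg s t \<in> torus" using assms by (auto simp: torus_def dg_def mk4_Sp4 forall_4)
  then have A: "?A \<in> torus" "weight_char \<omega>\<^sub>1 ?A = weight_char \<omega>\<^sub>2 (dg s t)"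
      "weight_char \<omega>\<^sub>2 ?A = weight_char (2, 0) (dg s t)"
    using special by (auto simp: special_isogeny_def)
  then have w: "?A $ 1 $ 1 = s * t" "?A $ 1 $ 1 * ?A $ 2 $ 2 = s ^ 2"
    by (simp_all add: weight_char_def \<omega>\<^sub>1_def \<omega>\<^sub>2_def dg_def)
  then have w2: "?A $ 2 $ 2 = s / t" using assms by (simp add: power2_eq_square field_simps)
  from A(1) have off: "i \<noteq> j \<Longrightarrow> ?A $ i $ j = 0" and S: "?A \<in> carrier Sp4" for i j by (auto simp: torus_def)
  have "?A $ 1 $ 1 * ?A $ 4 $ 4 = 1" "?A $ 2 $ 2 * ?A $ 3 $ 3 = 1"
    using Sp4_columns[OF S, of 1 4] Sp4_columns[OF S, of 2 3] by (simp_all add: minor_def off)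
  then have "?A $ 4 $ 4 = inverse (s * t)" "?A $ 3 $ 3 = inverse (s / t)"
    
    unfolding w w2 using assms by (simp_all add: field_simps)
  then show ?thesis using w w2 off by (simp add: dg_def mat4_eq_iff forall_4)
qed

lemma dg_mult_nth:
  "(dg a b ** A ** dg c d) $ i $ j = dg a b $ i $ i * A $ i $ j * dg c d $ j $ j"
proof -
  have 1: "(dg a b ** B) $ i $ j = dg a b $ i $ i * B $ i $ j" for B :: "'k mat4" and i j
    using exhaust_4[of i] by (elim disjE) (simp_all add: mult4 dg_def)
  have 2: "(B ** dg c d) $ i $ j = B $ i $ j * dg c d $ j $ j" for B :: "'k mat4" and i j
    using exhaust_4[of j] by (elim disjE) (simp_all add: mult4 dg_def)
  show ?thesis by (simp add: 1 2)
qed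

lemma dg_inverse_nth: "dg (inverse a) (inverse b) $ j $ j = inverse (dg a b $ j $ j)"
  using exhaust_4[of j] by (elim disjE) (simp_all add: dg_def)

text \<open>This supplies the scaling hypotheses of \<open>weight_curve\<close> and
  \<open>weight_curve_zero\<close> for entries of the image of a root subgroup.\<close>

lemma tau_conj_dg:
  assumes "s \<noteq> 0" "t \<noteq> 0" "g \<in> carrier Sp4" "dg s t ** g ** dg (inverse s) (inverse t) = h"
  shows "\<tau> h $ i $ j = dg (s * t) (s / t) $ i $ i * \<tau> g $ i $ j * inverse (dg (s * t) (s / t) $ j $ j)"
proof -
  have "\<tau> h = dg (s * t) (s / t) ** \<tau> g ** dg (inverse (s * t)) (inverse (s / t))"
    unfolding assms(4)[symmetric] using assms(1-3) by (simp add: tau_mult tau_dg divide_inverse)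
  then show ?thesis by (simp only: dg_mult_nth dg_inverse_nth)
qed

lemma tau_curve_poly:
  assumes "\<And>a. c a \<in> carrier Sp4" "\<And>i j. polyfun (\<lambda>a. c a $ i $ j)"
  shows "polyfun (\<lambda>a. \<tau> (c a) $ i $ j)"
proof -
  obtain f where f: "f \<in> poly_funs" "\<forall>g\<in>carrier Sp4. \<tau> g $ i $ j = f g" using tau_poly by blast
  have "polyfun (\<lambda>a. f (c a))" by (rule polyfun_curve[OF f(1) assms(2)])
  then show ?thesis using f assms by simp
qed

lemma root_curve_poly:
  "polyfun (\<lambda>a. x1 a $ i $ j)" "polyfun (\<lambda>a. y1 a $ i $ j)" "polyfun (\<lambda>a. x2 a $ i $ j)" "polyfun (\<lambda>a. y2 a $ i $ j)"
proof -
  have "polyfun (\<lambda>a. x1 a $ i $ j) \<and> polyfun (\<lambda>a. y1 a $ i $ j) \<and> polyfun (\<lambda>a. x2 a $ i $ j) \<and> polyfun (\<lambda>a. y2 a $ i $ j)"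
    using exhaust_4[of i] exhaust_4[of j] by (elim disjE) (simp_all add: root_defs)
  then show "polyfun (\<lambda>a. x1 a $ i $ j)" "polyfun (\<lambda>a. y1 a $ i $ j)" "polyfun (\<lambda>a. x2 a $ i $ j)" "polyfun (\<lambda>a. y2 a $ i $ j)"
    by blast+
qed

lemma roots_0: "x1 0 = mat 1" "y1 0 = mat 1" "x2 0 = mat 1" "y2 0 = mat 1"
  by (simp_all add: root_defs mat4_eq_iff forall_4 mat_nth)

lemma root_conj_dg:
  assumes "s \<noteq> 0" "t \<noteq> 0"
  shows "dg s t ** x1 a ** dg (inverse s) (inverse t) = x1 (s / t * a)"
    "dg s t ** y1 a ** dg (inverse s) (inverse t) = y1 (t / s * a)"
    "dg s t ** x2 a ** dg (inverse s) (inverse t) = x2 (t ^ 2 * a)"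
    "dg s t ** y2 a ** dg (inverse s) (inverse t) = y2 (a / t ^ 2)"
  using assms by (simp_all add: dg_def root_defs mat4_eq_iff forall_4 mult4 power2_eq_square field_simps)

text \<open>The element \<open>dg s 1\<close> centralizes \<open>x2\<close> and maps to
  \<open>dg s s\<close>, which kills the entries between the index sets 12 and 34. The element
  \<open>dg 1 t\<close> scales the parameter by \<open>t^2\<close> and maps to
  \<open>dg t (1/t)\<close>. This makes entries 12 and 34 linear, entries 21 and 43 zero and the
  diagonal constant; the form equates the two coefficients.\<close>

lemma tau_x2: "\<exists>c. \<forall>a. \<tau> (x2 a) = x1 (c * a)"
proof -
  define Q where "Q i j a = \<tau> (x2 a) $ i $ j" for i j a
  define q where "q i j = Q i j 1" for i j
  have poly: "polyfun (Q i j)" for i j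
    unfolding Q_def by (intro tau_curve_poly root_curve_poly root_Sp4)
  have Q0: "Q i j 0 = (if i = j then 1 else 0)" for i j by (simp add: Q_def roots_0 tau_one mat_nth)
  obtain s :: 'k where s: "s \<noteq> 0" "s \<noteq> 1" using exists_generic by blast
  have fixed: "Q i j a = dg s s $ i $ i * Q i j a * inverse (dg s s $ j $ j)" for i j a
    using tau_conj_dg[of s 1, OF _ _ root_Sp4(3)] s root_conj_dg(3)[of s 1] by (simp add: Q_def)
  have ne: "dg s s $ i $ i \<noteq> 0" for i using s exhaust_4[of i] by (elim disjE) (simp_all add: dg_def)
  have scale: "Q i j (t^2 * a) = dg t (inverse t) $ i $ i * Q i j a * inverse (dg t (inverse t) $ j $ j)" if "t \<noteq> 0" for i j t a
    using tau_conj_dg[of 1 t, OF _ that root_Sp4(3)] that root_conj_dg(3)[of 1 t] by (simp add: Q_def divide_inverse)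
  have ne': "dg t (inverse t) $ i $ i \<noteq> 0" if "t \<noteq> 0" for i t using that exhaust_4[of i] by (elim disjE) (simp_all add: dg_def)
  have s': "s \<noteq> inverse s" "inverse s \<noteq> s" using s sq_eq_1_iff[of s] by (auto simp: field_simps)
  have z: "Q i j a = 0" if "dg s s $ i $ i \<noteq> dg s s $ j $ j" for i j a
    using weight_curve_zero[OF fixed that ne] .
  note wc = weight_curve[of "Q i j" "\<lambda>t. dg t (inverse t) $ i $ i" "\<lambda>t. dg t (inverse t) $ j $ j" for i j,
      OF poly scale conjI[OF ne' ne']]
  have "Q 1 1 a = 1" "Q 2 2 a = 1" "Q 3 3 a = 1" "Q 4 4 a = 1" for a
    using wc(1)[of 1 1 a] wc(1)[of 2 2 a] wc(1)[of 3 3 a] wc(1)[of 4 4 a] by (auto simp: Q0)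
  moreover have "Q 1 2 a = a * q 1 2" "Q 3 4 a = a * q 3 4" for a
    using wc(3)[of 1 1 2 a] wc(3)[of 3 1 4 a] by (simp_all add: Q0 q_def dg_def power2_eq_square field_simps)
  moreover have "Q 2 1 a = 0" "Q 4 3 a = 0" for a
    using wc(2)[of 1 1 2 a] wc(2)[of 3 1 4 a] by (simp_all add: dg_def power2_eq_square field_simps)
  moreover have "Q 1 3 a = 0" "Q 1 4 a = 0" "Q 2 3 a = 0" "Q 2 4 a = 0" "Q 3 1 a = 0" "Q 4 1 a = 0" "Q 3 2 a = 0" "Q 4 2 a = 0" for a
    using s' by (auto intro!: z simp: dg_def)
  ultimately have eq: "\<tau> (x2 a) = mk4 [[1, a * q 1 2, 0, 0], [0, 1, 0, 0], [0, 0, 1, a * q 3 4], [0, 0, 0, 1]]" for a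
    by (simp add: mat4_eq_iff forall_4 flip: Q_def)
  have "\<tau> (x2 1) \<in> carrier Sp4" by simp
  then have "q 1 2 = q 3 4" unfolding eq mk4_Sp4 by simp
  then show ?thesis unfolding eq by (intro exI[of _ "q 1 2"]) (simp add: x1_def mult.commute)
qed

text \<open>The weights are opposite to those of \<open>x2\<close>, so the inverse torus parameter
  scales the curve by \<open>t^2\<close>.\<close>

lemma tau_y2: "\<exists>c. \<forall>a. \<tau> (y2 a) = y1 (c * a)"
proof -
  define Q where "Q i j a = \<tau> (y2 a) $ i $ j" for i j a
  define q where "q i j = Q i j 1" for i j
  have poly: "polyfun (Q i j)" for i j
    unfolding Q_def by (intro tau_curve_poly root_curve_poly root_Sp4)
  have Q0: "Q i j 0 = (if i = j then 1 else 0)" for i j by (simp add: Q_def roots_0 tau_one mat_nth)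
  obtain s :: 'k where s: "s \<noteq> 0" "s \<noteq> 1" using exists_generic by blast
  have fixed: "Q i j a = dg s s $ i $ i * Q i j a * inverse (dg s s $ j $ j)" for i j a
    using tau_conj_dg[of s 1, OF _ _ root_Sp4(4)] s root_conj_dg(4)[of s 1] by (simp add: Q_def)
  have ne: "dg s s $ i $ i \<noteq> 0" for i using s exhaust_4[of i] by (elim disjE) (simp_all add: dg_def)
  have scale: "Q i j (t^2 * a) = dg (inverse t) t $ i $ i * Q i j a * inverse (dg (inverse t) t $ j $ j)" if "t \<noteq> 0" for i j t a
    using tau_conj_dg[of 1 "inverse t", OF _ _ root_Sp4(4)] that root_conj_dg(4)[of 1 "inverse t" a]
    by (simp add: Q_def field_simps)
  have ne': "dg (inverse t) t $ i $ i \<noteq> 0" if "t \<noteq> 0" for i t using that exhaust_4[of i] by (elim disjE) (simp_all add: dg_def)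
  have s': "s \<noteq> inverse s" "inverse s \<noteq> s" using s sq_eq_1_iff[of s] by (auto simp: field_simps)
  have z: "Q i j a = 0" if "dg s s $ i $ i \<noteq> dg s s $ j $ j" for i j a
    using weight_curve_zero[OF fixed that ne] .
  note wc = weight_curve[of "Q i j" "\<lambda>t. dg (inverse t) t $ i $ i" "\<lambda>t. dg (inverse t) t $ j $ j" for i j,
      OF poly scale conjI[OF ne' ne']]
  have "Q 1 1 a = 1" "Q 2 2 a = 1" "Q 3 3 a = 1" "Q 4 4 a = 1" for a
    using wc(1)[of 1 1 a] wc(1)[of 2 2 a] wc(1)[of 3 3 a] wc(1)[of 4 4 a] by (auto simp: Q0)
  moreover have "Q 2 1 a = a * q 2 1" "Q 4 3 a = a * q 4 3" for a
    using wc(3)[of 2 1 1 a] wc(3)[of 4 1 3 a] by (simp_all add: Q0 q_def dg_def power2_eq_square field_simps)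
  moreover have "Q 1 2 a = 0" "Q 3 4 a = 0" for a
    using wc(2)[of 2 1 1 a] wc(2)[of 4 1 3 a] by (simp_all add: dg_def power2_eq_square field_simps)
  moreover have "Q 1 3 a = 0" "Q 1 4 a = 0" "Q 2 3 a = 0" "Q 2 4 a = 0" "Q 3 1 a = 0" "Q 4 1 a = 0" "Q 3 2 a = 0" "Q 4 2 a = 0" for a
    using s' by (auto intro!: z simp: dg_def)
  ultimately have eq: "\<tau> (y2 a) = mk4 [[1, 0, 0, 0], [a * q 2 1, 1, 0, 0], [0, 0, 1, 0], [0, 0, a * q 4 3, 1]]" for a
    by (simp add: mat4_eq_iff forall_4 flip: Q_def)
  have "\<tau> (y2 1) \<in> carrier Sp4" by simp
  then have "q 2 1 = q 4 3" unfolding eq mk4_Sp4 by simp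
  then show ?thesis unfolding eq by (intro exI[of _ "q 2 1"]) (simp add: y1_def mult.commute)
qed

text \<open>Here \<open>dg s s\<close> centralizes the curve and maps to \<open>dg (s*s) 1\<close>,
  which leaves only the diagonal and the middle block. The element \<open>dg t (1/t)\<close> maps to
  \<open>dg 1 (t*t)\<close>, so entry 23 scales by \<open>t^4\<close> while the parameter scales by
  \<open>t^2\<close>: hence the square.\<close>

lemma tau_x1: "\<exists>c. \<forall>a. \<tau> (x1 a) = x2 (c * a ^ 2)"
proof -
  define Q where "Q i j a = \<tau> (x1 a) $ i $ j" for i j a
  define q where "q i j = Q i j 1" for i j
  have poly: "polyfun (Q i j)" for i j
    unfolding Q_def by (intro tau_curve_poly root_curve_poly root_Sp4)
  have Q0: "Q i j 0 = (if i = j then 1 else 0)" for i j by (simp add: Q_def roots_0 tau_one mat_nth)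
  obtain s :: 'k where s: "s \<noteq> 0" "s \<noteq> 1" using exists_generic by blast
  have fixed: "Q i j a = dg (s * s) 1 $ i $ i * Q i j a * inverse (dg (s * s) 1 $ j $ j)" for i j a
    using tau_conj_dg[of s s, OF _ _ root_Sp4(1)] s root_conj_dg(1)[of s s] by (simp add: Q_def)
  have ne: "dg (s * s) 1 $ i $ i \<noteq> 0" for i using s exhaust_4[of i] by (elim disjE) (simp_all add: dg_def)
  have scale: "Q i j (t^2 * a) = dg 1 (t * t) $ i $ i * Q i j a * inverse (dg 1 (t * t) $ j $ j)" if "t \<noteq> 0" for i j t a
    using tau_conj_dg[of t "inverse t", OF _ _ root_Sp4(1)] that root_conj_dg(1)[of t "inverse t" a]
    by (simp add: Q_def power2_eq_square divide_inverse)
  have ne': "dg 1 (t * t) $ i $ i \<noteq> 0" if "t \<noteq> 0" for i t using that exhaust_4[of i] by (elim disjE) (simp_all add: dg_def)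
  \<comment> \<open>The eigenvalues \<open>s^2\<close>, 1 and \<open>s^-2\<close> have to be
    pairwise distinct.\<close>
  have s1: "s * s \<noteq> 1" "(s * s) * (s * s) \<noteq> 1" using s sq_eq_1_iff by metis+
  then have s': "s * s \<noteq> 1" "1 \<noteq> s * s" "inverse (s * s) \<noteq> 1" "1 \<noteq> inverse (s * s)"
    "s * s \<noteq> inverse (s * s)" "inverse (s * s) \<noteq> s * s"
    using s by (auto simp: field_simps)
  have z: "Q i j a = 0" if "dg (s * s) 1 $ i $ i \<noteq> dg (s * s) 1 $ j $ j" for i j a
    using weight_curve_zero[OF fixed that ne] .
  note wc = weight_curve[of "Q i j" "\<lambda>t. dg 1 (t * t) $ i $ i" "\<lambda>t. dg 1 (t * t) $ j $ j" for i j,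
      OF poly scale conjI[OF ne' ne']]
  have "Q 1 1 a = 1" "Q 2 2 a = 1" "Q 3 3 a = 1" "Q 4 4 a = 1" for a
    using wc(1)[of 1 1 a] wc(1)[of 2 2 a] wc(1)[of 3 3 a] wc(1)[of 4 4 a] by (auto simp: Q0)
  moreover have "Q 2 3 a = a ^ 2 * q 2 3" for a
    using wc(3)[of 2 2 3 a] by (simp add: Q0 q_def dg_def power2_eq_square field_simps)
  moreover have "Q 3 2 a = 0" for a
    using wc(2)[of 2 2 3 a] by (simp add: dg_def power2_eq_square field_simps)
  moreover have "Q 1 2 a = 0" "Q 1 3 a = 0" "Q 1 4 a = 0" "Q 2 1 a = 0" "Q 3 1 a = 0" "Q 4 1 a = 0"
      "Q 2 4 a = 0" "Q 3 4 a = 0" "Q 4 2 a = 0" "Q 4 3 a = 0" for a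
    using s' by (auto intro!: z simp: dg_def simp del: inverse_mult_distrib)
  ultimately have "\<tau> (x1 a) = x2 (q 2 3 * a ^ 2)" for a
    by (simp add: mat4_eq_iff forall_4 x2_def mult.commute flip: Q_def)
  then show ?thesis by blast
qed

text \<open>Opposite to \<open>x1\<close>: now \<open>dg (1/t) t\<close> scales the parameter by
  \<open>t^2\<close>, and the surviving entry is 32.\<close>

lemma tau_y1: "\<exists>c. \<forall>a. \<tau> (y1 a) = y2 (c * a ^ 2)"
proof -
  define Q where "Q i j a = \<tau> (y1 a) $ i $ j" for i j a
  define q where "q i j = Q i j 1" for i j
  have poly: "polyfun (Q i j)" for i j
    unfolding Q_def by (intro tau_curve_poly root_curve_poly root_Sp4)
  have Q0: "Q i j 0 = (if i = j then 1 else 0)" for i j by (simp add: Q_def roots_0 tau_one mat_nth)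
  obtain s :: 'k where s: "s \<noteq> 0" "s \<noteq> 1" using exists_generic by blast
  have fixed: "Q i j a = dg (s * s) 1 $ i $ i * Q i j a * inverse (dg (s * s) 1 $ j $ j)" for i j a
    using tau_conj_dg[of s s, OF _ _ root_Sp4(2)] s root_conj_dg(2)[of s s] by (simp add: Q_def)
  have ne: "dg (s * s) 1 $ i $ i \<noteq> 0" for i using s exhaust_4[of i] by (elim disjE) (simp_all add: dg_def)
  have scale: "Q i j (t^2 * a) = dg 1 (inverse (t * t)) $ i $ i * Q i j a * inverse (dg 1 (inverse (t * t)) $ j $ j)" if "t \<noteq> 0" for i j t a
    using tau_conj_dg[of "inverse t" t, OF _ _ root_Sp4(2)] that root_conj_dg(2)[of "inverse t" t a]
    by (simp add: Q_def power2_eq_square divide_inverse)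
  have ne': "dg 1 (inverse (t * t)) $ i $ i \<noteq> 0" if "t \<noteq> 0" for i t using that exhaust_4[of i] by (elim disjE) (simp_all add: dg_def)
  have s1: "s * s \<noteq> 1" "(s * s) * (s * s) \<noteq> 1" using s sq_eq_1_iff by metis+
  then have s': "s * s \<noteq> 1" "1 \<noteq> s * s" "inverse (s * s) \<noteq> 1" "1 \<noteq> inverse (s * s)"
    "s * s \<noteq> inverse (s * s)" "inverse (s * s) \<noteq> s * s"
    using s by (auto simp: field_simps)
  have z: "Q i j a = 0" if "dg (s * s) 1 $ i $ i \<noteq> dg (s * s) 1 $ j $ j" for i j a
    using weight_curve_zero[OF fixed that ne] .
  note wc = weight_curve[of "Q i j" "\<lambda>t. dg 1 (inverse (t * t)) $ i $ i" "\<lambda>t. dg 1 (inverse (t * t)) $ j $ j" for i j,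
      OF poly scale conjI[OF ne' ne']]
  have "Q 1 1 a = 1" "Q 2 2 a = 1" "Q 3 3 a = 1" "Q 4 4 a = 1" for a
    using wc(1)[of 1 1 a] wc(1)[of 2 2 a] wc(1)[of 3 3 a] wc(1)[of 4 4 a] by (auto simp: Q0)
  moreover have "Q 3 2 a = a ^ 2 * q 3 2" for a
    using wc(3)[of 3 2 2 a] by (simp add: Q0 q_def dg_def power2_eq_square field_simps)
  moreover have "Q 2 3 a = 0" for a
    using wc(2)[of 3 2 2 a] by (simp add: dg_def power2_eq_square field_simps)
  moreover have "Q 1 2 a = 0" "Q 1 3 a = 0" "Q 1 4 a = 0" "Q 2 1 a = 0" "Q 3 1 a = 0" "Q 4 1 a = 0"
      "Q 2 4 a = 0" "Q 3 4 a = 0" "Q 4 2 a = 0" "Q 4 3 a = 0" for a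
    using s' by (auto intro!: z simp: dg_def simp del: inverse_mult_distrib)
  ultimately have "\<tau> (y1 a) = y2 (q 3 2 * a ^ 2)" for a
    by (simp add: mat4_eq_iff forall_4 y2_def mult.commute flip: Q_def)
  then show ?thesis by blast
qed

text \<open>On the root subgroups both maps agree up to four constants. The Frobenius condition and
  one reflection leave a single free constant, which conjugation by a torus element absorbs;
  \<open>Sp4_induct\<close> extends the agreement to the group.\<close>

theorem tau_eq_minors:
  "\<exists>c. c \<noteq> 0 \<and> (\<forall>g\<in>carrier Sp4. \<tau> g = dg 1 (inverse c) ** minors g ** dg 1 c)"
proof -
  obtain c where c: "\<And>a. \<tau> (x2 a) = x1 (c * a)" using tau_x2 by blast
  obtain c' where c': "\<And>a. \<tau> (y2 a) = y1 (c' * a)" using tau_y2 by blast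
  obtain b where b: "\<And>a. \<tau> (x1 a) = x2 (b * a ^ 2)" using tau_x1 by blast
  obtain b' where b': "\<And>a. \<tau> (y1 a) = y2 (b' * a ^ 2)" using tau_y1 by blast
  have frob: "frobenius (x2 1) = x2 1" "frobenius (y2 1) = y2 1"
    by (simp_all add: frobenius_def mat4_eq_iff forall_4 root_defs)
  \<comment> \<open>Applying the isogeny twice to \<open>x2 1\<close> gives
    \<open>x2 (b * c^2)\<close>, and Frobenius fixes \<open>x2 1\<close>.\<close>
  have "x2 (b * c ^ 2) $ 2 $ 3 = x2 1 $ 2 $ 3" using tau_tau[of "x2 1"] by (simp add: c b frob)
  then have bc: "b * c ^ 2 = 1" by (simp add: x2_def)
  have "y2 (b' * c' ^ 2) $ 3 $ 2 = y2 1 $ 3 $ 2" using tau_tau[of "y2 1"] by (simp add: c' b' frob)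
  then have bc': "b' * c' ^ 2 = 1" by (simp add: y2_def)
  obtain s :: 'k where s: "s \<noteq> 0" "s \<noteq> 1" using exists_generic by blast
  \<comment> \<open>The image of \<open>w2\<close> must invert \<open>dg s (1/s)\<close>, the image
    of \<open>dg 1 s\<close>. Its entry 11 is therefore zero, and this entry equals
    \<open>1 + c * c'\<close>.\<close>
  define W where "W = x1 c ** y1 c' ** x1 c"
  have "\<tau> w2 = W" by (simp add: w2_eq W_def tau_mult c c')
  moreover have "w2 ** dg 1 s = dg 1 (inverse s) ** w2" 
    by (simp add: w2_def dg_def mat4_eq_iff forall_4 mult4)
  ultimately have "W ** dg s (inverse s) = dg (inverse s) s ** W"
    using tau_mult[of w2 "dg 1 s"] tau_mult[of "dg 1 (inverse s)" w2] gen_Sp4[OF w_gen(2)] s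
    by (simp add: tau_dg divide_inverse)
  then have "(W ** dg s (inverse s)) $ 1 $ 1 = (dg (inverse s) s ** W) $ 1 $ 1" by simp
  then have "W $ 1 $ 1 * s = inverse s * W $ 1 $ 1" by (simp add: mult4 dg_def)
  then have "W $ 1 $ 1 * (s * s - 1) = 0" using s by (simp add: field_simps)
  then have "W $ 1 $ 1 = 0" using s sq_eq_1_iff[of s] by simp
  then have cc': "c * c' = 1" by (simp add: W_def mult4 root_defs)
  then have c0: "c \<noteq> 0" and c'_eq: "c' = inverse c" by (auto simp: inverse_unique)
  have b_eq: "b = inverse (c ^ 2)" and b'_eq: "b' = c ^ 2"
    using bc bc' c0 by (auto simp: c'_eq field_simps inverse_unique)
  have inv: "dg 1 c ** dg 1 (inverse c) = mat 1"
    using c0 by (simp add: dg_mult dg_one)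
  have "\<tau> g = dg 1 (inverse c) ** minors g ** dg 1 c" if "g \<in> carrier Sp4" for g
    using that
  proof (induction rule: Sp4_induct)
    case one
    then show ?case using c0 by (simp add: tau_one dg_mult dg_one)
  next
    have step: "\<tau> (h ** g) = dg 1 (inverse c) ** minors (h ** g) ** dg 1 c"
      if "h \<in> carrier Sp4" "g \<in> carrier Sp4" "\<tau> g = dg 1 (inverse c) ** minors g ** dg 1 c"
        "\<tau> h = dg 1 (inverse c) ** minors h ** dg 1 c" for h g
    proof -
      have "\<tau> (h ** g) = dg 1 (inverse c) ** minors h ** (dg 1 c ** dg 1 (inverse c)) ** minors g ** dg 1 c"
        using that by (simp add: tau_mult matrix_mul_assoc)
      then show ?thesis using that by (simp add: inv minors_mult matrix_mul_assoc)
    qed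
    have ic: "inverse c \<noteq> 0" using c0 by simp
    note conj = root_conj_dg[OF one_neq_zero ic, simplified]
    { case (x1 g t)
      then show ?case using c0 by (intro step) (simp_all add: b b_eq minors_roots conj, simp add: field_simps) }
    { case (y1 g t)
      then show ?case using c0 by (intro step) (simp_all add: b' b'_eq minors_roots conj, simp add: field_simps) }
    { case (x2 g t)
      then show ?case using c0 by (intro step) (simp_all add: c minors_roots conj, simp add: field_simps) }
    { case (y2 g t)
      then show ?case using c0 by (intro step) (simp_all add: c' c'_eq minors_roots conj) }
  qed
  then show ?thesis using c0 by blast
qed

end

section \<open>The ideal of the kernel\<close>

lemma coord_ring_simps:
  "mult coord_ring = (\<lambda>f h. \<lambda>g\<in>carrier Sp4. f g * h g)"
  "one coord_ring = (\<lambda>g\<in>carrier Sp4. 1)"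
  "zero coord_ring = (\<lambda>g\<in>carrier Sp4. 0)"
  "add coord_ring = (\<lambda>f h. \<lambda>g\<in>carrier Sp4. f g + h g)"
  by (simp_all add: coord_ring_def)

lemma coord_ring_closed:
  assumes "f \<in> carrier coord_ring" "h \<in> carrier coord_ring"
  shows "(\<lambda>g\<in>carrier Sp4. f g + h g) \<in> carrier coord_ring"
    and "(\<lambda>g\<in>carrier Sp4. f g * h g) \<in> carrier coord_ring"
    and "(\<lambda>g\<in>carrier Sp4. c * f g) \<in> carrier coord_ring"
    and "(\<lambda>g\<in>carrier Sp4. - f g) \<in> carrier coord_ring"
proof -
  obtain f' h' where f: "f' \<in> poly_funs" "f = restrict f' (carrier Sp4)"
    and h: "h' \<in> poly_funs" "h = restrict h' (carrier Sp4)" using assms by (meson coord_ringE)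
  have "(\<lambda>g\<in>carrier Sp4. f g + h g) = restrict (\<lambda>g. f' g + h' g) (carrier Sp4)"
    "(\<lambda>g\<in>carrier Sp4. f g * h g) = restrict (\<lambda>g. f' g * h' g) (carrier Sp4)"
    "(\<lambda>g\<in>carrier Sp4. c * f g) = restrict (\<lambda>g. c * f' g) (carrier Sp4)"
    "(\<lambda>g\<in>carrier Sp4. - f g) = restrict (\<lambda>g. - f' g) (carrier Sp4)"
    by (auto simp: f h intro!: restrict_ext)
  then show "(\<lambda>g\<in>carrier Sp4. f g + h g) \<in> carrier coord_ring" "(\<lambda>g\<in>carrier Sp4. f g * h g) \<in> carrier coord_ring"
    "(\<lambda>g\<in>carrier Sp4. c * f g) \<in> carrier coord_ring" "(\<lambda>g\<in>carrier Sp4. - f g) \<in> carrier coord_ring"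
    using poly_funs.add[OF f(1) h(1)] poly_funs.mult[OF f(1) h(1)] poly_funs_cmult[OF f(1), of c] poly_funs_uminus[OF f(1)]
    by (simp_all add: restrict_in_coord_ring)
qed

lemma coord_ring_const: "(\<lambda>g\<in>carrier Sp4. c) \<in> carrier coord_ring"
  using restrict_in_coord_ring[OF poly_funs.const] .

lemma coord_ring_ext:
  assumes "f \<in> carrier coord_ring" shows "(\<lambda>g\<in>carrier Sp4. f g) = f"
  using assms by (auto elim!: coord_ringE intro!: restrict_ext)

lemma coord_ring_extensional: "f \<in> carrier coord_ring \<Longrightarrow> f \<in> extensional (carrier Sp4)"
  by (auto elim!: coord_ringE)

lemma coord_ring_cring: "cring (coord_ring :: ('k::field mat4 \<Rightarrow> 'k) ring)"
proof (rule cringI)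
  show "abelian_group (coord_ring :: ('k mat4 \<Rightarrow> 'k) ring)"
  proof (rule abelian_groupI)
    fix f assume f: "f \<in> carrier (coord_ring :: ('k mat4 \<Rightarrow> 'k) ring)"
    show "\<exists>h\<in>carrier coord_ring. h \<oplus>\<^bsub>coord_ring\<^esub> f = \<zero>\<^bsub>coord_ring\<^esub>"
      by (rule bexI[OF _ coord_ring_closed(4)[OF f f]]) (auto simp: coord_ring_simps intro!: restrict_ext)
    show "\<zero>\<^bsub>coord_ring\<^esub> \<oplus>\<^bsub>coord_ring\<^esub> f = f"
      using coord_ring_ext[OF f] by (auto simp: coord_ring_simps cong: restrict_cong)
  qed (auto simp: coord_ring_simps coord_ring_closed coord_ring_const add_ac intro!: restrict_ext)
  show "comm_monoid (coord_ring :: ('k mat4 \<Rightarrow> 'k) ring)"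
  proof (rule comm_monoidI)
    fix f assume f: "f \<in> carrier (coord_ring :: ('k mat4 \<Rightarrow> 'k) ring)"
    show "\<one>\<^bsub>coord_ring\<^esub> \<otimes>\<^bsub>coord_ring\<^esub> f = f"
      using coord_ring_ext[OF f] by (auto simp: coord_ring_simps cong: restrict_cong)
  qed (auto simp: coord_ring_simps coord_ring_closed coord_ring_const mult_ac intro!: restrict_ext)
qed (auto simp: coord_ring_simps algebra_simps intro!: restrict_ext)

context char2
begin

text \<open>The polynomials whose restriction to \<open>Sp4\<close> lies in the ideal of the kernel.
  Lifts are kept because derivatives are computed on matrices that may leave the group. The sum with
  \<open>mat 1\<close> is a difference in characteristic 2.\<close>

inductive_set kid :: "('k mat4 \<Rightarrow> 'k) set" where
  vanish: "f \<in> poly_funs \<Longrightarrow> (\<And>g. g \<in> carrier Sp4 \<Longrightarrow> f g = 0) \<Longrightarrow> f \<in> kid"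
| minor: "h \<in> poly_funs \<Longrightarrow> (\<lambda>g. h g * (minors g $ i $ j + mat 1 $ i $ j)) \<in> kid"
| add: "f \<in> kid \<Longrightarrow> h \<in> kid \<Longrightarrow> (\<lambda>g. f g + h g) \<in> kid"

lemmas pf = poly_funs.intros

lemma kid_poly: "f \<in> kid \<Longrightarrow> f \<in> poly_funs"
  by (induction rule: kid.induct) (auto intro!: pf)

lemma kid_mult: "f \<in> kid \<Longrightarrow> h \<in> poly_funs \<Longrightarrow> (\<lambda>g. h g * f g) \<in> kid"
proof (induction rule: kid.induct)
  case (vanish f)
  then show ?case by (auto intro!: kid.vanish pf)
next
  case (minor h' i j)
  then show ?case using kid.minor[of "\<lambda>g. h g * h' g" i j] by (simp add: pf mult.assoc)
next
  case (add f f')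
  then show ?case using kid.add[of "\<lambda>g. h g * f g" "\<lambda>g. h g * f' g"] by (simp add: distrib_left)
qed

lemma kid_mult': "f \<in> kid \<Longrightarrow> h \<in> poly_funs \<Longrightarrow> (\<lambda>g. f g * h g) \<in> kid"
  using kid_mult by (simp add: mult.commute)

lemma kid_cong: "f \<in> kid \<Longrightarrow> h \<in> poly_funs \<Longrightarrow> (\<And>g. g \<in> carrier Sp4 \<Longrightarrow> h g = f g) \<Longrightarrow> h \<in> kid"
  using kid.add[of f "\<lambda>g. f g + h g", OF _ kid.vanish] by (simp add: kid_poly pf)

lemma kid_zero: "(\<lambda>_. 0) \<in> kid"
  by (rule kid.vanish) (auto intro: pf)

lemma kid_sum: "(\<And>i. i \<in> A \<Longrightarrow> f i \<in> kid) \<Longrightarrow> (\<lambda>g. \<Sum>i\<in>A. f i g) \<in> kid"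
  by (induction A rule: infinite_finite_induct) (auto intro: kid_zero kid.add)

lemma kid_cmult: "f \<in> kid \<Longrightarrow> (\<lambda>g. c * f g) \<in> kid"
  by (intro kid_mult pf)

text \<open>The identity is a point of the kernel; this is how constants modulo the ideal are read
  off.\<close>

lemma kid_one: "f \<in> kid \<Longrightarrow> f (mat 1) = 0"
  by (induction rule: kid.induct) auto

lemma kid_minors: "(\<lambda>g. minors g $ i $ j + mat 1 $ i $ j) \<in> kid"
  using kid.minor[of "\<lambda>_. 1"] by (simp add: pf)

lemma conj_poly: "f \<in> poly_funs \<Longrightarrow> (\<lambda>g. f (x ** g ** y)) \<in> poly_funs"
proof (rule poly_funs_compose)
  fix i j show "(\<lambda>A. (x ** A ** y) $ i $ j) \<in> poly_funs"
    unfolding matrix_mult_nth[of _ y]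
    by (intro poly_funs_sum pf poly_funs_matrix_mult_left)
qed

lemma mult_mat_sandwich:
  "(x ** a ** y) $ i $ j = (\<Sum>m\<in>UNIV. \<Sum>l\<in>UNIV. (x $ i $ l * y $ m $ j) * (a::'k mat4) $ l $ m)"
  by (simp add: matrix_mult_nth sum_distrib_right sum_distrib_left mult_ac)

text \<open>The kernel is normal: as \<open>minors x ** minors y\<close> is the identity,
  conjugation turns \<open>minors g - 1\<close> into
  \<open>minors x ** (minors g - 1) ** minors y\<close>.\<close>

lemma kid_conj:
  assumes y: "x \<in> carrier Sp4" "y \<in> carrier Sp4" "x ** y = mat 1"
  shows "f \<in> kid \<Longrightarrow> (\<lambda>g. f (x ** g ** y)) \<in> kid"
proof (induction rule: kid.induct)
  case (vanish f)
  then show ?case using y by (auto intro!: kid.vanish conj_poly)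
next
  case (minor h i j)
  let ?R = "\<lambda>g. \<Sum>m\<in>UNIV. \<Sum>l\<in>UNIV. (minors x $ i $ l * minors y $ m $ j) * (minors g $ l $ m + mat 1 $ l $ m)"
  have R: "?R \<in> kid" by (intro kid_sum kid_cmult kid_minors)
  have eq: "minors (x ** g ** y) $ i $ j + mat 1 $ i $ j = ?R g" if "g \<in> carrier Sp4" for g
  proof -
    have "?R g = (minors x ** minors g ** minors y) $ i $ j + (minors x ** mat 1 ** minors y) $ i $ j"
      by (simp only: mult_mat_sandwich sum.distrib distrib_left)
    also have "minors x ** mat 1 ** minors y = mat 1"
      unfolding matrix_mul_rid minors_mult[OF y(1,2), symmetric] y(3) by simp
    finally show ?thesis using that y by (simp add: minors_mult)
  qed
  show ?case
    by (rule kid_cong[OF kid_mult[OF R conj_poly[OF minor]]])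
       (auto simp: eq intro!: pf conj_poly[OF minor] conj_poly[where f = "\<lambda>g. minors g $ i $ j"])
qed (rule kid.add)

definition eqv :: "('k mat4 \<Rightarrow> 'k) \<Rightarrow> ('k mat4 \<Rightarrow> 'k) \<Rightarrow> bool" (infix "\<doteq>" 50) where
  "f \<doteq> h \<longleftrightarrow> f \<in> poly_funs \<and> h \<in> poly_funs \<and> (\<lambda>g. f g + h g) \<in> kid"

lemma eqv_refl: "f \<in> poly_funs \<Longrightarrow> f \<doteq> f"
  by (simp add: eqv_def kid_zero)

lemma eqv_sym: "f \<doteq> h \<Longrightarrow> h \<doteq> f"
  by (simp add: eqv_def add.commute)

lemma eqv_trans [trans]: "f \<doteq> h \<Longrightarrow> h \<doteq> k \<Longrightarrow> f \<doteq> k"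
  using kid.add[of "\<lambda>g. f g + h g" "\<lambda>g. h g + k g"] by (auto simp: eqv_def add.assoc)

lemma eqv_add: "f \<doteq> h \<Longrightarrow> f' \<doteq> h' \<Longrightarrow> (\<lambda>g. f g + f' g) \<doteq> (\<lambda>g. h g + h' g)"
proof -
  assume a: "f \<doteq> h" "f' \<doteq> h'"
  then have "(\<lambda>g. (f g + h g) + (f' g + h' g)) \<in> kid" unfolding eqv_def by (blast intro: kid.add[of "\<lambda>g. f g + h g" "\<lambda>g. f' g + h' g"])
  moreover have "(\<lambda>g. (f g + h g) + (f' g + h' g)) = (\<lambda>g. (f g + f' g) + (h g + h' g))" by (simp add: add_ac)
  ultimately show ?thesis using a unfolding eqv_def by (simp add: pf)
qed

lemma eqv_mult:
  assumes "f \<doteq> h" "f' \<doteq> h'" shows "(\<lambda>g. f g * f' g) \<doteq> (\<lambda>g. h g * h' g)"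
proof -
  have "(\<lambda>g. f' g * (f g + h g) + h g * (f' g + h' g)) \<in> kid"
    using assms unfolding eqv_def
    by (blast intro: kid.add[OF kid_mult[of "\<lambda>g. f g + h g" f'] kid_mult[of "\<lambda>g. f' g + h' g" h]])
  then show ?thesis using assms by (auto simp: eqv_def algebra_simps intro!: pf)
qed

lemma eqv_zero_iff: "f \<doteq> (\<lambda>_. 0) \<longleftrightarrow> f \<in> kid"
  by (auto simp: eqv_def kid_poly intro: pf)

lemma eqvI:
  assumes "f \<in> poly_funs" "h \<in> poly_funs" "r \<in> kid" "\<And>g. g \<in> carrier Sp4 \<Longrightarrow> f g + h g = r g"
  shows "f \<doteq> h"
  using assms by (auto simp: eqv_def intro!: pf kid_cong[of r])

lemma kid_eqv: "f \<in> kid \<Longrightarrow> h \<doteq> f \<Longrightarrow> h \<in> kid"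
  using eqv_trans[of h f "\<lambda>_. 0"] eqv_zero_iff by blast

end

section \<open>Identification of the ideal of the kernel\<close>

context special
begin

definition tau_scalar :: 'k where
  "tau_scalar = (SOME c. c \<noteq> 0 \<and> (\<forall>g\<in>carrier Sp4. \<tau> g = dg 1 (inverse c) ** minors g ** dg 1 c))"

lemma tau_scalar: "tau_scalar \<noteq> 0"
    "g \<in> carrier Sp4 \<Longrightarrow> \<tau> g = dg 1 (inverse tau_scalar) ** minors g ** dg 1 tau_scalar"
  using someI_ex[OF tau_eq_minors] unfolding tau_scalar_def by blast+

lemma dg_scalar_inverse:
  "dg 1 (inverse tau_scalar) ** dg 1 tau_scalar = mat 1" "dg 1 tau_scalar ** dg 1 (inverse tau_scalar) = mat 1"
  using tau_scalar by (simp_all add: dg_mult dg_one)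

lemma minors_tau:
  assumes "g \<in> carrier Sp4"
  shows "minors g = dg 1 tau_scalar ** \<tau> g ** dg 1 (inverse tau_scalar)"
proof -
  have "dg 1 tau_scalar ** \<tau> g ** dg 1 (inverse tau_scalar) =
    (dg 1 tau_scalar ** dg 1 (inverse tau_scalar)) ** minors g ** (dg 1 tau_scalar ** dg 1 (inverse tau_scalar))"
    by (simp add: tau_scalar(2)[OF assms] matrix_mul_assoc)
  then show ?thesis by (simp add: dg_scalar_inverse)
qed

text \<open>A polynomial map on all matrices that extends the isogeny, whose values off
  \<open>Sp4\<close> are arbitrary.\<close>

definition tau_pol :: "'k mat4 \<Rightarrow> 'k mat4" where
  "tau_pol g = dg 1 (inverse tau_scalar) ** minors g ** dg 1 tau_scalar"

lemma tau_pol: "g \<in> carrier Sp4 \<Longrightarrow> \<tau> g = tau_pol g"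
  by (simp add: tau_pol_def tau_scalar)

lemma tau_pol_one: "tau_pol (mat 1) = mat 1"
  by (simp add: tau_pol_def dg_scalar_inverse)

lemma tau_pol_poly: "(\<lambda>g. tau_pol g $ i $ j) \<in> poly_funs"
  unfolding tau_pol_def mult_mat_sandwich by (intro poly_funs_sum pf minors_in_poly_funs)

text \<open>The isogeny is constant on its kernel: the entries of \<open>tau_pol g - 1\<close> are
  linear combinations of those of \<open>minors g - 1\<close>, and congruences respect sums and
  products.\<close>

lemma kid_tau_pol:
  "f \<in> poly_funs \<Longrightarrow> (\<lambda>g. f (tau_pol g)) \<doteq> (\<lambda>g. f (mat 1))"
proof (induction rule: poly_funs.induct)
  case (const c)
  then show ?case by (simp add: eqv_refl pf)
next
  case (entry i j)
  let ?l = "dg 1 (inverse tau_scalar)" and ?r = "dg 1 tau_scalar"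
  let ?R = "\<lambda>g. \<Sum>m\<in>UNIV. \<Sum>l\<in>UNIV. (?l $ i $ l * ?r $ m $ j) * (minors g $ l $ m + mat 1 $ l $ m)"
  have "?R \<in> kid" by (intro kid_sum kid_cmult kid_minors)
  moreover have "?R g = tau_pol g $ i $ j + tau_pol (mat 1) $ i $ j" for g
    unfolding tau_pol_def minors_one by (simp only: mult_mat_sandwich sum.distrib distrib_left)
  ultimately show ?case
    by (intro eqvI[of _ _ ?R] pf tau_pol_poly) (simp_all add: tau_pol_one)
qed (auto intro: eqv_add eqv_mult)

lemma ker_ideal_eq: "ker_ideal \<tau> = (\<lambda>f. restrict f (carrier Sp4)) ` kid"
proof
  interpret cring "coord_ring :: ('k mat4 \<Rightarrow> 'k) ring" by (rule coord_ring_cring)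
  let ?I = "(\<lambda>f. restrict f (carrier Sp4)) ` kid"
  let ?G = "{\<lambda>g\<in>carrier Sp4. f (\<tau> g) | f. f \<in> carrier coord_ring \<and> f \<one>\<^bsub>Sp4\<^esub> = 0}"
  have mult_I: "(\<lambda>g\<in>carrier Sp4. x g * a g) \<in> ?I" if x: "x \<in> carrier coord_ring" and a: "a \<in> ?I" for x a
  proof -
    obtain x' a' where "x' \<in> poly_funs" "x = restrict x' (carrier Sp4)" "a' \<in> kid" "a = restrict a' (carrier Sp4)"
      using x a by (auto elim!: coord_ringE)
    then show ?thesis
      by (intro image_eqI[of _ _ "\<lambda>g. x' g * a' g"] kid_mult) (auto intro!: restrict_ext)
  qed
  have "ideal ?I coord_ring"
  proof (rule idealI[OF ring_axioms])
    show "subgroup ?I (add_monoid coord_ring)"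
    proof (rule subgroup.intro)
      fix x y assume "x \<in> ?I" "y \<in> ?I"
      then obtain x' y' where "x' \<in> kid" "y' \<in> kid" "x = restrict x' (carrier Sp4)" "y = restrict y' (carrier Sp4)" by auto
      then show "x \<otimes>\<^bsub>add_monoid coord_ring\<^esub> y \<in> ?I"
        by (auto simp: coord_ring_simps intro!: image_eqI[of _ _ "\<lambda>g. x' g + y' g"] kid.add restrict_ext)
    next
      fix x assume x: "x \<in> ?I"
      then obtain x' where x': "x' \<in> kid" "x = restrict x' (carrier Sp4)" by auto
      then have xc: "x \<in> carrier coord_ring" by (auto dest: kid_poly)
      have "\<ominus>\<^bsub>coord_ring\<^esub> x = x"
        by (rule minus_equality) (auto simp: xc coord_ring_simps intro!: restrict_ext)
      then show "inv\<^bsub>add_monoid coord_ring\<^esub> x \<in> ?I" using x by (simp add: a_inv_def)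
    qed (auto simp: coord_ring_simps dest: kid_poly intro: kid_zero)
  next
    fix a x assume a: "a \<in> ?I" "x \<in> carrier (coord_ring :: ('k mat4 \<Rightarrow> 'k) ring)"
    show "x \<otimes>\<^bsub>coord_ring\<^esub> a \<in> ?I" "a \<otimes>\<^bsub>coord_ring\<^esub> x \<in> ?I"
      using mult_I[OF a(2,1)] by (simp_all add: coord_ring_simps mult.commute)
  qed
  moreover have "?G \<subseteq> ?I"
  proof
    fix u assume "u \<in> ?G"
    then obtain f where f: "f \<in> carrier coord_ring" "f (mat 1) = 0" "u = (\<lambda>g\<in>carrier Sp4. f (\<tau> g))" by auto
    then obtain f' where f': "f' \<in> poly_funs" "f = restrict f' (carrier Sp4)" by (auto elim!: coord_ringE)
    then have "f' (mat 1) = 0" using f(2) by simp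
    then have "(\<lambda>g. f' (tau_pol g)) \<in> kid" using kid_tau_pol[OF f'(1)] by (simp add: eqv_zero_iff)
    moreover have "u = restrict (\<lambda>g. f' (tau_pol g)) (carrier Sp4)"
      unfolding f(3) f'(2)
    proof (rule restrict_ext)
      fix g :: "'k mat4" assume g: "g \<in> carrier Sp4"
      show "restrict f' (carrier Sp4) (\<tau> g) = f' (tau_pol g)"
        using tau_Sp4[OF g] by (simp add: tau_pol[OF g, symmetric])
    qed
    ultimately show "u \<in> ?I" by blast
  qed
  ultimately show "ker_ideal \<tau> \<subseteq> ?I" unfolding ker_ideal_def by (intro genideal_minimal)
  have Gc: "?G \<subseteq> carrier coord_ring" 
    by (rule order.trans[OF \<open>?G \<subseteq> ?I\<close>]) (auto dest: kid_poly)
  interpret J: ideal "ker_ideal \<tau>" "coord_ring :: ('k mat4 \<Rightarrow> 'k) ring"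
    unfolding ker_ideal_def by (rule genideal_ideal[OF Gc])
  have "restrict f (carrier Sp4) \<in> ker_ideal \<tau>" if "f \<in> kid" for f
    using that
  proof (induction rule: kid.induct)
    case (vanish f)
    then have "restrict f (carrier Sp4) = \<zero>\<^bsub>coord_ring\<^esub>" by (auto simp: coord_ring_simps intro!: restrict_ext)
    then show ?case using J.zero_closed by simp
  next
    case (minor h i j)
    \<comment> \<open>The coordinate function that undoes the conjugation by the torus: composed
      with \<open>\<tau>\<close> it is an entry of \<open>minors g - 1\<close>, and it vanishes at
      the identity.\<close>
    define p where "p g = (dg 1 tau_scalar ** g ** dg 1 (inverse tau_scalar)) $ i $ j + mat 1 $ i $ j" for g :: "'k mat4"
    have "p \<in> poly_funs" unfolding p_def[abs_def] using conj_poly[OF pf(2)] by (intro pf)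
    moreover have "p (mat 1) = 0" by (simp add: p_def dg_scalar_inverse)
    ultimately have "(\<lambda>g\<in>carrier Sp4. restrict p (carrier Sp4) (\<tau> g)) \<in> ?G"
      by (intro CollectI exI[of _ "restrict p (carrier Sp4)"]) auto
    then have *: "(\<lambda>g\<in>carrier Sp4. restrict p (carrier Sp4) (\<tau> g)) \<in> ker_ideal \<tau>"
      unfolding ker_ideal_def using genideal_self[OF Gc] by blast
    have "restrict h (carrier Sp4) \<otimes>\<^bsub>coord_ring\<^esub> (\<lambda>g\<in>carrier Sp4. restrict p (carrier Sp4) (\<tau> g)) \<in> ker_ideal \<tau>"
      using J.I_l_closed[OF * restrict_in_coord_ring[OF minor]] .
    moreover have "restrict h (carrier Sp4) \<otimes>\<^bsub>coord_ring\<^esub> (\<lambda>g\<in>carrier Sp4. restrict p (carrier Sp4) (\<tau> g)) =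
      (\<lambda>g\<in>carrier Sp4. h g * (minors g $ i $ j + mat 1 $ i $ j))"
      using tau_Sp4 by (auto simp: coord_ring_simps minors_tau p_def intro!: restrict_ext)
    ultimately show ?case by (simp only:)
  next
    case (add f h)
    from J.a_closed[OF add.IH] show ?case by (auto simp: coord_ring_simps restrict_def if_distrib cong: if_cong)
  qed
  then show "?I \<subseteq> ker_ideal \<tau>" by auto
qed

text \<open>The squares of the entries are the entries of \<open>\<tau> (\<tau> g)\<close>, so the
  kernel lies in the Frobenius kernel.\<close>

lemma kid_square: "(\<lambda>g. g $ i $ j * g $ i $ j) \<doteq> (\<lambda>g. mat 1 $ i $ j)"
proof -
  have "(\<lambda>g. tau_pol (tau_pol g) $ i $ j) \<doteq> (\<lambda>g. tau_pol (mat 1) $ i $ j)"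
    using kid_tau_pol[OF tau_pol_poly] .
  moreover have "(\<lambda>g. g $ i $ j * g $ i $ j) \<doteq> (\<lambda>g. tau_pol (tau_pol g) $ i $ j)"
  proof (rule eqvI[OF _ _ kid_zero])
    fix g assume g: "g \<in> carrier (Sp4 :: 'k mat4 monoid)"
    have "tau_pol (tau_pol g) = frobenius g" using tau_tau[OF g] g by (simp add: tau_pol[symmetric])
    then show "g $ i $ j * g $ i $ j + tau_pol (tau_pol g) $ i $ j = 0"
      by (simp add: frobenius_def power2_eq_square)
  qed (auto intro!: pf poly_funs_compose[OF tau_pol_poly] tau_pol_poly)
  ultimately have "(\<lambda>g. g $ i $ j * g $ i $ j) \<doteq> (\<lambda>g. tau_pol (mat 1) $ i $ j)"
    using eqv_trans by blast
  then show ?thesis by (simp add: tau_pol_one)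
qed

end

section \<open>Invariant derivations modulo the kernel ideal\<close>

context char2
begin

text \<open>Tangent vectors of the short root subgroups, numbered so that \<open>srv j\<close> is dual to \<open>phi j\<close>.\<close>

definition srv :: "4 \<Rightarrow> 'k mat4" where
  "srv j = (if j = 1 then mk4 [[0,0,0,0],[0,0,0,0],[1,0,0,0],[0,1,0,0]]
    else if j = 2 then mk4 [[0,0,0,0],[1,0,0,0],[0,0,0,0],[0,0,1,0]]
    else if j = 3 then mk4 [[0,1,0,0],[0,0,0,0],[0,0,0,1],[0,0,0,0]]
    else mk4 [[0,0,1,0],[0,0,0,1],[0,0,0,0],[0,0,0,0]])"

lemma srv_simps:
  "srv 1 = mk4 [[0,0,0,0],[0,0,0,0],[1,0,0,0],[0,1,0,0]]"
  "srv 2 = mk4 [[0,0,0,0],[1,0,0,0],[0,0,0,0],[0,0,1,0]]"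
  "srv 3 = mk4 [[0,1,0,0],[0,0,0,0],[0,0,0,1],[0,0,0,0]]"
  "srv 4 = mk4 [[0,0,1,0],[0,0,0,1],[0,0,0,0],[0,0,0,0]]"
  by (simp_all add: srv_def)

text \<open>Short root elements are affine in their parameter, so the whole line lies in
  \<open>Sp4\<close> and not only its first-order part.\<close>

lemma srv_curve: "shift (mat 1) (srv j) t \<in> carrier Sp4"
proof -
  have "shift (mat 1) (srv 1) t = y12 t" "shift (mat 1) (srv 2) t = y1 t"
    "shift (mat 1) (srv 3) t = x1 t" "shift (mat 1) (srv 4) t = x12 t"
    by (simp_all add: mat4_eq_iff forall_4 srv_simps root_defs root_defs' mat_nth)
  then show ?thesis using exhaust_4[of j] gen_Sp4[OF root_gen'(1)] gen_Sp4[OF root_gen'(2)] by auto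
qed

lemma srv_curve_Sp4: "g \<in> carrier Sp4 \<Longrightarrow> shift g (g ** srv j) t \<in> carrier Sp4"
  using Sp4_mult[OF _ srv_curve[of j t], of g] by (simp add: shift_mult_left)

abbreviation der :: "4 \<Rightarrow> ('k mat4 \<Rightarrow> 'k) \<Rightarrow> 'k mat4 \<Rightarrow> 'k" where
  "der j \<equiv> lderiv (srv j)"

abbreviation euler :: "('k mat4 \<Rightarrow> 'k) \<Rightarrow> 'k mat4 \<Rightarrow> 'k" where
  "euler \<equiv> lderiv (mat 1)"

lemma der_cong:
  assumes "\<And>g. g \<in> carrier Sp4 \<Longrightarrow> f g = h g" "g \<in> carrier Sp4"
  shows "der j f g = der j h g"
  by (simp add: lderiv_def lin_def assms srv_curve_Sp4)

text \<open>Numbers 3 and 2 belong to \<open>x1\<close> and \<open>y1\<close>. Their commutator is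
  the coroot \<open>diag(1,-1,1,-1)\<close>, the identity matrix in characteristic 2.\<close>

lemma euler_commutator:
  assumes "f \<in> poly_funs" shows "euler f = (\<lambda>g. der 3 (der 2 f) g + der 2 (der 3 f) g)"
proof -
  have "srv 3 ** srv 2 - srv 2 ** srv 3 = mat 1"
    by (simp add: mat4_eq_iff forall_4 srv_simps mult4 mat_nth)
  then show ?thesis using lderiv_commutator[OF assms, of "srv 3" "srv 2"] by (simp add: minus_eq fun_eq_iff)
qed

text \<open>The line through \<open>g\<close> along \<open>g\<close> leaves \<open>Sp4\<close>, so
  the argument of \<open>der_cong\<close> fails; writing \<open>euler\<close> as a commutator
  repairs this.\<close>

lemma euler_cong:
  assumes "f \<in> poly_funs" "h \<in> poly_funs" "\<And>g. g \<in> carrier Sp4 \<Longrightarrow> f g = h g" "g \<in> carrier Sp4"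
  shows "euler f g = euler h g"
  unfolding euler_commutator[OF assms(1)] euler_commutator[OF assms(2)]
  by (intro arg_cong2[of _ _ _ _ "(+)"] der_cong assms)

lemma polyfun_minors [simp]: "polyfun (\<lambda>t. minors (shift A Y t) $ i $ j)"
  by (rule polyfun_shift[OF minors_in_poly_funs])

lemma lin_minor: "lin (minor a b c d) A Y =
    A $ a $ c * Y $ b $ d + Y $ a $ c * A $ b $ d - (A $ a $ d * Y $ b $ c + Y $ a $ d * A $ b $ c)"
  unfolding minor_def[abs_def] by (subst lin_diff) (simp_all add: poly_funs.intros)

lemma lin_phi_one: "lin (phi i) (mat 1) (srv j) = (if i = j then 1 else 0)"
  unfolding phi_def[abs_def] lin_minor
  using exhaust_4[of i] exhaust_4[of j]
  by (elim disjE) (simp_all add: srv_simps mat_nth)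

text \<open>The differential of the isogeny kills short root vectors, in line with the squared
  parameters in \<open>minors_roots\<close>.\<close>

lemma lin_minors_one: "lin (\<lambda>A. minors A $ i $ m) (mat 1) (srv j) = 0"
proof -
  have "\<forall>i m. lin (\<lambda>A. minors A $ i $ m) (mat 1) (srv j) = 0" if "j = 1 \<or> j = 2 \<or> j = 3 \<or> j = 4" for j
    using that unfolding minors_nth lin_minor forall_4
    by (elim disjE) (simp_all add: srv_simps mat_nth)
  then show ?thesis using exhaust_4[of j] by blast
qed

lemma der_minors:
  assumes g: "g \<in> carrier Sp4"
  shows "der j (\<lambda>A. minors A $ i $ m) g = 0"
proof -
  have "der j (\<lambda>A. minors A $ i $ m) g = dcoef (\<lambda>t. minors (g ** shift (mat 1) (srv j) t) $ i $ m)"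
    by (simp add: lderiv_def lin_def shift_mult_left)
  also have "\<dots> = dcoef (\<lambda>t. \<Sum>l\<in>UNIV. minors g $ i $ l * minors (shift (mat 1) (srv j) t) $ l $ m)"
    by (simp add: minors_mult[OF g srv_curve] matrix_mult_nth)
  also have "\<dots> = (\<Sum>l\<in>UNIV. minors g $ i $ l * lin (\<lambda>A. minors A $ l $ m) (mat 1) (srv j))"
    by (subst dcoef_sum) (auto simp: dcoef_cmult lin_def intro!: polyfun_mult)
  finally show ?thesis by (simp add: lin_minors_one)
qed

text \<open>In \<open>phi_mult\<close> the factor \<open>minors\<close> is constant to first order,
  so only \<open>phi i\<close> of the moving factor contributes, and its derivatives at the identity
  are dual to \<open>srv\<close>.\<close>

lemma der_phi:
  assumes g: "g \<in> carrier Sp4"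
  shows "der j (phi i) g = (if i = j then 1 else 0)"
proof -
  have "der j (phi i) g = dcoef (\<lambda>t. phi i (g ** shift (mat 1) (srv j) t))"
    by (simp add: lderiv_def lin_def shift_mult_left)
  also have "\<dots> = dcoef (\<lambda>t. phi i (shift (mat 1) (srv j) t) + (\<Sum>l\<in>UNIV. phi l g * minors (shift (mat 1) (srv j) t) $ l $ i))"
    by (simp add: phi_mult[OF g srv_curve])
  also have "\<dots> = dcoef (\<lambda>t. phi i (shift (mat 1) (srv j) t)) +
      dcoef (\<lambda>t. \<Sum>l\<in>UNIV. phi l g * minors (shift (mat 1) (srv j) t) $ l $ i)"
    by (rule dcoef_add) (auto intro!: polyfun_sum polyfun_mult)
  also have "dcoef (\<lambda>t. \<Sum>l\<in>UNIV. phi l g * minors (shift (mat 1) (srv j) t) $ l $ i) =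
      (\<Sum>l\<in>UNIV. phi l g * lin (\<lambda>A. minors A $ l $ i) (mat 1) (srv j))"
    by (subst dcoef_sum) (auto simp: dcoef_cmult lin_def intro!: polyfun_mult)
  also have "dcoef (\<lambda>t. phi i (shift (mat 1) (srv j) t)) = lin (phi i) (mat 1) (srv j)"
    by (simp add: lin_def)
  finally show ?thesis by (simp add: lin_minors_one lin_phi_one)
qed

text \<open>The derivation annihilates on \<open>Sp4\<close> both the functions that vanish there
  and the generators \<open>minors g - 1\<close>; the product rule does the rest.\<close>

lemma der_kid: "f \<in> kid \<Longrightarrow> der j f \<in> kid"
proof (induction rule: kid.induct)
  case (vanish f)
  have "der j f g = 0" if "g \<in> carrier Sp4" for g
    using der_cong[of f "\<lambda>_. 0" g j] vanish(2) that by simp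
  then show ?case using vanish by (intro kid.vanish) auto
next
  case (minor h i m)
  have eq: "der j (\<lambda>g. h g * (minors g $ i $ m + mat 1 $ i $ m)) =
      (\<lambda>g. h g * der j (\<lambda>g. minors g $ i $ m) g + der j h g * (minors g $ i $ m + mat 1 $ i $ m))"
    using minor by (simp add: pf minors_in_poly_funs)
  show ?case unfolding eq
    by (intro kid.add kid.minor) (auto intro!: kid.vanish pf minor simp: der_minors)
next
  case (add f h)
  then show ?case using kid.add by (simp add: kid_poly)
qed

lemma euler_kid: "f \<in> kid \<Longrightarrow> euler f \<in> kid"
  using kid.add[OF der_kid[OF der_kid] der_kid[OF der_kid], of f f] by (simp add: euler_commutator kid_poly)

subsection \<open>A normal form modulo the ideal\<close>

text \<open>Closure under congruence makes these the preimages of subalgebras of the coordinate ring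
  of the kernel.\<close>

definition subalg :: "('k mat4 \<Rightarrow> 'k) set \<Rightarrow> bool" where
  "subalg N \<longleftrightarrow> N \<subseteq> poly_funs \<and> (\<forall>c. (\<lambda>_. c) \<in> N) \<and>
    (\<forall>f\<in>N. \<forall>h\<in>N. (\<lambda>g. f g + h g) \<in> N \<and> (\<lambda>g. f g * h g) \<in> N) \<and> (\<forall>f\<in>N. \<forall>h. f \<doteq> h \<longrightarrow> h \<in> N)"

text \<open>Degree at most one in \<open>u\<close> is enough because it is applied when
  \<open>u^2\<close> lies in \<open>N\<close>; the coefficients need not be unique.\<close>

definition adjoin :: "('k mat4 \<Rightarrow> 'k) \<Rightarrow> ('k mat4 \<Rightarrow> 'k) set \<Rightarrow> ('k mat4 \<Rightarrow> 'k) set" where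
  "adjoin u N = {f. \<exists>a\<in>N. \<exists>b\<in>N. f \<doteq> (\<lambda>g. a g + u g * b g)}"

definition constmod :: "('k mat4 \<Rightarrow> 'k) set" where
  "constmod = {f. \<exists>c. f \<doteq> (\<lambda>_. c)}"

lemma subalgD:
  assumes "subalg N"
  shows "f \<in> N \<Longrightarrow> f \<in> poly_funs" "(\<lambda>_. c) \<in> N"
    "f \<in> N \<Longrightarrow> h \<in> N \<Longrightarrow> (\<lambda>g. f g + h g) \<in> N" "f \<in> N \<Longrightarrow> h \<in> N \<Longrightarrow> (\<lambda>g. f g * h g) \<in> N"
    "f \<in> N \<Longrightarrow> f \<doteq> h \<Longrightarrow> h \<in> N"
  using assms by (auto simp: subalg_def)

lemma subalg_constmod: "subalg constmod"
proof -
  have 1: "\<exists>c. (\<lambda>g. f g + h g) \<doteq> (\<lambda>_. c)" if "f \<doteq> (\<lambda>_. c)" "h \<doteq> (\<lambda>_. d)" for f h c d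
    using eqv_add[OF that] by blast
  have 2: "\<exists>c. (\<lambda>g. f g * h g) \<doteq> (\<lambda>_. c)" if "f \<doteq> (\<lambda>_. c)" "h \<doteq> (\<lambda>_. d)" for f h c d
    using eqv_mult[OF that] by blast
  have 3: "\<exists>c. h \<doteq> (\<lambda>_. c)" if "f \<doteq> (\<lambda>_. c)" "f \<doteq> h" for f h c
    using eqv_trans[OF eqv_sym] that by blast
  have 4: "f \<in> poly_funs" if "f \<doteq> (\<lambda>_. c)" for f c using that by (simp add: eqv_def)
  show ?thesis unfolding subalg_def constmod_def mem_Collect_eq
  proof (intro conjI ballI allI impI subsetI)
    fix c show "\<exists>d. (\<lambda>_. c) \<doteq> (\<lambda>_. d)" using eqv_refl[OF pf(1)] by blast
  next
    fix f h assume "f \<in> {f. \<exists>c. f \<doteq> (\<lambda>_. c)}" "h \<in> {f. \<exists>c. f \<doteq> (\<lambda>_. c)}"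
    then obtain c d where "f \<doteq> (\<lambda>_. c)" "h \<doteq> (\<lambda>_. d)" by blast
    then show "\<exists>c. (\<lambda>g. f g + h g) \<doteq> (\<lambda>_. c)" "\<exists>c. (\<lambda>g. f g * h g) \<doteq> (\<lambda>_. c)"
      by (fact 1, fact 2)
  next
    fix f h assume "f \<in> {f. \<exists>c. f \<doteq> (\<lambda>_. c)}" "f \<doteq> h"
    then obtain c where "f \<doteq> (\<lambda>_. c)" by blast
    then show "\<exists>c. h \<doteq> (\<lambda>_. c)" using \<open>f \<doteq> h\<close> by (rule 3)
  next
    fix f assume "f \<in> {f. \<exists>c. f \<doteq> (\<lambda>_. c)}"
    then obtain c where "f \<doteq> (\<lambda>_. c)" by blast
    then show "f \<in> poly_funs" by (rule 4)
  qed
qed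

lemma adjoinI: "subalg N \<Longrightarrow> a \<in> N \<Longrightarrow> b \<in> N \<Longrightarrow> f \<doteq> (\<lambda>g. a g + u g * b g) \<Longrightarrow> f \<in> adjoin u N"
  unfolding adjoin_def by blast

lemma
  assumes N: "subalg N" and u: "u \<in> poly_funs"
  shows adjoin_incl: "f \<in> N \<Longrightarrow> f \<in> adjoin u N" and adjoin_gen: "u \<in> adjoin u N"
proof -
  note s = subalgD[OF N]
  { assume f: "f \<in> N"
    show "f \<in> adjoin u N"
      by (rule adjoinI[OF N f s(2)[of 0]]) (simp add: eqv_refl[OF s(1)[OF f]]) }
  show "u \<in> adjoin u N"
    by (rule adjoinI[OF N s(2)[of 0] s(2)[of 1]]) (simp add: eqv_refl[OF u])
qed

lemma subalg_adjoin:
  assumes N: "subalg N" and u: "u \<in> poly_funs" and uu: "(\<lambda>g. u g * u g) \<in> N"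
  shows "subalg (adjoin u N)"
proof -
  note s = subalgD[OF N]
  have "(\<lambda>g. f g + h g) \<in> adjoin u N \<and> (\<lambda>g. f g * h g) \<in> adjoin u N"
    if fh: "f \<in> adjoin u N" "h \<in> adjoin u N" for f h
  proof -
    obtain a b c d where m: "a \<in> N" "b \<in> N" "c \<in> N" "d \<in> N"
      and f: "f \<doteq> (\<lambda>g. a g + u g * b g)" and h: "h \<doteq> (\<lambda>g. c g + u g * d g)"
      using fh unfolding adjoin_def by blast
    have "(\<lambda>g. f g + h g) \<in> adjoin u N"
      by (rule adjoinI[OF N s(3)[OF m(1,3)] s(3)[OF m(2,4)]])
         (use eqv_add[OF f h] in \<open>simp add: algebra_simps\<close>)
    moreover have "(\<lambda>g. f g * h g) \<in> adjoin u N"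
      by (rule adjoinI[OF N s(3)[OF s(4)[OF m(1,3)] s(4)[OF uu s(4)[OF m(2,4)]]]
            s(3)[OF s(4)[OF m(1,4)] s(4)[OF m(2,3)]]])
         (use eqv_mult[OF f h] in \<open>simp add: algebra_simps\<close>)
    ultimately show ?thesis by blast
  qed
  moreover have "h \<in> adjoin u N" if "f \<in> adjoin u N" "f \<doteq> h" for f h
    using that eqv_trans[OF eqv_sym] unfolding adjoin_def by blast
  moreover have "adjoin u N \<subseteq> poly_funs" by (auto simp: adjoin_def eqv_def)
  moreover have "(\<lambda>_. c) \<in> adjoin u N" for c by (rule adjoin_incl[OF N u s(2)])
  ultimately show ?thesis unfolding subalg_def by blast
qed

definition kills :: "'k mat4 \<Rightarrow> ('k mat4 \<Rightarrow> 'k) set \<Rightarrow> bool" where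
  "kills X N \<longleftrightarrow> (\<forall>f\<in>N. lderiv X f \<in> kid)"

definition stable :: "'k mat4 \<Rightarrow> bool" where
  "stable X \<longleftrightarrow> (\<forall>f\<in>kid. lderiv X f \<in> kid)"

lemma lderiv_eqv:
  assumes "stable X" "f \<doteq> h"
  shows "lderiv X f \<doteq> lderiv X h"
proof -
  have "lderiv X (\<lambda>g. f g + h g) \<in> kid" using assms by (auto simp: stable_def eqv_def)
  then show ?thesis using assms by (simp add: eqv_def)
qed

lemma kills_constmod: "stable X \<Longrightarrow> kills X constmod"
  unfolding kills_def constmod_def using lderiv_eqv[of X _ "\<lambda>_. _"] by (auto simp: eqv_zero_iff)

lemma kills_adjoin:
  assumes "stable X" "subalg N" "u \<in> poly_funs" "kills X N" "lderiv X u \<in> kid"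
  shows "kills X (adjoin u N)"
  unfolding kills_def
proof
  fix f assume "f \<in> adjoin u N"
  then obtain a b where ab: "a \<in> N" "b \<in> N" and f: "f \<doteq> (\<lambda>g. a g + u g * b g)" by (auto simp: adjoin_def)
  then have p: "a \<in> poly_funs" "b \<in> poly_funs" using subalgD[OF assms(2)] by blast+
  have "lderiv X f \<doteq> (\<lambda>g. lderiv X a g + (u g * lderiv X b g + lderiv X u g * b g))"
    using lderiv_eqv[OF assms(1) f] p assms(3) by (simp add: pf)
  moreover have "(\<lambda>g. lderiv X a g + (u g * lderiv X b g + lderiv X u g * b g)) \<in> kid"
    using assms(4,5) ab unfolding kills_def
    by (intro kid.add[OF _ kid.add[OF kid_mult kid_mult']] p assms(3)) auto
  ultimately show "lderiv X f \<in> kid" using kid_eqv by blast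
qed

text \<open>Writing \<open>f = a + u b\<close>, the hypotheses give \<open>X f = X u \<cdot> b\<close> modulo the ideal, and \<open>X u\<close> is a unit.\<close>

lemma adjoin_elim:
  assumes X: "stable X" and N: "subalg N" and u: "u \<in> poly_funs" and k: "kills X N"
    and e: "e \<in> poly_funs" "(\<lambda>g. e g * lderiv X u g) \<doteq> (\<lambda>_. 1)"
    and f: "f \<in> adjoin u N" "lderiv X f \<in> kid"
  shows "f \<in> N"
proof -
  obtain a b where ab: "a \<in> N" "b \<in> N" and feq: "f \<doteq> (\<lambda>g. a g + u g * b g)" using f(1) by (auto simp: adjoin_def)
  then have p: "a \<in> poly_funs" "b \<in> poly_funs" using subalgD[OF N] by blast+
  have "lderiv X f \<doteq> (\<lambda>g. lderiv X a g + (u g * lderiv X b g + lderiv X u g * b g))"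
    using lderiv_eqv[OF X feq] p u by (simp add: pf)
  then have 1: "(\<lambda>g. lderiv X a g + (u g * lderiv X b g + lderiv X u g * b g)) \<in> kid"
    using f(2) eqv_sym kid_eqv by blast
  have 2: "(\<lambda>g. lderiv X a g + u g * lderiv X b g) \<in> kid"
    using k ab unfolding kills_def by (intro kid.add[OF _ kid_mult] u) auto
  have "(\<lambda>g. lderiv X u g * b g) \<in> kid"
    by (rule kid_cong[OF kid.add[OF 1 2]]) (auto intro!: pf p u simp: algebra_simps)
  then have "(\<lambda>g. e g * (lderiv X u g * b g)) \<in> kid" by (rule kid_mult[OF _ e(1)])
  moreover have "b \<doteq> (\<lambda>g. e g * (lderiv X u g * b g))"
    using eqv_mult[OF eqv_sym[OF e(2)] eqv_refl[OF p(2)]] by (simp add: mult.assoc)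
  ultimately have "b \<in> kid" using kid_eqv by blast
  then have "(\<lambda>g. u g * b g) \<doteq> (\<lambda>_. 0)" using kid_mult u by (simp add: eqv_zero_iff)
  then have "(\<lambda>g. a g + u g * b g) \<doteq> (\<lambda>g. a g + 0)" using eqv_add[OF eqv_refl[OF p(1)]] by blast
  then have "a \<doteq> f" using eqv_sym[OF eqv_trans[OF feq]] by simp
  then show ?thesis using subalgD(5)[OF N ab(1)] by blast
qed

end

section \<open>Five generators of the coordinate ring of the kernel\<close>

context special
begin

abbreviation (input) en :: "4 \<Rightarrow> 4 \<Rightarrow> 'k mat4 \<Rightarrow> 'k" where "en i j \<equiv> \<lambda>g. g $ i $ j"

lemma kid_square_diag: "(\<lambda>g. g $ i $ i * g $ i $ i + 1) \<in> kid"
  using kid_square[of i i] by (simp add: eqv_def mat_nth)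

lemma kid_square_off: "i \<noteq> j \<Longrightarrow> (\<lambda>g. g $ i $ j * g $ i $ j) \<in> kid"
  using kid_square[of i j] by (simp add: eqv_def mat_nth)

lemma square_zero:
  assumes "i \<noteq> j" shows "(\<lambda>g. (g $ 1 $ 1 * g $ i $ j) * (g $ 1 $ 1 * g $ i $ j)) \<in> constmod"
proof -
  have "(\<lambda>g. (g $ 1 $ 1 * g $ 1 $ 1) * (g $ i $ j * g $ i $ j)) \<in> kid"
    by (rule kid_mult[OF kid_square_off[OF assms] pf(4)[OF pf(2) pf(2)]])
  then have "(\<lambda>g. (g $ 1 $ 1 * g $ i $ j) * (g $ 1 $ 1 * g $ i $ j)) \<doteq> (\<lambda>_. 0)"
    by (simp add: eqv_zero_iff mult_ac)
  then show ?thesis unfolding constmod_def by blast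
qed

text \<open>The factor \<open>g $ 1 $ 1\<close> makes the first four generators quadratic, so
  \<open>euler\<close> kills them in characteristic 2 and detects only the last one. The order makes
  the elimination in \<open>kid_criterion\<close> triangular.\<close>

definition "N1 = adjoin (\<lambda>g. g $ 1 $ 1 * g $ 1 $ 2) constmod"
definition "N2 = adjoin (\<lambda>g. g $ 1 $ 1 * g $ 1 $ 3) N1"
definition "N3 = adjoin (\<lambda>g. g $ 1 $ 1 * g $ 2 $ 1) N2"
definition "N4 = adjoin (\<lambda>g. g $ 1 $ 1 * g $ 3 $ 1) N3"
definition "N5 = adjoin (\<lambda>g. g $ 1 $ 1) N4"

lemma gen_poly: "(\<lambda>g. g $ 1 $ 1 * g $ i $ j) \<in> poly_funs" by (intro pf)

lemma subalg_N: "subalg N1" "subalg N2" "subalg N3" "subalg N4" "subalg N5"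
proof -
  show 1: "subalg N1" unfolding N1_def by (intro subalg_adjoin subalg_constmod gen_poly square_zero) simp
  have i1: "f \<in> N1" if "f \<in> constmod" for f unfolding N1_def using adjoin_incl[OF subalg_constmod gen_poly that] .
  show 2: "subalg N2" unfolding N2_def by (intro subalg_adjoin 1 gen_poly i1 square_zero) simp
  have i2: "f \<in> N2" if "f \<in> constmod" for f unfolding N2_def using adjoin_incl[OF 1 gen_poly i1[OF that]] .
  show 3: "subalg N3" unfolding N3_def by (intro subalg_adjoin 2 gen_poly i2 square_zero) simp
  have i3: "f \<in> N3" if "f \<in> constmod" for f unfolding N3_def using adjoin_incl[OF 2 gen_poly i2[OF that]] .
  show 4: "subalg N4" unfolding N4_def by (intro subalg_adjoin 3 gen_poly i3 square_zero) simp
  have "(\<lambda>g. g $ 1 $ 1 * g $ 1 $ 1) \<in> N4"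
    using subalgD(5)[OF 4 subalgD(2)[OF 4, of 1] eqv_sym] kid_square_diag[of 1] by (auto simp: eqv_def intro!: pf)
  then show "subalg N5" unfolding N5_def by (intro subalg_adjoin 4 pf)
qed

lemma N5_gens:
  "en 1 1 \<in> N5" "(\<lambda>g. g $ 1 $ 1 * g $ 1 $ 2) \<in> N5" "(\<lambda>g. g $ 1 $ 1 * g $ 1 $ 3) \<in> N5"
  "(\<lambda>g. g $ 1 $ 1 * g $ 2 $ 1) \<in> N5" "(\<lambda>g. g $ 1 $ 1 * g $ 3 $ 1) \<in> N5"
proof -
  have i5: "f \<in> N5" if "f \<in> N4" for f unfolding N5_def using adjoin_incl[OF subalg_N(4) pf(2) that] .
  have i4: "f \<in> N4" if "f \<in> N3" for f unfolding N4_def using adjoin_incl[OF subalg_N(3) gen_poly that] .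
  have i3: "f \<in> N3" if "f \<in> N2" for f unfolding N3_def using adjoin_incl[OF subalg_N(2) gen_poly that] .
  have i2: "f \<in> N2" if "f \<in> N1" for f unfolding N2_def using adjoin_incl[OF subalg_N(1) gen_poly that] .
  show "en 1 1 \<in> N5" unfolding N5_def by (rule adjoin_gen[OF subalg_N(4) pf(2)])
  show "(\<lambda>g. g $ 1 $ 1 * g $ 3 $ 1) \<in> N5" by (rule i5) (unfold N4_def, rule adjoin_gen[OF subalg_N(3) gen_poly])
  show "(\<lambda>g. g $ 1 $ 1 * g $ 2 $ 1) \<in> N5" by (rule i5, rule i4) (unfold N3_def, rule adjoin_gen[OF subalg_N(2) gen_poly])
  show "(\<lambda>g. g $ 1 $ 1 * g $ 1 $ 3) \<in> N5" by (rule i5, rule i4, rule i3) (unfold N2_def, rule adjoin_gen[OF subalg_N(1) gen_poly])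
  show "(\<lambda>g. g $ 1 $ 1 * g $ 1 $ 2) \<in> N5" by (rule i5, rule i4, rule i3, rule i2) (unfold N1_def, rule adjoin_gen[OF subalg_constmod gen_poly])
qed

lemma N5_mem:
  assumes "h \<in> N5" "f \<in> poly_funs" "r \<in> kid" "\<And>g. g \<in> carrier Sp4 \<Longrightarrow> f g + h g = r g"
  shows "f \<in> N5"
  using subalgD(5)[OF subalg_N(5) assms(1) eqv_sym[OF eqvI[OF assms(2) _ assms(3,4)]]] subalgD(1)[OF subalg_N(5) assms(1)] by blast

lemmas N5_closed = subalgD(3,4)[OF subalg_N(5)] subalgD(2)[OF subalg_N(5)]

text \<open>The entry 11 is its own inverse modulo the ideal, so it can be cancelled.\<close>

lemma N5_cancel:
  assumes "h \<in> N5" "f \<in> poly_funs" "r \<in> kid" "\<And>g. g \<in> carrier Sp4 \<Longrightarrow> g $ 1 $ 1 * f g + h g = r g"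
  shows "f \<in> N5"
proof -
  have 1: "(\<lambda>g. f g * (g $ 1 $ 1 * g $ 1 $ 1 + 1) + g $ 1 $ 1 * r g) \<in> kid"
    by (rule kid.add[OF kid_mult[OF kid_square_diag assms(2)] kid_mult[OF assms(3) pf(2)]])
  have 2: "(\<lambda>g. g $ 1 $ 1 * h g) \<in> N5" by (rule N5_closed(2)[OF N5_gens(1) assms(1)])
  show ?thesis
    by (rule N5_mem[OF 2 assms(2) 1]) (simp add: assms(4)[symmetric] algebra_simps)
qed

lemma rel_minors: "(\<lambda>g. minor (pfst i) (psnd i) (pfst j) (psnd j) g + mat 1 $ i $ j) \<in> kid"
  using kid_minors[of i j] by (simp add: minors_nth)

lemma row12:
  assumes that: "g \<in> carrier (Sp4 :: 'k mat4 monoid)"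
  shows "g $ 1 $ 1 * g $ 2 $ 4 + g $ 1 $ 4 * g $ 2 $ 1 + g $ 1 $ 2 * g $ 2 $ 3 + g $ 1 $ 3 * g $ 2 $ 2 = 0"
  using Sp4_rows[OF that, of 1 2] by (simp add: minor_def minus_eq add.assoc del: add_eq_0)

text \<open>Modulo the ideal the minor of rows 12 and columns 12 is 1, that of columns 24 is 0, and
  the square of entry 12 is 0. Adding suitable multiples of these relations leaves entry 12 times
  the expression that \<open>row12\<close> turns into the product of entries 13 and 22.\<close>

lemma entry14_kid: "(\<lambda>g. g $ 1 $ 4 + g $ 1 $ 2 * g $ 1 $ 3 * g $ 2 $ 2) \<in> kid"
proof -
  have r1: "(\<lambda>g. g $ 1 $ 4 * (minor 1 2 1 2 g + 1) + (g $ 1 $ 1 * minor 1 2 2 4 g + g $ 2 $ 3 * (g $ 1 $ 2 * g $ 1 $ 2))) \<in> kid"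
    using rel_minors[of 1 1] rel_minors[of 1 3] kid_square_off[of 1 2]
    by (intro kid.add[OF kid_mult[OF _ pf(2)] kid.add[OF kid_mult[OF _ pf(2)] kid_mult[OF _ pf(2)]]]) (simp_all add: mat_nth)
  have eq1: "g $ 1 $ 4 + g $ 1 $ 2 * g $ 1 $ 3 * g $ 2 $ 2 = 
      g $ 1 $ 4 * (minor 1 2 1 2 g + 1) + (g $ 1 $ 1 * minor 1 2 2 4 g + g $ 2 $ 3 * (g $ 1 $ 2 * g $ 1 $ 2))"
    if "g \<in> carrier Sp4" for g :: "'k mat4"
  proof -
    have "g $ 1 $ 3 * g $ 2 $ 2 = g $ 1 $ 1 * g $ 2 $ 4 + g $ 1 $ 4 * g $ 2 $ 1 + g $ 1 $ 2 * g $ 2 $ 3"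
      using row12[OF that] by (simp add: algebra_simps)
    then show ?thesis by (simp add: minor_def minus_eq mult.assoc algebra_simps)
  qed
  show ?thesis by (rule kid_cong[OF r1 _ eq1]) (intro pf)
qed

text \<open>Cancelling entry 11 gives the rest of the first row and column except the corners. The
  minors give the middle block, the cubic congruences give entries 14 and 41, and the symplectic
  relations give the others.\<close>

lemma entries_N5: "en i j \<in> N5"
proof -
  have e1: "en 1 2 \<in> N5" "en 1 3 \<in> N5" "en 2 1 \<in> N5" "en 3 1 \<in> N5"
    by (rule N5_cancel[OF N5_gens(2) pf(2) kid_zero], simp)
       (rule N5_cancel[OF N5_gens(3) pf(2) kid_zero], simp,
        rule N5_cancel[OF N5_gens(4) pf(2) kid_zero], simp,
        rule N5_cancel[OF N5_gens(5) pf(2) kid_zero], simp)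
  note cl = N5_closed N5_gens(1) e1
  have "(\<lambda>g. g $ 1 $ 2 * g $ 2 $ 1 + 1) \<in> N5" "(\<lambda>g. g $ 1 $ 3 * g $ 2 $ 1) \<in> N5"
    "(\<lambda>g. g $ 1 $ 2 * g $ 3 $ 1) \<in> N5" "(\<lambda>g. g $ 1 $ 3 * g $ 3 $ 1 + 1) \<in> N5"
    by (intro cl)+
  note N5_cancel[OF this(1) pf(2) rel_minors[of 1 1]] N5_cancel[OF this(2) pf(2) rel_minors[of 1 2]]
    N5_cancel[OF this(3) pf(2) rel_minors[of 2 1]] N5_cancel[OF this(4) pf(2) rel_minors[of 2 2]]
  then have e2: "en 2 2 \<in> N5" "en 2 3 \<in> N5" "en 3 2 \<in> N5" "en 3 3 \<in> N5"
    by (simp_all add: minor_def minus_eq mat_nth add.assoc)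
  note cl = cl e2
  have col12: "g $ 1 $ 1 * g $ 4 $ 2 + g $ 1 $ 2 * g $ 4 $ 1 + g $ 2 $ 1 * g $ 3 $ 2 + g $ 2 $ 2 * g $ 3 $ 1 = 0"
    if "g \<in> carrier Sp4" for g :: "'k mat4"
    using Sp4_columns[OF that, of 1 2] by (simp add: minor_def minus_eq add.assoc del: add_eq_0)
  have row13: "g $ 1 $ 1 * g $ 3 $ 4 + g $ 1 $ 4 * g $ 3 $ 1 + g $ 1 $ 2 * g $ 3 $ 3 + g $ 1 $ 3 * g $ 3 $ 2 = 0"
    if "g \<in> carrier Sp4" for g :: "'k mat4"
    using Sp4_rows[OF that, of 1 3] by (simp add: minor_def minus_eq add.assoc del: add_eq_0)
  have col13: "g $ 1 $ 1 * g $ 4 $ 3 + g $ 1 $ 3 * g $ 4 $ 1 + g $ 2 $ 1 * g $ 3 $ 3 + g $ 2 $ 3 * g $ 3 $ 1 = 0"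
    if "g \<in> carrier Sp4" for g :: "'k mat4"
    using Sp4_columns[OF that, of 1 3] by (simp add: minor_def minus_eq add.assoc del: add_eq_0)
  have row14: "g $ 1 $ 1 * g $ 4 $ 4 + g $ 1 $ 4 * g $ 4 $ 1 + g $ 1 $ 2 * g $ 4 $ 3 + g $ 1 $ 3 * g $ 4 $ 2 = 1"
    if "g \<in> carrier Sp4" for g :: "'k mat4"
    using Sp4_rows[OF that, of 1 4] by (simp add: minor_def minus_eq add.assoc del: add_eq_0)
  have "(\<lambda>g. g $ 1 $ 2 * g $ 1 $ 3 * g $ 2 $ 2) \<in> N5" by (intro cl)
  from N5_mem[OF this pf(2) entry14_kid refl] have e14: "en 1 4 \<in> N5" .
  \<comment> \<open>The transpose of the congruence for entry 14, with \<open>col12\<close> in place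
    of \<open>row12\<close>.\<close>
  have r2: "(\<lambda>g. g $ 4 $ 1 * (minor 1 2 1 2 g + 1) + (g $ 1 $ 1 * minor 2 4 1 2 g + g $ 3 $ 2 * (g $ 2 $ 1 * g $ 2 $ 1))) \<in> kid"
    using rel_minors[of 1 1] rel_minors[of 3 1] kid_square_off[of 2 1]
    by (intro kid.add[OF kid_mult[OF _ pf(2)] kid.add[OF kid_mult[OF _ pf(2)] kid_mult[OF _ pf(2)]]]) (simp_all add: mat_nth)
  have eq2: "g $ 4 $ 1 + g $ 2 $ 1 * g $ 3 $ 1 * g $ 2 $ 2 = 
      g $ 4 $ 1 * (minor 1 2 1 2 g + 1) + (g $ 1 $ 1 * minor 2 4 1 2 g + g $ 3 $ 2 * (g $ 2 $ 1 * g $ 2 $ 1))"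
    if "g \<in> carrier Sp4" for g :: "'k mat4"
  proof -
    have "g $ 3 $ 1 * g $ 2 $ 2 = g $ 1 $ 1 * g $ 4 $ 2 + g $ 4 $ 1 * g $ 1 $ 2 + g $ 2 $ 1 * g $ 3 $ 2"
      using col12[OF that] by (simp add: algebra_simps)
    then show ?thesis by (simp add: minor_def minus_eq mult.assoc algebra_simps)
  qed
  have "(\<lambda>g. g $ 2 $ 1 * g $ 3 $ 1 * g $ 2 $ 2) \<in> N5" by (intro cl)
  from N5_mem[OF this pf(2) r2 eq2] have e41: "en 4 1 \<in> N5" .
  note cl = cl e14 e41
  have "(\<lambda>g. g $ 1 $ 4 * g $ 2 $ 1 + g $ 1 $ 2 * g $ 2 $ 3 + g $ 1 $ 3 * g $ 2 $ 2) \<in> N5"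
     "(\<lambda>g. g $ 1 $ 2 * g $ 4 $ 1 + g $ 2 $ 1 * g $ 3 $ 2 + g $ 2 $ 2 * g $ 3 $ 1) \<in> N5"
     "(\<lambda>g. g $ 1 $ 4 * g $ 3 $ 1 + g $ 1 $ 2 * g $ 3 $ 3 + g $ 1 $ 3 * g $ 3 $ 2) \<in> N5"
     "(\<lambda>g. g $ 1 $ 3 * g $ 4 $ 1 + g $ 2 $ 1 * g $ 3 $ 3 + g $ 2 $ 3 * g $ 3 $ 1) \<in> N5"
    by (intro cl)+
  note N5_cancel[OF this(1) pf(2) kid_zero, of 2 4] N5_cancel[OF this(2) pf(2) kid_zero, of 4 2]
    N5_cancel[OF this(3) pf(2) kid_zero, of 3 4] N5_cancel[OF this(4) pf(2) kid_zero, of 4 3]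
  then have e3: "en 2 4 \<in> N5" "en 4 2 \<in> N5" "en 3 4 \<in> N5" "en 4 3 \<in> N5"
    using row12 col12 row13 col13 by (simp_all add: add.assoc del: add_eq_0)
  note cl = cl e3
  have "(\<lambda>g. g $ 1 $ 4 * g $ 4 $ 1 + g $ 1 $ 2 * g $ 4 $ 3 + g $ 1 $ 3 * g $ 4 $ 2 + 1) \<in> N5"
    by (intro cl)
  then have "en 4 4 \<in> N5"
    by (rule N5_cancel[OF _ pf(2) kid_zero]) (use row14 in \<open>simp add: add.assoc[symmetric] del: add_eq_0\<close>)
  then show ?thesis using exhaust_4[of i] exhaust_4[of j] cl by (elim disjE) simp_all
qed

lemma poly_funs_N5: "f \<in> poly_funs \<Longrightarrow> f \<in> N5"
  by (induction rule: poly_funs.induct) (auto intro: N5_closed entries_N5)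

lemma stable_der: "stable (srv j)" and stable_euler: "stable (mat 1)"
  by (auto simp: stable_def der_kid euler_kid)

text \<open>The generators are removed in reverse order of adjunction, by \<open>euler\<close> and
  then by \<open>der 1\<close>, \<open>der 2\<close>, \<open>der 4\<close>, \<open>der 3\<close>.
  Each sends its generator to a unit modulo the ideal and kills those adjoined before it. What
  remains is a constant, fixed by the value at the identity.\<close>

theorem kid_criterion:
  assumes f: "f \<in> poly_funs" and d: "\<And>j. der j f \<in> kid" and f1: "f (mat 1) = 0"
  shows "f \<in> kid"
proof -
  have pr: "(\<lambda>g. g $ a $ b * g $ c $ d) \<in> poly_funs" for a b c d by (intro pf)
  have e: "euler f \<in> kid"
    unfolding euler_commutator[OF f] using d der_kid by (intro kid.add) auto
  have one: "(\<lambda>_. 1) \<in> poly_funs" by (rule pf)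
  have sq0: "(\<lambda>g. g $ 1 $ 2 * g $ 1 $ 2) \<in> kid" "(\<lambda>g. g $ 1 $ 3 * g $ 1 $ 3) \<in> kid"
    by (simp_all add: kid_square_off)
  \<comment> \<open>This is the derivative of the first generator under \<open>der 1\<close> and of
    the second under \<open>der 2\<close>; its vanishing gives the triangular shape.\<close>
  have r: "(\<lambda>g. g $ 1 $ 1 * g $ 1 $ 4 + g $ 1 $ 3 * g $ 1 $ 2) \<in> kid"
  proof -
    have "(\<lambda>g. g $ 1 $ 1 * (g $ 1 $ 4 + g $ 1 $ 2 * g $ 1 $ 3 * g $ 2 $ 2) +
        ((g $ 1 $ 2 * g $ 1 $ 3) * (minor 1 2 1 2 g + 1) + (g $ 1 $ 3 * g $ 2 $ 1) * (g $ 1 $ 2 * g $ 1 $ 2))) \<in> kid"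
      using entry14_kid rel_minors[of 1 1] sq0
      by (intro kid.add[OF kid_mult[OF _ pf(2)] kid.add[OF kid_mult[OF _ pr] kid_mult[OF _ pr]]]) (simp_all add: mat_nth)
    then show ?thesis by (rule kid_cong) (auto intro!: pf simp: minor_def minus_eq algebra_simps)
  qed
  have r': "(\<lambda>g. g $ 1 $ 1 * g $ 1 $ 4 + g $ 1 $ 2 * g $ 1 $ 3) \<in> kid" using r by (simp add: mult.commute)
  have m11: "(\<lambda>g. (g $ 1 $ 1 * g $ 2 $ 2 + g $ 1 $ 2 * g $ 2 $ 1) + 1) \<in> kid"
    using rel_minors[of 1 1] by (simp add: minor_def minus_eq mat_nth)
  have m12: "(\<lambda>g. g $ 1 $ 1 * g $ 2 $ 3 + g $ 1 $ 3 * g $ 2 $ 1) \<in> kid"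
    using rel_minors[of 1 2] by (simp add: minor_def minus_eq mat_nth)
  have m21: "(\<lambda>g. g $ 1 $ 1 * g $ 3 $ 2 + g $ 1 $ 2 * g $ 3 $ 1) \<in> kid"
    using rel_minors[of 2 1] by (simp add: minor_def minus_eq mat_nth)
  have m22: "(\<lambda>g. (g $ 1 $ 1 * g $ 3 $ 3 + g $ 1 $ 3 * g $ 3 $ 1) + 1) \<in> kid"
    using rel_minors[of 2 2] by (simp add: minor_def minus_eq mat_nth)
  have sq1: "(\<lambda>g. g $ 1 $ 1 * g $ 1 $ 1 + 1) \<in> kid" by (rule kid_square_diag)
  note sm = mult4 srv_simps mat_nth kid_zero pf pr sq0 r r' m11 m12 m21 m22 sq1 eqv_def
  let ?x = "\<lambda>g::'k mat4. g $ 1 $ 1 * g $ 1 $ 2" and ?y = "\<lambda>g::'k mat4. g $ 1 $ 1 * g $ 1 $ 3"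
    and ?z = "\<lambda>g::'k mat4. g $ 1 $ 1 * g $ 2 $ 1" and ?w = "\<lambda>g::'k mat4. g $ 1 $ 1 * g $ 3 $ 1"
  have "f \<in> adjoin (en 1 1) N4" using poly_funs_N5[OF f] by (simp add: N5_def)
  moreover have "kills (mat 1) N4"
    unfolding N1_def N2_def N3_def N4_def
    by (intro kills_adjoin kills_constmod stable_euler gen_poly subalg_constmod subalg_N[unfolded N1_def N2_def N3_def N4_def];
        simp add: sm)
  ultimately have f4: "f \<in> adjoin ?w N3" unfolding N4_def[symmetric]
    by (intro adjoin_elim[OF stable_euler subalg_N(4) pf(2) _ pf(2)[of 1 1] _ _ e]) (simp_all add: sm)
  have "kills (srv 1) N3"
    unfolding N1_def N2_def N3_def
    by (intro kills_adjoin kills_constmod stable_der gen_poly subalg_constmod subalg_N[unfolded N1_def N2_def N3_def N4_def];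
        simp add: sm)
  with f4 have f3: "f \<in> adjoin ?z N2" unfolding N3_def[symmetric]
    by (intro adjoin_elim[OF stable_der[of 1] subalg_N(3) gen_poly _ one _ _ d]) (simp_all add: sm)
  have "kills (srv 2) N2"
    unfolding N1_def N2_def
    by (intro kills_adjoin kills_constmod stable_der gen_poly subalg_constmod subalg_N[unfolded N1_def N2_def N3_def N4_def];
        simp add: sm)
  with f3 have f2: "f \<in> adjoin ?y N1" unfolding N2_def[symmetric]
    by (intro adjoin_elim[OF stable_der[of 2] subalg_N(2) gen_poly _ one _ _ d]) (simp_all add: sm)
  have "kills (srv 4) N1"
    unfolding N1_def
    by (intro kills_adjoin kills_constmod stable_der gen_poly subalg_constmod; simp add: sm)
  with f2 have f1': "f \<in> adjoin ?x constmod" unfolding N1_def[symmetric]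
    by (intro adjoin_elim[OF stable_der[of 4] subalg_N(1) gen_poly _ one _ _ d]) (simp_all add: sm)
  then have "f \<in> constmod"
    by (intro adjoin_elim[OF stable_der[of 3] subalg_constmod gen_poly _ one _ _ d] kills_constmod stable_der) (simp_all add: sm)
  then obtain c where c: "f \<doteq> (\<lambda>_. c)" by (auto simp: constmod_def)
  then have "f (mat 1) + c = 0" unfolding eqv_def using kid_one by blast
  then show ?thesis using c f1 by (simp add: eqv_zero_iff)
qed

end

section \<open>Cocycles modulo the ideal\<close>

context char2
begin

abbreviation tang :: "4 \<Rightarrow> ('k mat4 \<Rightarrow> 'k) \<Rightarrow> 'k" where
  "tang j f \<equiv> lin f (mat 1) (srv j)"

lemma tang_kid: "f \<in> kid \<Longrightarrow> tang j f = 0"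
  using kid_one[OF der_kid, of f j] by (simp add: lderiv_def)

lemma tang_cong: "(\<And>g. g \<in> carrier Sp4 \<Longrightarrow> f g = h g) \<Longrightarrow> tang j f = tang j h"
  by (simp add: lin_def srv_curve)

lemma kid_tensor:
  assumes "\<And>i. i < n \<Longrightarrow> a i \<in> poly_funs" "\<And>i. i < n \<Longrightarrow> a i \<in> kid \<or> c i = 0"
  shows "(\<lambda>g. \<Sum>i<n. a i g * c i) \<in> kid"
proof (rule kid_sum)
  fix i assume "i \<in> {..<n}"
  then show "(\<lambda>g. a i g * c i) \<in> kid"
    using assms(2)[of i] kid_mult'[OF _ pf(1), of "a i" "c i"] by (auto simp: kid_zero)
qed

text \<open>The right-hand side is an element of the ideal of the product of two kernels, evaluated
  at a point of the coefficient module. Differentiating in \<open>h\<close> at the identity kills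
  the terms with \<open>b i\<close> in \<open>kid\<close> and leaves coefficients in
  \<open>kid\<close> in the others.\<close>

theorem primitive_mod_kid:
  fixes a b :: "nat \<Rightarrow> 'k mat4 \<Rightarrow> 'k"
  assumes f: "f \<in> poly_funs"
    and ab: "\<And>i. i < n \<Longrightarrow> a i \<in> poly_funs" "\<And>i. i < n \<Longrightarrow> b i \<in> poly_funs" "\<And>i. i < n \<Longrightarrow> a i \<in> kid \<or> b i \<in> kid"
    and eq: "\<And>g h. g \<in> carrier Sp4 \<Longrightarrow> h \<in> carrier Sp4 \<Longrightarrow> f h + f (g ** h) + f g = (\<Sum>i<n. a i g * b i h * m i)"
  shows der_primitive: "(\<lambda>g. der j f g + tang j f) \<in> kid" and primitive_one: "f (mat 1) = 0"
proof -
  show "f (mat 1) = 0"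
  proof -
    have "a i (mat 1) * b i (mat 1) = 0" if "i < n" for i using ab(3)[OF that] kid_one by auto
    then have "(\<Sum>i<n. a i (mat 1) * b i (mat 1) * m i) = 0" by (intro sum.neutral) simp
    then show ?thesis using eq[of "mat 1" "mat 1"] by simp
  qed
  have *: "tang j f + der j f g = (\<Sum>i<n. a i g * (tang j (b i) * m i))" if g: "g \<in> carrier Sp4" for g
  proof -
    let ?h = "\<lambda>t. shift (mat 1) (srv j) t"
    have "dcoef (\<lambda>t. f (?h t) + f (shift g (g ** srv j) t) + f g) = dcoef (\<lambda>t. \<Sum>i<n. (a i g * m i) * b i (?h t))"
      using eq[OF g srv_curve[of j]] by (simp add: shift_mult_left mult_ac)
    also have "\<dots> = (\<Sum>i<n. (a i g * m i) * tang j (b i))"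
      unfolding lin_def by (subst dcoef_sum) (auto intro!: sum.cong dcoef_cmult polyfun_mult ab)
    also have "dcoef (\<lambda>t. f (?h t) + f (shift g (g ** srv j) t) + f g) = tang j f + der j f g"
      by (subst dcoef_add) (auto simp: f lin_def lderiv_def dcoef_add intro!: polyfun_add)
    finally show ?thesis by (simp add: mult_ac)
  qed
  have "(\<lambda>g. \<Sum>i<n. a i g * (tang j (b i) * m i)) \<in> kid"
    using ab tang_kid by (intro kid_tensor) fastforce+
  then show "(\<lambda>g. der j f g + tang j f) \<in> kid"
    by (rule kid_cong) (auto simp: *[symmetric] f add.commute intro!: pf)
qed

text \<open>Expand by \<open>phi_mult\<close> twice. The terms free of \<open>phi l g\<close> reduce
  modulo the ideal to the expansion of \<open>phi j (x ** y)\<close>, which is zero.\<close>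

lemma phi_conj:
  assumes y: "x \<in> carrier Sp4" "y \<in> carrier Sp4" "x ** y = mat 1"
  shows "(\<lambda>g. phi j (x ** g ** y)) \<doteq> (\<lambda>g. \<Sum>l\<in>UNIV. minors y $ l $ j * phi l g)"
proof -
  define R where "R g = (\<Sum>l\<in>UNIV. \<Sum>m\<in>UNIV. (phi m x * minors y $ l $ j) * (minors g $ m $ l + mat 1 $ m $ l))" for g
  have R: "R \<in> kid" unfolding R_def[abs_def] by (intro kid_sum kid_cmult kid_minors)
  have "(\<Sum>l\<in>UNIV. \<Sum>m\<in>UNIV. (phi m x * minors y $ l $ j) * mat 1 $ m $ l) = (\<Sum>l\<in>UNIV. phi l x * minors y $ l $ j)"
    by (simp add: sum_4 mat_nth)
  also have "\<dots> = phi j y" using phi_mult[OF y(1,2), of j] by (simp add: y(3))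
  finally have one: "(\<Sum>l\<in>UNIV. \<Sum>m\<in>UNIV. (phi m x * minors y $ l $ j) * mat 1 $ m $ l) = phi j y" .
  show ?thesis
  proof (rule eqvI[OF _ _ R])
    fix g assume g: "g \<in> carrier (Sp4 :: 'k mat4 monoid)"
    have "phi j (x ** g ** y) = phi j y + (\<Sum>l\<in>UNIV. (phi l g + (\<Sum>m\<in>UNIV. phi m x * minors g $ m $ l)) * minors y $ l $ j)"
      using y g by (simp add: phi_mult)
    then have "phi j (x ** g ** y) + (\<Sum>l\<in>UNIV. minors y $ l $ j * phi l g)
        = phi j y + (\<Sum>l\<in>UNIV. \<Sum>m\<in>UNIV. (phi m x * minors y $ l $ j) * minors g $ m $ l)"
      by (simp add: sum_4 algebra_simps)
    also have "\<dots> = R g" unfolding R_def one[symmetric] by (simp add: distrib_left sum.distrib add.commute)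
    finally show "phi j (x ** g ** y) + (\<Sum>l\<in>UNIV. minors y $ l $ j * phi l g) = R g" .
  qed (auto intro!: poly_funs_sum pf conj_poly)
qed

text \<open>The identity matrix is central, so the left invariant derivation is also right
  invariant.\<close>

lemma euler_right_mult: "euler (\<lambda>A. f (A ** C)) A = euler f (A ** C)"
  by (simp add: lderiv_def lin_mult_right)

lemma euler_sum:
  assumes "\<And>k. k \<in> I \<Longrightarrow> f k \<in> poly_funs"
  shows "euler (\<lambda>g. \<Sum>k\<in>I. c k * f k g) A = (\<Sum>k\<in>I. c k * euler (f k) A)"
  using assms by (subst lderiv_sum) (auto simp: pf intro!: sum.cong)

lemma left_mult_poly: "f \<in> poly_funs \<Longrightarrow> (\<lambda>h. f (g ** h)) \<in> poly_funs"
  and right_mult_poly: "f \<in> poly_funs \<Longrightarrow> (\<lambda>h. f (h ** g)) \<in> poly_funs"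
  using poly_funs_compose[of f "\<lambda>h. g ** h"] poly_funs_compose[of f "\<lambda>h. h ** g"]
  by (auto simp: poly_funs_matrix_mult_left poly_funs_matrix_mult_right)

lemma natural_cocycle_mod_kid:
  fixes a b :: "nat \<Rightarrow> 'k mat4 \<Rightarrow> 'k" and f :: "4 \<Rightarrow> 'k mat4 \<Rightarrow> 'k"
  assumes f: "\<And>i. f i \<in> poly_funs"
    and ab: "\<And>i. i < n \<Longrightarrow> a i \<in> poly_funs" "\<And>i. i < n \<Longrightarrow> b i \<in> poly_funs" "\<And>i. i < n \<Longrightarrow> a i \<in> kid \<or> b i \<in> kid"
    and eq: "\<And>i g h. g \<in> carrier Sp4 \<Longrightarrow> h \<in> carrier Sp4 \<Longrightarrow>
      (\<Sum>l\<in>UNIV. g $ i $ l * f l h) + f i (g ** h) + f i g = (\<Sum>k<n. a k g * b k h * m k i)"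
  shows "\<exists>v. \<forall>i. (\<lambda>g. f i g + ((\<Sum>l\<in>UNIV. g $ i $ l * v $ l) + v $ i)) \<in> kid"
proof -
  \<comment> \<open>Modulo the ideal, differentiating in \<open>h\<close> will give
    \<open>g v + E f(g) = 0\<close> and differentiating in \<open>g\<close> will give
    \<open>f(h) + E f(h) + v = 0\<close>, where \<open>E\<close> is \<open>euler\<close>.\<close>
  define v :: "'k ^ 4" where "v = (\<chi> i. euler (f i) (mat 1))"
  have euler0: "euler u (mat 1) = 0" if "u \<in> kid" for u using kid_one[OF euler_kid[OF that]] .
  have 1: "(\<Sum>l\<in>UNIV. g $ i $ l * v $ l) + euler (f i) g = (\<Sum>k<n. a k g * (euler (b k) (mat 1) * m k i))"
    if g: "g \<in> carrier Sp4" for g i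
  proof -
    have "euler (\<lambda>h. (\<Sum>l\<in>UNIV. g $ i $ l * f l h) + f i (g ** h) + f i g) (mat 1) =
        euler (\<lambda>h. \<Sum>k<n. (a k g * m k i) * b k h) (mat 1)"
      using eq[OF g] by (intro euler_cong) (auto intro!: pf poly_funs_sum f left_mult_poly ab simp: mult_ac)
    also have "\<dots> = (\<Sum>k<n. (a k g * m k i) * euler (b k) (mat 1))"
      by (rule euler_sum) (simp add: ab)
    also have "euler (\<lambda>h. (\<Sum>l\<in>UNIV. g $ i $ l * f l h) + f i (g ** h) + f i g) (mat 1) =
        (\<Sum>l\<in>UNIV. g $ i $ l * v $ l) + euler (f i) g"
      by (simp add: pf poly_funs_sum left_mult_poly f euler_sum lderiv_left_mult v_def)
    finally show ?thesis by (simp add: mult_ac)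
  qed
  have 2: "f i h + euler (f i) h + v $ i = (\<Sum>k<n. b k h * (euler (a k) (mat 1) * m k i))"
    if h: "h \<in> carrier Sp4" for h i
  proof -
    have "euler (\<lambda>g. (\<Sum>l\<in>UNIV. f l h * g $ i $ l) + f i (g ** h) + f i g) (mat 1) =
        euler (\<lambda>g. \<Sum>k<n. (b k h * m k i) * a k g) (mat 1)"
      using eq[OF _ h] by (intro euler_cong) (auto intro!: pf poly_funs_sum f right_mult_poly ab simp: mult_ac)
    also have "\<dots> = (\<Sum>k<n. (b k h * m k i) * euler (a k) (mat 1))"
      by (rule euler_sum) (simp add: ab)
    also have "euler (\<lambda>g. (\<Sum>l\<in>UNIV. f l h * g $ i $ l) + f i (g ** h) + f i g) (mat 1) =
        (\<Sum>l\<in>UNIV. f l h * mat 1 $ i $ l) + euler (f i) h + v $ i"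
      by (simp add: pf poly_funs_sum right_mult_poly f euler_sum euler_right_mult v_def)
    also have "(\<Sum>l\<in>UNIV. f l h * mat 1 $ i $ l) = f i h"
      using exhaust_4[of i] by (elim disjE) (simp_all add: sum_4 mat_nth)
    finally show ?thesis by (simp add: mult_ac)
  qed
  have "(\<lambda>g. f i g + ((\<Sum>l\<in>UNIV. g $ i $ l * v $ l) + v $ i)) \<in> kid" for i
  proof -
    \<comment> \<open>The sum of the two congruences: the Euler derivatives of \<open>f\<close>
      cancel and the coboundary of \<open>v\<close> remains.\<close>
    have "(\<lambda>g. (\<Sum>k<n. a k g * (euler (b k) (mat 1) * m k i)) + (\<Sum>k<n. b k g * (euler (a k) (mat 1) * m k i))) \<in> kid"
      using ab euler0 by (intro kid.add[OF kid_tensor kid_tensor]) fastforce+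
    then show ?thesis
    proof (rule kid_cong)
      fix g assume "g \<in> carrier (Sp4 :: 'k mat4 monoid)"
      from 1[OF this, of i, symmetric] 2[OF this, of i, symmetric]
      show "f i g + ((\<Sum>l\<in>UNIV. g $ i $ l * v $ l) + v $ i) = (\<Sum>k<n. a k g * (euler (b k) (mat 1) * m k i)) + (\<Sum>k<n. b k g * (euler (a k) (mat 1) * m k i))"
        by (simp add: add_ac)
    qed (intro pf poly_funs_sum f)
  qed
  then show ?thesis by blast
qed

end

context special
begin

text \<open>Adding the combination of the \<open>phi j\<close> with the same derivatives at the
  identity yields a function to which \<open>kid_criterion\<close> applies.\<close>

theorem primitive_eqv_phi:
  fixes a b :: "nat \<Rightarrow> 'k mat4 \<Rightarrow> 'k"
  assumes f: "f \<in> poly_funs"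
    and ab: "\<And>i. i < n \<Longrightarrow> a i \<in> poly_funs" "\<And>i. i < n \<Longrightarrow> b i \<in> poly_funs" "\<And>i. i < n \<Longrightarrow> a i \<in> kid \<or> b i \<in> kid"
    and eq: "\<And>g h. g \<in> carrier Sp4 \<Longrightarrow> h \<in> carrier Sp4 \<Longrightarrow> f h + f (g ** h) + f g = (\<Sum>i<n. a i g * b i h * m i)"
  shows "(\<lambda>g. f g + (\<Sum>j\<in>UNIV. tang j f * phi j g)) \<in> kid"
proof (rule kid_criterion)
  show "(\<lambda>g. f g + (\<Sum>j\<in>UNIV. tang j f * phi j g)) \<in> poly_funs"
    by (intro pf poly_funs_sum f phi_in_poly_funs)
  show "f (mat 1) + (\<Sum>j\<in>UNIV. tang j f * phi j (mat 1)) = 0"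
    using primitive_one[OF f ab eq] by simp
  fix j
  have delta: "(\<Sum>i\<in>UNIV. tang i f * (if i = j then 1 else 0)) = tang j f"
    using exhaust_4[of j] by (elim disjE) (simp_all add: sum_4)
  have "der j (\<lambda>g. f g + (\<Sum>i\<in>UNIV. tang i f * phi i g)) g = der j f g + tang j f" if "g \<in> carrier Sp4" for g
    by (simp add: pf poly_funs_sum f lderiv_sum phi_in_poly_funs der_phi that delta)
  then show "der j (\<lambda>g. f g + (\<Sum>i\<in>UNIV. tang i f * phi i g)) \<in> kid"
    by (intro kid_cong[OF der_primitive[OF f ab eq]]) (auto intro!: lderiv_in_poly_funs pf poly_funs_sum f)
qed

end

section \<open>Induced modules of small weight\<close>

text \<open>The polynomials \<open>p\<close> and \<open>q\<close> describe a section of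
  \<open>O(n)\<close> on the projective line in its two affine charts.\<close>

lemma degree_le_reciprocal:
  fixes p q :: "'k::alg_closed_field poly"
  assumes "\<And>t. t \<noteq> 0 \<Longrightarrow> poly p t = t ^ n * poly q (inverse t)"
  shows "degree p \<le> n"
proof (cases "p = 0")
  case False
  have eq: "monom 1 (degree q) * p = monom 1 n * reflect_poly q"
  proof (rule poly_eqI_nonzero)
    fix t :: 'k assume "t \<noteq> 0"
    then show "poly (monom 1 (degree q) * p) t = poly (monom 1 n * reflect_poly q) t"
      using assms[of t] by (simp add: poly_monom poly_reflect_poly_nz)
  qed
  have "degree (monom 1 (degree q) * p) = degree q + degree p"
    using False by (simp add: degree_mult_eq degree_monom_eq)
  moreover have "degree (monom 1 n * reflect_poly q) \<le> n + degree (reflect_poly q)"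
    by (rule order.trans[OF degree_mult_le]) (simp add: degree_monom_eq)
  ultimately show ?thesis using degree_reflect_poly_le[of q] eq by simp
qed simp

lemma reciprocal_0:
  fixes u v :: "'k::alg_closed_field \<Rightarrow> 'k"
  assumes "polyfun u" "polyfun v" "\<And>t. t \<noteq> 0 \<Longrightarrow> u t = v (inverse t)"
  shows "u t = u 0" "v t = u 0"
proof -
  have *: "u t = u 0" if uv: "polyfun u" "polyfun v" "\<And>t. t \<noteq> 0 \<Longrightarrow> u t = v (inverse t)" for u v :: "'k \<Rightarrow> 'k" and t
  proof -
    obtain p q where pq: "u = poly p" "v = poly q" using uv(1,2) by (meson polyfunE)
    then have "degree p \<le> 0" using uv(3) by (intro degree_le_reciprocal[of p 0 q]) auto
    then obtain c where "p = [:c:]" by (metis degree_eq_zeroE le_zero_eq)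
    then show ?thesis by (simp add: pq)
  qed
  show "u t = u 0" by (rule *[OF assms])
  have "v t = v 0" by (rule *[OF assms(2,1)]) (use assms(3) in \<open>metis inverse_inverse_eq inverse_nonzero_iff_nonzero\<close>)
  moreover have "v 1 = v 0" by (rule *[OF assms(2,1)]) (use assms(3) in \<open>metis inverse_inverse_eq inverse_nonzero_iff_nonzero\<close>)
  moreover have "u 1 = u 0" by (rule *[OF assms])
  ultimately show "v t = u 0" using assms(3)[of 1] by simp
qed

text \<open>A section of \<open>O(1)\<close> is determined by its values at the origins of the two
  charts.\<close>

lemma reciprocal_1:
  fixes u v :: "'k::alg_closed_field \<Rightarrow> 'k"
  assumes "polyfun u" "polyfun v" "\<And>t. t \<noteq> 0 \<Longrightarrow> u t = t * v (inverse t)"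
  shows "u t = u 0 + t * v 0"
proof -
  obtain p q where pq: "u = poly p" "v = poly q" using assms by (meson polyfunE)
  then have "degree p \<le> 1" using assms(3) by (intro degree_le_reciprocal[of p 1 q]) auto
  then have p: "p = [:coeff p 0, coeff p 1:]"
    by (intro poly_eqI) (auto simp: coeff_pCons coeff_eq_0 split: nat.split)
  have ut: "u t = coeff p 0 + t * coeff p 1" for t unfolding pq(1) by (subst p) simp
  have "v s = coeff p 1 + s * coeff p 0" if "s \<noteq> 0" for s
    using assms(3)[of "inverse s"] that by (simp add: ut field_simps)
  then have "q = [:coeff p 1, coeff p 0:]" by (intro poly_eqI_nonzero) (simp add: pq)
  then have "v 0 = coeff p 1" by (simp add: pq)
  then show ?thesis using ut by simp
qed

lemma H0_simps:
  "carrier (H0 w) = {f \<in> carrier coord_ring. \<forall>g\<in>carrier Sp4. \<forall>b\<in>borel. f (g ** b) = inverse (weight_char w b) * f g}"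
  "zero (H0 w) = (\<lambda>g\<in>carrier Sp4. 0)" "add (H0 w) = (\<lambda>f h. \<lambda>g\<in>carrier Sp4. f g + h g)"
  "smult (H0 w) = (\<lambda>c f. \<lambda>g\<in>carrier Sp4. c * f g)"
  "act (H0 w) = (\<lambda>x f. \<lambda>g\<in>carrier Sp4. f (inv\<^bsub>Sp4\<^esub> x ** g))"
  by (simp_all add: H0_def coord_ring_def)

context char2
begin

lemma polyfun_divide_linear [simp]: "polyfun (\<lambda>s::'k. (x + s * y) / c)"
  using polyfun_linear[of "x / c" "y / c"] by (simp add: add_divide_distrib)

text \<open>A symplectic matrix with prescribed last column: a local section of the orbit map of the
  last basis vector, regular where coordinate \<open>j\<close> is nonzero.\<close>

definition chart :: "4 \<Rightarrow> 'k ^ 4 \<Rightarrow> 'k mat4" where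
  "chart j v =
    (if j = 1 then mk4 [[0, 0, 0, v $ 1], [0, 0, 1, v $ 2], [0, 1, 0, v $ 3], [1 / v $ 1, v $ 2 / v $ 1, v $ 3 / v $ 1, v $ 4]]
     else if j = 2 then mk4 [[0, 0, 1, v $ 1], [0, 0, 0, v $ 2], [1 / v $ 2, v $ 1 / v $ 2, v $ 4 / v $ 2, v $ 3], [0, 1, 0, v $ 4]]
     else if j = 3 then mk4 [[0, 1, 0, v $ 1], [1 / v $ 3, v $ 4 / v $ 3, v $ 1 / v $ 3, v $ 2], [0, 0, 0, v $ 3], [0, 0, 1, v $ 4]]
     else mk4 [[1 / v $ 4, v $ 3 / v $ 4, v $ 2 / v $ 4, v $ 1], [0, 1, 0, v $ 2], [0, 0, 1, v $ 3], [0, 0, 0, v $ 4]])"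

lemma chart_Sp4: "v $ j \<noteq> 0 \<Longrightarrow> chart j v \<in> carrier Sp4"
  using exhaust_4[of j] by (elim disjE) (simp_all add: chart_def mk4_Sp4 field_simps)

lemma chart_column: "column 4 (chart j v) = v"
  by (simp add: column_def vec_eq_iff chart_def forall_4)

text \<open>The only denominator is coordinate \<open>j\<close>, which stays constant along such a
  line.\<close>

lemma chart_poly:
  assumes "u $ j = 0"
  shows "polyfun (\<lambda>s. chart j (\<chi> i. v $ i + s * u $ i) $ a $ b)"
proof -
  have "\<forall>a b. polyfun (\<lambda>s. chart j (\<chi> i. v $ i + s * u $ i) $ a $ b)" if "j = 1 \<or> j = 2 \<or> j = 3 \<or> j = 4"
    using that assms by (elim disjE) (simp_all add: chart_def forall_4)
  then show ?thesis using exhaust_4[of j] by blast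
qed

lemma borel_elems:
  "y1 t \<in> borel" "y2 t \<in> borel" "y12 t \<in> borel" "y11 t \<in> borel" "s \<noteq> 0 \<Longrightarrow> t \<noteq> 0 \<Longrightarrow> dg s t \<in> borel"
  using gen_Sp4[OF root_gen'(2)] gen_Sp4[OF root_gen'(4)] dg_Sp4
  by (auto simp: borel_def, simp_all add: root_defs root_defs' dg_def)

lemma root_shift:
  "x2 t = shift (mat 1) (mk4 [[0,0,0,0],[0,0,1,0],[0,0,0,0],[0,0,0,0]]) t"
  "y2 t = shift (mat 1) (mk4 [[0,0,0,0],[0,0,0,0],[0,1,0,0],[0,0,0,0]]) t"
  by (simp_all add: root_defs mat4_eq_iff forall_4 mat_nth)

lemma entry_1_1: "y1 t $ 1 $ 1 = 1" "y2 t $ 1 $ 1 = 1" "y12 t $ 1 $ 1 = 1" "y11 t $ 1 $ 1 = 1" "dg s t $ 1 $ 1 = s"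
  by (simp_all add: root_defs root_defs' dg_def)

end

locale small_weight = char2 ty for ty :: "'k::alg_closed_field itself" +
  fixes n :: nat and f f' :: "'k mat4 \<Rightarrow> 'k"
  assumes f: "f \<in> carrier (H0 (int n, 0))" and f': "f' \<in> poly_funs" "f = restrict f' (carrier Sp4)"
begin

lemma inv_borel: "g \<in> carrier Sp4 \<Longrightarrow> b \<in> borel \<Longrightarrow> f (g ** b) = inverse (b $ 1 $ 1 ^ n) * f g"
  using f by (simp add: H0_simps weight_char_def)

lemma inv_roots:
  assumes "g \<in> carrier Sp4"
  shows "f (g ** y1 t) = f g" "f (g ** y2 t) = f g" "f (g ** y12 t) = f g" "f (g ** y11 t) = f g"
    "t \<noteq> 0 \<Longrightarrow> f (g ** dg 1 t) = f g"
  using inv_borel[OF assms] borel_elems by (simp_all add: entry_1_1)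

lemma f_curve:
  assumes "\<And>t. c t \<in> carrier Sp4" "\<And>i j. polyfun (\<lambda>t. c t $ i $ j)"
  shows "polyfun (\<lambda>t. f (c t))"
  using polyfun_curve[OF f'(1) assms(2)] by (simp add: f'(2) assms(1))

text \<open>The weight is orthogonal to the long simple root, so along its rank one subgroup the
  function is a section of the trivial bundle on a projective line, hence constant.\<close>

lemma inv_x2:
  assumes g: "g \<in> carrier Sp4" shows "f (g ** x2 t) = f g"
proof -
  \<comment> \<open>The change of chart on this projective line, written as a product with a Borel
    element whose entry 11 is 1.\<close>
  have x2: "x2 t = y2 (inverse t) ** w2 ** mk4 [[1,0,0,0],[0,1/t,0,0],[0,1,t,0],[0,0,0,1]]" if "t \<noteq> 0" for t
    using that by (simp add: root_defs w2_def mat4_eq_iff forall_4 mult4 inverse_eq_divide)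
  have b: "mk4 [[1,0,0,0],[0,1/t,0,0],[0,1,t,0],[0,0,0,1]] \<in> borel" if "t \<noteq> 0" for t :: 'k
    using that by (simp add: borel_def mk4_Sp4)
  have w: "g ** y2 s ** w2 \<in> carrier Sp4" for s using g gen_Sp4[OF w_gen(2)] by blast
  have "f (g ** x2 t) = f (g ** y2 (inverse t) ** w2)" if "t \<noteq> 0" for t
    using inv_borel[OF w b[OF that], of "inverse t"] by (simp add: x2[OF that] matrix_mul_assoc)
  moreover have "polyfun (\<lambda>t. f (g ** x2 t))"
    by (rule f_curve[OF Sp4_mult[OF g root_Sp4(3)]]) (simp add: root_shift shift_mult_left)
  moreover have "polyfun (\<lambda>t. f (g ** y2 t ** w2))"
    by (rule f_curve[OF w]) (simp add: root_shift shift_mult_left shift_mult_right)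
  ultimately have "f (g ** x2 t) = f (g ** x2 0)" using reciprocal_0(1) by blast
  moreover have "x2 0 = mat 1" by (simp add: x2_def mat4_eq_iff forall_4 mat_nth)
  ultimately show ?thesis by simp
qed

lemma inv_w2: "g \<in> carrier Sp4 \<Longrightarrow> f (g ** w2) = f g"
  by (simp add: w2_eq matrix_mul_assoc inv_x2 inv_roots)

lemma inv_block2:
  assumes g: "g \<in> carrier Sp4" and d: "p * s + q * r = 1"
  shows "f (g ** block2 p q r s) = f g"
proof (cases "s = 0")
  case False
  then show ?thesis using g
    by (simp add: block2_factor[OF d] matrix_mul_assoc inv_roots inv_x2)
next
  case True
  then have q: "q \<noteq> 0" "r * q + s * p = 1" using d by (auto simp: mult.commute)
  have "block2 p q r s = w2 ** block2 r s p q"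
    by (simp add: block2_def w2_def mat4_eq_iff forall_4 mult4)
  then show ?thesis using g gen_Sp4[OF w_gen(2)] q
    by (simp add: block2_factor[OF q(2,1)] matrix_mul_assoc inv_roots inv_x2 inv_w2)
qed

text \<open>Two group elements with equal last column differ on the right by a stabilizer of the
  last basis vector, and the function is invariant under each factor in
  \<open>Sp4_last_column_factor\<close>.\<close>

lemma column_dep:
  assumes g: "g \<in> carrier Sp4" "h \<in> carrier Sp4" and col: "column 4 g = column 4 h"
  shows "f g = f h"
proof -
  let ?q = "sinv g ** h"
  have "?q $ i $ 4 = (sinv g ** g) $ i $ 4" for i
    using col by (simp add: mult4 column_def vec_eq_iff)
  then have "?q \<in> carrier Sp4" "?q $ 1 $ 4 = 0" "?q $ 2 $ 4 = 0" "?q $ 3 $ 4 = 0" "?q $ 4 $ 4 = 1"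
    using g by (simp_all add: sinv_left mat_nth)
  from Sp4_last_column_factor[OF this] obtain a b c p q r s
    where e: "y11 a ** y12 b ** y1 c ** ?q = block2 p q r s" "p * s + q * r = 1" by blast
  have inv: "y1 c ** y12 b ** y11 a ** (y11 a ** y12 b ** y1 c) = mat 1"
    by (simp add: root_defs root_defs' mat4_eq_iff forall_4 mult4 mat_nth)
  have "g ** (y1 c ** y12 b ** y11 a) ** (y11 a ** y12 b ** y1 c ** ?q) = 
      g ** (y1 c ** y12 b ** y11 a ** (y11 a ** y12 b ** y1 c)) ** ?q"
    by (simp only: matrix_mul_assoc)
  also have "\<dots> = (g ** sinv g) ** h" unfolding inv by (simp add: matrix_mul_assoc)
  also have "\<dots> = h" using g by (simp add: sinv_right)
  finally have "h = g ** y1 c ** y12 b ** y11 a ** block2 p q r s"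
    unfolding e(1) by (simp add: matrix_mul_assoc)
  then show ?thesis
    using g gen_Sp4[OF root_gen'(2)] gen_Sp4[OF root_gen'(4)] by (simp add: inv_block2[OF _ e(2)] inv_roots)
qed

text \<open>The induced function on nonzero vectors; by \<open>F_chart\<close> the chosen coordinate
  does not matter. At the zero vector the value has no meaning.\<close>

definition F :: "'k ^ 4 \<Rightarrow> 'k" where
  "F v = f (chart (SOME j. v $ j \<noteq> 0) v)"

lemma F_column: assumes g: "g \<in> carrier Sp4" shows "F (column 4 g) = f g"
proof -
  have "\<exists>j. column 4 g $ j \<noteq> 0" using Sp4_column_nonzero[OF g, of 4] by (simp add: column_def)
  from someI_ex[OF this] show ?thesis
    unfolding F_def by (intro column_dep chart_Sp4 g chart_column)
qed

lemma F_chart: "v $ j \<noteq> 0 \<Longrightarrow> F v = f (chart j v)"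
  using F_column[OF chart_Sp4, of v j] by (simp add: chart_column)

text \<open>Right multiplication by \<open>dg (inverse c) 1\<close> scales the last column by
  \<open>c\<close>, and equivariance contributes \<open>c ^ n\<close>.\<close>

lemma F_scale:
  assumes "c \<noteq> 0" "v \<noteq> 0" shows "F (c *s v) = c ^ n * F v"
proof -
  obtain j where j: "v $ j \<noteq> 0" using assms(2) by (auto simp: vec_eq_iff)
  let ?g = "chart j v"
  have g: "?g \<in> carrier Sp4" "?g ** dg (inverse c) 1 \<in> carrier Sp4" using chart_Sp4[OF j] assms(1) by auto
  have "column 4 (?g ** dg (inverse c) 1) = c *s column 4 ?g"
    by (simp add: column_def vec_eq_iff mult4 dg_def mult.commute)
  then have "F (c *s v) = f (?g ** dg (inverse c) 1)" using F_column[OF g(2)] by (simp add: chart_column)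
  also have "\<dots> = c ^ n * f ?g" using inv_borel[OF g(1) borel_elems(5)] assms(1) by (simp add: entry_1_1 power_inverse)
  finally show ?thesis using F_chart[OF j] by simp
qed

lemma F_line_poly:
  assumes "v $ j \<noteq> 0" "u $ j = 0"
  shows "polyfun (\<lambda>s. F (\<chi> i. v $ i + s * u $ i))"
proof -
  have "F (\<chi> i. v $ i + s * u $ i) = f (chart j (\<chi> i. v $ i + s * u $ i))" for s
    using assms by (intro F_chart) simp
  moreover have "polyfun (\<lambda>s. f (chart j (\<chi> i. v $ i + s * u $ i)))"
    using assms by (intro f_curve chart_Sp4 chart_poly) simp_all
  ultimately show ?thesis by simp
qed

text \<open>The vectors \<open>v\<close> and \<open>axis i 1\<close> span a projective line;
  \<open>p\<close> and \<open>q\<close> are the restrictions of \<open>F\<close> in its two affine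
  charts, and homogeneity links them.\<close>

lemma F_line:
  assumes v: "v \<noteq> 0" "v $ i = 0"
  defines "p \<equiv> \<lambda>s. F (\<chi> k. v $ k + s * axis i 1 $ k)" and "q \<equiv> \<lambda>s. F (\<chi> k. axis i 1 $ k + s * v $ k)"
  shows "polyfun p" "polyfun q" "t \<noteq> 0 \<Longrightarrow> p t = t ^ n * q (inverse t)" "p 0 = F v" "q 0 = F (axis i 1)"
proof -
  obtain j where j: "v $ j \<noteq> 0" using v(1) by (auto simp: vec_eq_iff)
  then have ij: "i \<noteq> j" using v(2) by auto
  show "polyfun p" unfolding p_def by (rule F_line_poly[OF j]) (use ij in \<open>simp add: axis_def\<close>)
  show "polyfun q" unfolding q_def by (rule F_line_poly[of _ i]) (simp_all add: axis_def v)
  show "p 0 = F v" "q 0 = F (axis i 1)" by (simp_all add: p_def q_def)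
  assume t: "t \<noteq> 0"
  have "(\<chi> k. v $ k + t * axis i 1 $ k) = t *s (\<chi> k. axis i 1 $ k + inverse t * v $ k)"
    using t by (simp add: vec_eq_iff algebra_simps)
  moreover have "(\<chi> k. axis i 1 $ k + inverse t * v $ k) $ i \<noteq> 0" by (simp add: v axis_def)
  then have "(\<chi> k. axis i 1 $ k + inverse t * v $ k) \<noteq> 0" by (metis zero_index)
  ultimately show "p t = t ^ n * q (inverse t)" unfolding p_def q_def using F_scale[OF t] by metis
qed

lemma F_constant:
  assumes "n = 0" "v \<noteq> 0" shows "F v = F (axis 1 1)"
proof -
  have *: "F (\<chi> k. w $ k + s * axis i 1 $ k) = F w" "F (axis i 1) = F w" if "w \<noteq> 0" "w $ i = 0" for w i s
    using reciprocal_0[OF F_line(1,2)[OF that], of s] reciprocal_0[OF F_line(1,2)[OF that], of 0] F_line(3-5)[OF that] assms(1) by auto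
  have ax: "F (axis i 1) = F (axis 1 1)" for i
  proof (cases "i = 1")
    case False
    then show ?thesis using *(2)[of "axis 1 1" i] by (simp add: axis_def vec_eq_iff)
  qed simp
  show ?thesis
  proof (cases "\<exists>i. v $ i = 0")
    case True
    then show ?thesis using *(2)[OF assms(2)] ax by metis
  next
    case False
    \<comment> \<open>With no zero coordinate, \<open>v\<close> is reached from this nonzero vector
      by moving along the first axis.\<close>
    define w where "w = (\<chi> k. if k = 1 then 0 else v $ k)"
    have w: "w $ 1 = 0" "w $ 2 \<noteq> 0" using False by (simp_all add: w_def)
    then have w0: "w \<noteq> 0" by (metis zero_index)
    have "v = (\<chi> k. w $ k + v $ 1 * axis 1 1 $ k)" by (simp add: vec_eq_iff w_def axis_def)
    then show ?thesis using *[OF w0 w(1)] by metis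
  qed
qed

lemma F_linear:
  assumes "n = 1" "v \<noteq> 0" shows "F v = (\<Sum>i\<in>UNIV. v $ i * F (axis i 1))"
proof -
  \<comment> \<open>The meaningless value at the zero vector is replaced by 0, so that coordinates
    can be added starting from the zero vector.\<close>
  define F0 where "F0 v = (if v = 0 then 0 else F v)" for v
  have ax: "axis i (1::'k) \<noteq> 0" for i :: 4 by (simp add: axis_eq_0_iff)
  have step: "F0 (\<chi> k. w $ k + s * axis i 1 $ k) = F0 w + s * F (axis i 1)" if "w $ i = 0" for w s i
  proof (cases "w = 0")
    case True
    have "(\<chi> k. w $ k + s * axis i 1 $ k) = s *s axis i 1" by (simp add: True vec_eq_iff)
    then show ?thesis using F_scale[OF _ ax[of i], of s] assms(1) True ax[of i]
      by (simp add: F0_def)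
  next
    case False
    then obtain j where "w $ j \<noteq> 0" by (auto simp: vec_eq_iff)
    moreover from this that have "i \<noteq> j" by auto
    ultimately have "(\<chi> k. w $ k + s * axis i 1 $ k) $ j \<noteq> 0" by (simp add: axis_def)
    then have "(\<chi> k. w $ k + s * axis i 1 $ k) \<noteq> 0" by (metis zero_index)
    moreover have "F (\<chi> k. w $ k + s * axis i 1 $ k) = F w + s * F (axis i 1)"
      using reciprocal_1[OF F_line(1,2)[OF False that], of s] F_line(3-5)[OF False that] assms(1) by simp
    ultimately show ?thesis using False by (simp add: F0_def)
  qed
  define w :: "nat \<Rightarrow> 'k ^ 4" where "w m = (vector [if m > 0 then v $ 1 else 0, if m > 1 then v $ 2 else 0, if m > 2 then v $ 3 else 0, if m > 3 then v $ 4 else 0])" for m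
  have w0: "w 0 $ 1 = 0" "w 1 $ 2 = 0" "w 2 $ 3 = 0" "w 3 $ 4 = 0" by (simp_all add: w_def)
  have w: "(\<chi> k. w 0 $ k + v $ 1 * axis 1 1 $ k) = w 1" "(\<chi> k. w 1 $ k + v $ 2 * axis 2 1 $ k) = w 2"
      "(\<chi> k. w 2 $ k + v $ 3 * axis 3 1 $ k) = w 3" "(\<chi> k. w 3 $ k + v $ 4 * axis 4 1 $ k) = w 4"
    by (simp_all add: w_def axis_def vec_eq_iff forall_4)
  have "F0 (w 1) = F0 (w 0) + v $ 1 * F (axis 1 1)" "F0 (w 2) = F0 (w 1) + v $ 2 * F (axis 2 1)"
      "F0 (w 3) = F0 (w 2) + v $ 3 * F (axis 3 1)" "F0 (w 4) = F0 (w 3) + v $ 4 * F (axis 4 1)"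
    using step[OF w0(1), of "v $ 1"] step[OF w0(2), of "v $ 2"] step[OF w0(3), of "v $ 3"] step[OF w0(4), of "v $ 4"]
    unfolding w by simp_all
  moreover have "w 0 = 0" "w 4 = v" by (simp_all add: w_def vec_eq_iff forall_4)
  ultimately have "F0 v = (\<Sum>i\<in>UNIV. v $ i * F (axis i 1))" by (simp add: sum_4 F0_def add_ac)
  then show ?thesis using assms(2) by (simp add: F0_def)
qed

end

section \<open>Explicit form of the two induced modules\<close>

context char2
begin

text \<open>Each index is paired with its dual index under the form. Linear functionals of the last
  column form the dual of the natural module, which the form identifies with the natural module
  itself.\<close>

definition opp :: "4 \<Rightarrow> 4" where "opp i = (vector [4, 3, 2, 1] :: 4 ^ 4) $ i"

lemma opp_simps [simp]: "opp 1 = 4" "opp 2 = 3" "opp 3 = 2" "opp 4 = 1"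
  by (simp_all add: opp_def)

text \<open>In these coordinates \<open>H\<^sup>0(\<omega>\<^sub>1)\<close> becomes the natural representation of \<open>Sp\<^sub>4\<close>.\<close>

definition vfun :: "'k ^ 4 \<Rightarrow> 'k mat4 \<Rightarrow> 'k" where
  "vfun c = (\<lambda>g\<in>carrier Sp4. \<Sum>i\<in>UNIV. c $ i * g $ opp i $ 4)"

definition cfun :: "'k \<Rightarrow> 'k mat4 \<Rightarrow> 'k" where
  "cfun c = (\<lambda>g\<in>carrier Sp4. c)"

text \<open>A group element whose last column is a unit vector, so that evaluation there reads off
  one coefficient of \<open>vfun\<close>.\<close>

definition pt :: "4 \<Rightarrow> 'k mat4" where "pt i = chart (opp i) (axis (opp i) 1)"

lemma pt_Sp4 [simp, intro]: "pt i \<in> carrier Sp4"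
  unfolding pt_def by (rule chart_Sp4) simp

lemma pt_nth: "pt i $ j $ 4 = (if j = opp i then 1 else 0)"
  using chart_column[of "opp i" "axis (opp i) 1"] by (simp add: column_def vec_eq_iff pt_def axis_def)

lemma vfun_pt [simp]: "vfun c (pt i) = c $ i"
  using exhaust_4[of i] by (elim disjE) (simp_all add: vfun_def pt_nth sum_4)

lemma borel_inverse: "b \<in> borel \<Longrightarrow> (b :: 'k mat4) $ 1 $ 1 * b $ 4 $ 4 = 1"
  using Sp4_columns[of b 1 4] by (auto simp: borel_def minor_def)

text \<open>One inclusion is \<open>F_linear\<close>. For the other, a Borel element multiplies the
  last column by its entry 44, the inverse of its entry 11.\<close>

lemma H0_omega1: "carrier (H0 \<omega>\<^sub>1) = range vfun"
proof
  show "carrier (H0 \<omega>\<^sub>1) \<subseteq> range vfun"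
  proof
    fix f :: "'k mat4 \<Rightarrow> 'k" assume f: "f \<in> carrier (H0 \<omega>\<^sub>1)"
    then obtain f' where "f' \<in> poly_funs" "f = restrict f' (carrier Sp4)" by (auto simp: H0_simps elim!: coord_ringE)
    then interpret small_weight ty 1 f f'
      using f by unfold_locales (simp_all add: \<omega>\<^sub>1_def)
    have "f g = vfun (\<chi> i. F (axis (opp i) 1)) g" if g: "g \<in> carrier Sp4" for g
    proof -
      have "column 4 g \<noteq> 0" using Sp4_column_nonzero[OF g, of 4] by (auto simp: column_def vec_eq_iff)
      then have "f g = (\<Sum>i\<in>UNIV. column 4 g $ i * F (axis i 1))" using F_linear F_column[OF g] by metis
      then show ?thesis using g by (simp add: vfun_def sum_4 column_def mult.commute add_ac)
    qed
    moreover have "f g = vfun (\<chi> i. F (axis (opp i) 1)) g" if "g \<notin> carrier Sp4" for g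
      using that fun_cong[OF f'(2), of g] by (simp add: vfun_def)
    ultimately have "f = vfun (\<chi> i. F (axis (opp i) 1))" by blast
    then show "f \<in> range vfun" by blast
  qed
  have "vfun c \<in> carrier (H0 \<omega>\<^sub>1)" for c
  proof -
    have "vfun c \<in> carrier coord_ring" unfolding vfun_def
      by (intro restrict_in_coord_ring poly_funs_sum poly_funs.intros)
    moreover have "vfun c (g ** b) = inverse (weight_char \<omega>\<^sub>1 b) * vfun c g" if "g \<in> carrier Sp4" "b \<in> borel" for g b
    proof -
      have b: "b \<in> carrier Sp4" "b $ 1 $ 4 = 0" "b $ 2 $ 4 = 0" "b $ 3 $ 4 = 0" using that(2) by (auto simp: borel_def)
      have "inverse (b $ 1 $ 1) = b $ 4 $ 4" using borel_inverse[OF that(2)] by (rule inverse_unique)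
      moreover have "(g ** b) $ i $ 4 = g $ i $ 4 * b $ 4 $ 4" for i by (simp add: mult4 b)
      ultimately show ?thesis using that b(1)
        by (simp add: vfun_def weight_char_def \<omega>\<^sub>1_def sum_distrib_left mult_ac)
    qed
    ultimately show ?thesis by (simp add: H0_simps)
  qed
  then show "range vfun \<subseteq> carrier (H0 \<omega>\<^sub>1)" by blast
qed

lemma H0_zero: "carrier (H0 0) = range cfun"
proof
  show "carrier (H0 0) \<subseteq> range cfun"
  proof
    fix f :: "'k mat4 \<Rightarrow> 'k" assume f: "f \<in> carrier (H0 0)"
    then obtain f' where "f' \<in> poly_funs" "f = restrict f' (carrier Sp4)" by (auto simp: H0_simps elim!: coord_ringE)
    then interpret small_weight ty 0 f f'
      using f by unfold_locales (simp_all add: zero_prod_def)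
    have "f g = cfun (F (axis 1 1)) g" if g: "g \<in> carrier Sp4" for g
    proof -
      have "column 4 g \<noteq> 0" using Sp4_column_nonzero[OF g, of 4] by (auto simp: column_def vec_eq_iff)
      from F_constant[OF refl this] show ?thesis unfolding F_column[OF g] using g by (simp add: cfun_def)
    qed
    moreover have "f g = cfun (F (axis 1 1)) g" if "g \<notin> carrier Sp4" for g
      using that fun_cong[OF f'(2), of g] by (simp add: cfun_def)
    ultimately have "f = cfun (F (axis 1 1))" by blast
    then show "f \<in> range cfun" by blast
  qed
  have "b \<in> carrier Sp4" if "b \<in> borel" for b :: "'k mat4" using that by (simp add: borel_def)
  then show "range cfun \<subseteq> carrier (H0 0)"
    by (auto simp: H0_simps cfun_def weight_char_def intro!: restrict_in_coord_ring poly_funs.intros)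
qed

end

section \<open>Modules\<close>

lemma base_field_simps [simp]:
  "carrier base_field = UNIV" "mult base_field = (*)" "one base_field = 1" "zero base_field = 0" "add base_field = (+)"
  by (simp_all add: base_field_def)

lemma base_field_cring: "cring (base_field :: 'k::field ring)"
proof (rule cringI)
  show "abelian_group (base_field :: 'k ring)"
    by (rule abelian_groupI) (auto intro: exI[of _ "- _"] simp: add_ac)
  show "comm_monoid (base_field :: 'k ring)"
    by (rule comm_monoidI) (auto simp: mult_ac)
qed (simp add: distrib_right)

lemma is_gmoduleD:
  assumes "is_gmodule M"
  shows "Module.module base_field M"
    and "g \<in> carrier Sp4 \<Longrightarrow> v \<in> carrier M \<Longrightarrow> act M g v \<in> carrier M"
    and "g \<in> carrier Sp4 \<Longrightarrow> v \<in> carrier M \<Longrightarrow> w \<in> carrier M \<Longrightarrow> act M g (v \<oplus>\<^bsub>M\<^esub> w) = act M g v \<oplus>\<^bsub>M\<^esub> act M g w"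
    and "g \<in> carrier Sp4 \<Longrightarrow> v \<in> carrier M \<Longrightarrow> act M g (c \<odot>\<^bsub>M\<^esub> v) = c \<odot>\<^bsub>M\<^esub> act M g v"
    and "v \<in> carrier M \<Longrightarrow> act M \<one>\<^bsub>Sp4\<^esub> v = v"
    and "g \<in> carrier Sp4 \<Longrightarrow> h \<in> carrier Sp4 \<Longrightarrow> v \<in> carrier M \<Longrightarrow> act M (g \<otimes>\<^bsub>Sp4\<^esub> h) v = act M g (act M h v)"
    and "v \<in> carrier M \<Longrightarrow> (\<lambda>g\<in>carrier Sp4. act M g v) \<in> tensor_maps (carrier Sp4) (carrier coord_ring) M"
  using assms by (auto simp: is_gmodule_def)

lemma transport_finsum:
  assumes M: "abelian_group M" and N: "abelian_group N"
    and c: "\<And>u. u \<in> carrier N \<Longrightarrow> c u \<in> carrier M" "c \<zero>\<^bsub>N\<^esub> = \<zero>\<^bsub>M\<^esub>"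
      "\<And>u v. u \<in> carrier N \<Longrightarrow> v \<in> carrier N \<Longrightarrow> c (u \<oplus>\<^bsub>N\<^esub> v) = c u \<oplus>\<^bsub>M\<^esub> c v"
    and F: "\<And>i. i < n \<Longrightarrow> F i \<in> carrier N"
  shows "c (finsum N F {..<n::nat}) = finsum M (\<lambda>i. c (F i)) {..<n}"
  using F
proof (induction n)
  interpret M: abelian_group M by (rule M)
  interpret N: abelian_group N by (rule N)
  {
    case 0
    show ?case by (simp add: c)
  next
    case (Suc n)
    then have "finsum N F {..<n} \<in> carrier N" by (intro N.finsum_closed) auto
    then show ?case using Suc by (simp add: lessThan_Suc Pi_def c)
  }
qed

text \<open>All axioms, rationality included, are carried from \<open>N\<close> along the bijection
  and need not be checked on \<open>M\<close>.\<close>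

lemma gmodule_transport:
  fixes M :: "('k::field, 'v) gmodule" and N :: "('k, 'w) gmodule"
  assumes N: "is_gmodule N" and bij: "bij_betw c (carrier N) (carrier M)"
    and add: "\<And>u v. u \<in> carrier N \<Longrightarrow> v \<in> carrier N \<Longrightarrow> c u \<oplus>\<^bsub>M\<^esub> c v = c (u \<oplus>\<^bsub>N\<^esub> v)"
    and smult: "\<And>a u. u \<in> carrier N \<Longrightarrow> a \<odot>\<^bsub>M\<^esub> c u = c (a \<odot>\<^bsub>N\<^esub> u)"
    and zero: "\<zero>\<^bsub>M\<^esub> = c \<zero>\<^bsub>N\<^esub>"
    and act: "\<And>g u. g \<in> carrier Sp4 \<Longrightarrow> u \<in> carrier N \<Longrightarrow> act M g (c u) = c (act N g u)"
  shows "M \<cong>\<^sub>G N"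
proof -
  note N' = is_gmoduleD[OF N]
  interpret N: Module.module base_field N by (rule N'(1))
  have M: "carrier M = c ` carrier N" using bij by (simp add: bij_betw_def)
  have ag: "abelian_group M"
  proof (rule abelian_groupI)
    fix x assume "x \<in> carrier M"
    then obtain u where u: "u \<in> carrier N" "x = c u" unfolding M by blast
    then have "c (\<ominus>\<^bsub>N\<^esub> u) \<in> carrier M" "c (\<ominus>\<^bsub>N\<^esub> u) \<oplus>\<^bsub>M\<^esub> x = \<zero>\<^bsub>M\<^esub>"
      by (auto simp: M add zero N.l_neg)
    then show "\<exists>y\<in>carrier M. y \<oplus>\<^bsub>M\<^esub> x = \<zero>\<^bsub>M\<^esub>" by blast
  qed (auto simp: M add zero N.a_ac)
  have mod: "Module.module base_field M"
    by (rule moduleI[OF base_field_cring ag])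
       (use N.smult_l_distr N.smult_r_distr N.smult_assoc1 N.smult_one in \<open>auto simp: M add smult\<close>)
  have "(\<lambda>g\<in>carrier Sp4. act M g x) \<in> tensor_maps (carrier Sp4) (carrier coord_ring) M" if x: "x \<in> carrier M" for x
  proof -
    obtain u where u: "u \<in> carrier N" "x = c u" using x unfolding M by blast
    obtain n a v where eq: "(\<lambda>g\<in>carrier Sp4. act N g u) = (\<lambda>g\<in>carrier Sp4. \<Oplus>\<^bsub>N\<^esub>i\<in>{..<n::nat}. a i g \<odot>\<^bsub>N\<^esub> v i)"
      and av: "\<forall>i<n. a i \<in> carrier coord_ring \<and> v i \<in> carrier N"
      using N'(7)[OF u(1)] unfolding tensor_maps_def by blast
    have "act M g x = (\<Oplus>\<^bsub>M\<^esub>i\<in>{..<n}. a i g \<odot>\<^bsub>M\<^esub> c (v i))" if g: "g \<in> carrier Sp4" for g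
    proof -
      have "act M g x = c (\<Oplus>\<^bsub>N\<^esub>i\<in>{..<n}. a i g \<odot>\<^bsub>N\<^esub> v i)"
        using fun_cong[OF eq, of g] g by (simp add: u act)
      also have "\<dots> = (\<Oplus>\<^bsub>M\<^esub>i\<in>{..<n}. c (a i g \<odot>\<^bsub>N\<^esub> v i))"
        by (rule transport_finsum[OF ag N.abelian_group_axioms]) (use av in \<open>auto simp: M zero add\<close>)
      also have "\<dots> = (\<Oplus>\<^bsub>M\<^esub>i\<in>{..<n}. a i g \<odot>\<^bsub>M\<^esub> c (v i))"
      proof -
        interpret M: abelian_group M by (rule ag)
        show ?thesis by (rule M.finsum_cong') (use av in \<open>auto simp: M smult\<close>)
      qed
      finally show ?thesis .
    qed
    then have "(\<lambda>g\<in>carrier Sp4. act M g x) = (\<lambda>g\<in>carrier Sp4. \<Oplus>\<^bsub>M\<^esub>i\<in>{..<n}. a i g \<odot>\<^bsub>M\<^esub> c (v i))"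
      by (intro restrict_ext)
    moreover have "\<forall>i<n. a i \<in> carrier coord_ring \<and> c (v i) \<in> carrier M" using av by (auto simp: M)
    ultimately show ?thesis unfolding tensor_maps_def
      by (intro CollectI exI[of _ n] exI[of _ a] exI[of _ "\<lambda>i. c (v i)"] conjI)
  qed
  then have gM: "is_gmodule M"
    unfolding is_gmodule_def using mod N'(2-6) by (auto simp: M add smult act)
  have inj: "inj_on c (carrier N)" using bij by (simp add: bij_betw_def)
  have inv: "u \<in> carrier N \<Longrightarrow> inv_into (carrier N) c (c u) = u" for u using inj by simp
  show ?thesis unfolding gmodule_iso_def
  proof (intro conjI gM N exI[of _ "inv_into (carrier N) c"] ballI allI)
    show "bij_betw (inv_into (carrier N) c) (carrier M) (carrier N)" using bij by (rule bij_betw_inv_into)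
  qed (auto simp: M add smult act inv N'(2))
qed

text \<open>The cosets are the fibres of the map, so the quotient is a copy of \<open>N\<close>. In
  particular the untwisted action is rational because that of \<open>N\<close> is.\<close>

lemma quotient_iso:
  fixes A :: "('k::field, 'v) gmodule" and N :: "('k, 'w) gmodule"
  assumes N: "is_gmodule N" and onto: "\<Psi> ` carrier A = carrier N"
    and B: "B = {z \<in> carrier A. \<Psi> z = \<zero>\<^bsub>N\<^esub>}"
    and add: "\<And>z z'. z \<in> carrier A \<Longrightarrow> z' \<in> carrier A \<Longrightarrow> z \<oplus>\<^bsub>A\<^esub> z' \<in> carrier A \<and> \<Psi> (z \<oplus>\<^bsub>A\<^esub> z') = \<Psi> z \<oplus>\<^bsub>N\<^esub> \<Psi> z'"
    and assoc: "\<And>x y z. x \<in> carrier A \<Longrightarrow> y \<in> carrier A \<Longrightarrow> z \<in> carrier A \<Longrightarrow> (x \<oplus>\<^bsub>A\<^esub> y) \<oplus>\<^bsub>A\<^esub> z = x \<oplus>\<^bsub>A\<^esub> (y \<oplus>\<^bsub>A\<^esub> z)"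
    and smult: "\<And>a z. z \<in> carrier A \<Longrightarrow> a \<odot>\<^bsub>A\<^esub> z \<in> carrier A \<and> \<Psi> (a \<odot>\<^bsub>A\<^esub> z) = a \<odot>\<^bsub>N\<^esub> \<Psi> z"
    and act: "\<And>g z. g \<in> carrier Sp4 \<Longrightarrow> z \<in> carrier A \<Longrightarrow>
      act A (inv_into (carrier Sp4) \<tau> g) z \<in> carrier A \<and> \<Psi> (act A (inv_into (carrier Sp4) \<tau> g) z) = act N g (\<Psi> z)"
    and fibre: "\<And>z z'. z \<in> carrier A \<Longrightarrow> z' \<in> carrier A \<Longrightarrow> \<Psi> z = \<Psi> z' \<Longrightarrow> \<exists>b\<in>B. z' = b \<oplus>\<^bsub>A\<^esub> z"
  shows "untwist \<tau> (quot_gmodule A B) \<cong>\<^sub>G N"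
proof -
  define cls where "cls u = {z \<in> carrier A. \<Psi> z = u}" for u
  interpret N: Module.module base_field N by (rule is_gmoduleD[OF N])
  have coset: "B +>\<^bsub>A\<^esub> z = cls (\<Psi> z)" if z: "z \<in> carrier A" for z
  proof
    show "B +>\<^bsub>A\<^esub> z \<subseteq> cls (\<Psi> z)"
      using z add onto by (auto simp: a_r_coset_def' B cls_def) (metis N.l_zero imageI onto)
    show "cls (\<Psi> z) \<subseteq> B +>\<^bsub>A\<^esub> z"
      using fibre[OF z] by (fastforce simp: a_r_coset_def' cls_def)
  qed
  have ne: "\<exists>z\<in>carrier A. \<Psi> z = u" if "u \<in> carrier N" for u using that by (auto simp flip: onto)
  have im: "\<Psi> z \<in> carrier N" if "z \<in> carrier A" for z using that onto by blast
  show ?thesis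
  proof (rule gmodule_transport[OF N, of cls])
    have "carrier (quot_gmodule A B) = cls ` carrier N"
      by (auto simp: quot_gmodule_def A_RCOSETS_def' coset simp flip: onto)
    moreover have "inj_on cls (carrier N)"
    proof (rule inj_onI)
      fix u v assume "u \<in> carrier N" "v \<in> carrier N" "cls u = cls v"
      then show "u = v" using ne[of u] by (auto simp: cls_def)
    qed
    ultimately show "bij_betw cls (carrier N) (carrier (untwist \<tau> (quot_gmodule A B)))"
      by (simp add: bij_betw_def untwist_def)
  next
    fix u v assume uv: "u \<in> carrier N" "v \<in> carrier N"
    have "cls u <+>\<^bsub>A\<^esub> cls v = cls (u \<oplus>\<^bsub>N\<^esub> v)"
    proof
      show "cls u <+>\<^bsub>A\<^esub> cls v \<subseteq> cls (u \<oplus>\<^bsub>N\<^esub> v)"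
        using add by (auto simp: set_add_def' cls_def)
      show "cls (u \<oplus>\<^bsub>N\<^esub> v) \<subseteq> cls u <+>\<^bsub>A\<^esub> cls v"
      proof
        fix w assume w: "w \<in> cls (u \<oplus>\<^bsub>N\<^esub> v)"
        obtain x y where x: "x \<in> carrier A" "\<Psi> x = u" and y: "y \<in> carrier A" "\<Psi> y = v" using ne uv by metis
        then have "\<Psi> (x \<oplus>\<^bsub>A\<^esub> y) = \<Psi> w" "x \<oplus>\<^bsub>A\<^esub> y \<in> carrier A" "w \<in> carrier A" using add w by (auto simp: cls_def)
        then obtain b where b: "b \<in> B" "w = b \<oplus>\<^bsub>A\<^esub> (x \<oplus>\<^bsub>A\<^esub> y)" using fibre by metis
        \<comment> \<open>The correction \<open>b\<close> has image zero, so it can be absorbed into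
          the representative of \<open>u\<close>.\<close>
        then have "w = (b \<oplus>\<^bsub>A\<^esub> x) \<oplus>\<^bsub>A\<^esub> y" using assoc x y by (simp add: B)
        moreover have "b \<oplus>\<^bsub>A\<^esub> x \<in> cls u" using add[of b x] b(1) x uv by (simp add: B cls_def)
        moreover have "y \<in> cls v" using y by (simp add: cls_def)
        ultimately show "w \<in> cls u <+>\<^bsub>A\<^esub> cls v" by (auto simp: set_add_def')
      qed
    qed
    then show "cls u \<oplus>\<^bsub>untwist \<tau> (quot_gmodule A B)\<^esub> cls v = cls (u \<oplus>\<^bsub>N\<^esub> v)"
      by (simp add: untwist_def quot_gmodule_def)
  next
    fix a u assume u: "u \<in> carrier N"
    have "(\<Union>v\<in>cls u. B +>\<^bsub>A\<^esub> (a \<odot>\<^bsub>A\<^esub> v)) = (\<Union>v\<in>cls u. cls (a \<odot>\<^bsub>N\<^esub> u))"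
      by (rule SUP_cong) (use smult in \<open>auto simp: cls_def[of u] coset\<close>)
    then show "a \<odot>\<^bsub>untwist \<tau> (quot_gmodule A B)\<^esub> cls u = cls (a \<odot>\<^bsub>N\<^esub> u)"
      using ne[OF u] by (auto simp: untwist_def quot_gmodule_def cls_def[of u])
  next
    show "\<zero>\<^bsub>untwist \<tau> (quot_gmodule A B)\<^esub> = cls \<zero>\<^bsub>N\<^esub>"
      by (simp add: untwist_def quot_gmodule_def cls_def B)
  next
    fix g u assume g: "g \<in> carrier (Sp4 :: 'k mat4 monoid)" and u: "u \<in> carrier N"
    have "(\<Union>v\<in>cls u. B +>\<^bsub>A\<^esub> act A (inv_into (carrier Sp4) \<tau> g) v) = (\<Union>v\<in>cls u. cls (act N g u))"
      by (rule SUP_cong) (use act[OF g] in \<open>auto simp: cls_def[of u] coset\<close>)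
    then show "act (untwist \<tau> (quot_gmodule A B)) g (cls u) = cls (act N g u)"
      using ne[OF u] by (auto simp: untwist_def quot_gmodule_def cls_def[of u])
  qed
qed

context char2
begin

lemma H0_extensional: "f \<in> carrier (H0 w) \<Longrightarrow> f \<in> extensional (carrier Sp4)"
  by (simp add: H0_simps coord_ring_extensional)

lemma borel_Sp4: "b \<in> borel \<Longrightarrow> b \<in> carrier (Sp4 :: 'k mat4 monoid)"
  by (simp add: borel_def)

lemma H0_closed:
  assumes "f \<in> carrier (H0 w)" "h \<in> carrier (H0 w)"
  shows "(\<lambda>g\<in>carrier Sp4. f g + h g) \<in> carrier (H0 w :: ('k, _) gmodule)"
    "(\<lambda>g\<in>carrier Sp4. c * f g) \<in> carrier (H0 w :: ('k, _) gmodule)"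
  using assms borel_Sp4 by (auto simp: H0_simps coord_ring_closed algebra_simps)

lemma H0_zero_closed: "(\<lambda>g\<in>carrier Sp4. 0) \<in> carrier (H0 w :: ('k, _) gmodule)"
  using borel_Sp4 by (auto simp: H0_simps coord_ring_const)

lemma H0_restrict: "f \<in> carrier (H0 w :: ('k, _) gmodule) \<Longrightarrow> (\<lambda>g\<in>carrier Sp4. f g) = f"
  using extensional_restrict[OF H0_extensional] .

lemma H0_abelian_group: "abelian_group (H0 w :: ('k, _) gmodule)"
proof (rule abelian_groupI)
  fix f assume f: "f \<in> carrier (H0 w :: ('k, _) gmodule)"
  show "\<exists>h\<in>carrier (H0 w :: ('k, _) gmodule). h \<oplus>\<^bsub>H0 w\<^esub> f = \<zero>\<^bsub>H0 w\<^esub>"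
    by (rule bexI[OF _ f]) (simp add: H0_simps(2-))
  show "\<zero>\<^bsub>H0 w\<^esub> \<oplus>\<^bsub>H0 w\<^esub> f = f"
    using H0_restrict[OF f] by (auto simp: H0_simps(2-) cong: restrict_cong)
qed (auto simp: H0_simps(2-) H0_closed H0_zero_closed add_ac intro!: restrict_ext)

lemma H0_module: "Module.module base_field (H0 w :: ('k, _) gmodule)"
proof (rule moduleI[OF base_field_cring H0_abelian_group])
  fix f assume f: "f \<in> carrier (H0 w :: ('k, _) gmodule)"
  show "\<one>\<^bsub>base_field\<^esub> \<odot>\<^bsub>H0 w\<^esub> f = f"
    using H0_restrict[OF f] by (auto simp: H0_simps(2-) cong: restrict_cong)
qed (auto simp: H0_simps(2-) H0_closed algebra_simps intro!: restrict_ext)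

lemma H0_minus: "f \<in> carrier (H0 w :: ('k, _) gmodule) \<Longrightarrow> \<ominus>\<^bsub>H0 w\<^esub> f = f"
  by (rule abelian_group.minus_equality[OF H0_abelian_group]) (simp_all add: H0_simps(2-))

lemma H0_finsum:
  assumes "\<And>i. i < n \<Longrightarrow> F i \<in> carrier (H0 w :: ('k, _) gmodule)" "p \<in> carrier Sp4"
  shows "finsum (H0 w) F {..<n::nat} p = (\<Sum>i<n. F i p)"
  using assms(1)
proof (induction n)
  interpret abelian_group "H0 w :: ('k, _) gmodule" by (rule H0_abelian_group)
  {
    case 0
    show ?case using assms(2) by (simp add: H0_simps(2-))
  next
    case (Suc n)
    then have "finsum (H0 w) F {..<n} \<in> carrier (H0 w)" by (intro finsum_closed) auto
    then have "finsum (H0 w) F {..<Suc n} = F n \<oplus>\<^bsub>H0 w\<^esub> finsum (H0 w) F {..<n}"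
      using Suc by (simp add: lessThan_Suc Pi_def)
    then show ?case using Suc assms(2) by (simp add: H0_simps(2-) add.commute)
  }
qed

lemma tensor_H0_E:
  assumes "\<phi> \<in> tensor_maps X S (H0 w :: ('k, _) gmodule)"
  obtains n a v where "\<And>i. i < (n::nat) \<Longrightarrow> a i \<in> S" "\<And>i. i < n \<Longrightarrow> v i \<in> carrier (H0 w)"
    "\<And>x. x \<in> X \<Longrightarrow> \<phi> x \<in> carrier (H0 w)"
    "\<And>x p. x \<in> X \<Longrightarrow> p \<in> carrier Sp4 \<Longrightarrow> \<phi> x p = (\<Sum>i<n. a i x * v i p)" "\<phi> \<in> extensional X"
proof -
  interpret module base_field "H0 w :: ('k, _) gmodule" by (rule H0_module)
  obtain n a v where \<phi>: "\<phi> = (\<lambda>x\<in>X. \<Oplus>\<^bsub>H0 w\<^esub>i\<in>{..<n::nat}. a i x \<odot>\<^bsub>H0 w\<^esub> v i)"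
    and av: "\<forall>i<n. a i \<in> S \<and> v i \<in> carrier (H0 w)"
    using assms unfolding tensor_maps_def by blast
  have cl: "a i x \<odot>\<^bsub>H0 w\<^esub> v i \<in> carrier (H0 w)" if "i < n" for i x using av that by simp
  have "\<phi> x \<in> carrier (H0 w)" if "x \<in> X" for x using that cl by (auto simp: \<phi> intro!: finsum_closed)
  moreover have "\<phi> x p = (\<Sum>i<n. a i x * v i p)" if "x \<in> X" "p \<in> carrier Sp4" for x p
    using that cl by (simp add: \<phi> H0_finsum) (simp add: H0_simps(2-))
  moreover have "\<phi> \<in> extensional X" by (simp add: \<phi>)
  ultimately show ?thesis using that[of n a v] av by blast
qed

lemma tensor_H0D:
  assumes "\<phi> \<in> tensor_maps X S (H0 w :: ('k, _) gmodule)"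
  shows "\<phi> \<in> extensional X" "x \<in> X \<Longrightarrow> \<phi> x \<in> carrier (H0 w)"
  using tensor_H0_E[OF assms, of thesis for thesis] by blast+

text \<open>Lists instead of indexed families: sums of tensors then become concatenations.\<close>

lemma tensor_H0_I:
  fixes xs :: "(('x \<Rightarrow> 'k) \<times> ('k mat4 \<Rightarrow> 'k)) list"
  assumes xs: "\<And>a v. (a, v) \<in> set xs \<Longrightarrow> a \<in> S \<and> v \<in> carrier (H0 w)"
    and \<phi>: "\<phi> \<in> extensional X" "\<And>x. x \<in> X \<Longrightarrow> \<phi> x \<in> carrier (H0 w)"
    "\<And>x p. x \<in> X \<Longrightarrow> p \<in> carrier Sp4 \<Longrightarrow> \<phi> x p = (\<Sum>(a, v)\<leftarrow>xs. a x * v p)"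
  shows "\<phi> \<in> tensor_maps X S (H0 w :: ('k, _) gmodule)"
proof -
  interpret module base_field "H0 w :: ('k, _) gmodule" by (rule H0_module)
  have av: "fst (xs ! i) \<in> S \<and> snd (xs ! i) \<in> carrier (H0 w)" if "i < length xs" for i
    using xs[of "fst (xs ! i)" "snd (xs ! i)"] that by simp
  have cl: "(\<Oplus>\<^bsub>H0 w\<^esub>i\<in>{..<length xs}. fst (xs ! i) x \<odot>\<^bsub>H0 w\<^esub> snd (xs ! i)) \<in> carrier (H0 w)" for x
    using av by (auto intro!: finsum_closed)
  have "\<phi> x = (\<Oplus>\<^bsub>H0 w\<^esub>i\<in>{..<length xs}. fst (xs ! i) x \<odot>\<^bsub>H0 w\<^esub> snd (xs ! i))" if x: "x \<in> X" for x
  proof (rule extensionalityI[OF H0_extensional[OF \<phi>(2)[OF x]] H0_extensional[OF cl]])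
    fix p assume p: "p \<in> carrier (Sp4 :: 'k mat4 monoid)"
    have "\<phi> x p = (\<Sum>i<length xs. fst (xs ! i) x * snd (xs ! i) p)"
      unfolding \<phi>(3)[OF x p] by (simp add: sum_list_sum_nth atLeast0LessThan case_prod_unfold)
    also have "\<dots> = (\<Oplus>\<^bsub>H0 w\<^esub>i\<in>{..<length xs}. fst (xs ! i) x \<odot>\<^bsub>H0 w\<^esub> snd (xs ! i)) p"
      using av p by (subst H0_finsum) (simp_all add: smult_closed, simp add: H0_simps(2-))
    finally show "\<phi> x p = (\<Oplus>\<^bsub>H0 w\<^esub>i\<in>{..<length xs}. fst (xs ! i) x \<odot>\<^bsub>H0 w\<^esub> snd (xs ! i)) p" .
  qed
  then have "\<phi> = (\<lambda>x\<in>X. \<Oplus>\<^bsub>H0 w\<^esub>i\<in>{..<length xs}. fst (xs ! i) x \<odot>\<^bsub>H0 w\<^esub> snd (xs ! i))"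
    using \<phi>(1) by (auto simp: extensional_def restrict_def)
  then show ?thesis unfolding tensor_maps_def using av
    by (intro CollectI exI[of _ "length xs"] exI[of _ "\<lambda>i. fst (xs ! i)"] exI[of _ "\<lambda>i. snd (xs ! i)"] conjI) auto
qed

subsection \<open>The natural module\<close>

lemma vfun_carrier [simp, intro]: "vfun c \<in> carrier (H0 \<omega>\<^sub>1)"
  by (simp add: H0_omega1)

lemma vfun_inj: "vfun c = vfun d \<longleftrightarrow> c = d"
  by (metis vfun_pt vec_eq_iff)

lemma vfun_add: "add (H0 w) (vfun c) (vfun d) = vfun (c + d)"
  by (auto simp: H0_simps(2-) vfun_def distrib_right sum.distrib intro!: restrict_ext)

lemma vfun_smult: "smult (H0 w) a (vfun c) = vfun (a *s c)"
  by (auto simp: H0_simps(2-) vfun_def sum_distrib_left mult.assoc intro!: restrict_ext)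

lemma vfun_zero: "zero (H0 w) = vfun 0"
  by (auto simp: H0_simps(2-) vfun_def intro!: restrict_ext)

text \<open>Inversion reflects in the antidiagonal, and \<open>opp\<close> reflects the indices
  back, so the coefficients transform by \<open>x\<close> itself.\<close>

lemma vfun_act:
  assumes x: "x \<in> carrier Sp4" shows "act (H0 w) x (vfun c) = vfun (x *v c)"
proof -
  have "(\<Sum>i\<in>UNIV. c $ i * (sinv x ** g) $ opp i $ 4) = (\<Sum>i\<in>UNIV. (x *v c) $ i * g $ opp i $ 4)" for g
    by (simp add: sum_4 mult4 sinv_nth matrix_vector_mult_def algebra_simps)
  then show ?thesis using x by (auto simp: H0_simps(2-) Sp4_inv vfun_def intro!: restrict_ext)
qed

lemma H0_omega1_gmodule: "is_gmodule (H0 \<omega>\<^sub>1 :: ('k, _) gmodule)"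
proof -
  have rational: "(\<lambda>g\<in>carrier Sp4. act (H0 \<omega>\<^sub>1) g (vfun c)) \<in> tensor_maps (carrier Sp4) (carrier coord_ring) (H0 \<omega>\<^sub>1)" for c
  proof (rule tensor_H0_I)
    let ?t = "\<lambda>i::4. (restrict (\<lambda>g. (g *v c) $ i) (carrier Sp4), vfun (axis i 1))"
    let ?xs = "[?t 1, ?t 2, ?t 3, ?t 4]"
    have "(\<lambda>g. (g *v c) $ i) \<in> poly_funs" for i
      unfolding matrix_vector_mult_def by (simp, intro poly_funs_sum pf)
    then show "a \<in> carrier coord_ring \<and> v \<in> carrier (H0 \<omega>\<^sub>1)" if "(a, v) \<in> set ?xs" for a v
      using that by auto
    show "(\<lambda>g\<in>carrier Sp4. act (H0 \<omega>\<^sub>1) g (vfun c)) x p = (\<Sum>(a, v)\<leftarrow>?xs. a x * v p)"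
      if "x \<in> carrier Sp4" "p \<in> carrier Sp4" for x p
      using that by (simp add: vfun_act) (simp add: vfun_def sum_4 axis_def)
  qed (auto simp: vfun_act)
  show ?thesis
    unfolding is_gmodule_def
    using rational
    by (auto simp: H0_module H0_omega1 vfun_act vfun_add vfun_smult matrix_vector_right_distrib
        vector_scalar_commute matrix_vector_mul_assoc)
qed

lemma vfun_sum_axis: "c = c $ 1 *s axis 1 1 + c $ 2 *s axis 2 1 + c $ 3 *s axis 3 1 + c $ 4 *s (axis 4 1 :: 'k ^ 4)"
  by (simp add: vec_eq_iff forall_4 axis_def)

text \<open>A long root element minus the identity has rank one and isolates a coordinate of
  \<open>c\<close> on one axis; the reflections then carry that axis to all others.\<close>

lemma invariant_subspace:
  fixes C :: "('k ^ 4) set"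
  assumes add: "\<And>c d. c \<in> C \<Longrightarrow> d \<in> C \<Longrightarrow> c + d \<in> C" and scale: "\<And>a c. c \<in> C \<Longrightarrow> a *s c \<in> C"
    and act: "\<And>g c. g \<in> carrier Sp4 \<Longrightarrow> c \<in> C \<Longrightarrow> g *v c \<in> C"
    and c: "c \<in> C" "c \<noteq> 0"
  shows "C = UNIV"
proof -
  have w: "w1 *v d \<in> C" "w2 *v d \<in> C" if "d \<in> C" for d
    using that act gen_Sp4 w_gen by blast+
  have wax: "w1 *v axis 1 1 = axis 2 1" "w1 *v axis 2 1 = axis 1 1" "w1 *v axis 3 1 = axis 4 1" "w1 *v axis 4 1 = axis 3 1"
    "w2 *v axis 2 1 = axis 3 1" "w2 *v axis 3 1 = axis 2 1"
    by (simp_all add: vec_eq_iff forall_4 matrix_vector_mult_def sum_4 w1_def w2_def axis_def)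
  have root: "c + x11 1 *v c = c $ 4 *s axis 1 1" "c + x2 1 *v c = c $ 3 *s axis 2 1"
    "c + y2 1 *v c = c $ 2 *s axis 3 1" "c + y11 1 *v c = c $ 1 *s axis 4 1"
    by (simp_all add: vec_eq_iff forall_4 matrix_vector_mult_def sum_4 root_defs root_defs' axis_def)
  have "c $ 4 *s axis 1 1 \<in> C" "c $ 3 *s axis 2 1 \<in> C" "c $ 2 *s axis 3 1 \<in> C" "c $ 1 *s axis 4 1 \<in> C"
    unfolding root[symmetric] by (intro add c(1) act gen_Sp4 root_gen' gen_roots)+
  moreover have inv: "d \<in> C" if "a *s d \<in> C" "a \<noteq> 0" for a d
    using scale[OF that(1), of "inverse a"] that(2) by simp
  moreover obtain i where "c $ i \<noteq> 0" using c(2) by (auto simp: vec_eq_iff)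
  ultimately have "axis 1 1 \<in> C \<or> axis 2 1 \<in> C \<or> axis 3 1 \<in> C \<or> axis 4 1 \<in> C"
    using exhaust_4[of i] by metis
  then have "axis 2 1 \<in> C \<or> axis 3 1 \<in> C" using w(1) wax(1,4) by metis
  then have 23: "axis 2 1 \<in> C" "axis 3 1 \<in> C" using w(2) wax(5,6) by metis+
  then have 14: "axis 1 1 \<in> C" "axis 4 1 \<in> C" using w(1) wax(2,3) by metis+
  have "d \<in> C" for d by (subst vfun_sum_axis) (intro add scale 23 14)
  then show ?thesis by blast
qed

lemma H0_omega1_simple: "simple_gmodule (H0 \<omega>\<^sub>1 :: ('k, _) gmodule)"
  unfolding simple_gmodule_def
proof (intro conjI allI impI)
  show "is_gmodule (H0 \<omega>\<^sub>1 :: ('k, _) gmodule)" by (rule H0_omega1_gmodule)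
  have "(axis 1 1 :: 'k ^ 4) \<noteq> 0" by (simp add: axis_eq_0_iff)
  then have "vfun (axis 1 1) \<noteq> \<zero>\<^bsub>H0 \<omega>\<^sub>1\<^esub>" by (simp add: vfun_zero vfun_inj)
  then show "carrier (H0 \<omega>\<^sub>1) \<noteq> {\<zero>\<^bsub>H0 \<omega>\<^sub>1\<^esub> :: 'k mat4 \<Rightarrow> 'k}" using vfun_carrier by blast
next
  fix N assume N: "gsubmodule N (H0 \<omega>\<^sub>1 :: ('k, _) gmodule)"
  then interpret submodule N base_field "H0 \<omega>\<^sub>1 :: ('k, _) gmodule" by (simp add: gsubmodule_def)
  have sub: "N \<subseteq> range vfun" using subset by (simp add: H0_omega1)
  show "N = {\<zero>\<^bsub>H0 \<omega>\<^sub>1\<^esub>} \<or> N = carrier (H0 \<omega>\<^sub>1)"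
  proof (cases "N = {\<zero>\<^bsub>H0 \<omega>\<^sub>1\<^esub>}")
    case False
    moreover have "\<zero>\<^bsub>H0 \<omega>\<^sub>1\<^esub> \<in> N" using one_closed by simp
    ultimately obtain x where x: "x \<in> N" "x \<noteq> \<zero>\<^bsub>H0 \<omega>\<^sub>1\<^esub>" by blast
    then obtain c where "x = vfun c" using sub by blast
    then have c: "vfun c \<in> N" "c \<noteq> 0" using x by (auto simp: vfun_zero)
    have "{c. vfun c \<in> N} = UNIV"
    proof (rule invariant_subspace[where c = c])
      show "c + d \<in> {c. vfun c \<in> N}" if "c \<in> {c. vfun c \<in> N}" "d \<in> {c. vfun c \<in> N}" for c d
        using m_closed[of "vfun c" "vfun d"] that by (simp add: vfun_add)
      show "a *s c \<in> {c. vfun c \<in> N}" if "c \<in> {c. vfun c \<in> N}" for a c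
        using smult_closed[of a "vfun c"] that by (simp add: vfun_smult)
      show "g *v c \<in> {c. vfun c \<in> N}" if "g \<in> carrier Sp4" "c \<in> {c. vfun c \<in> N}" for g c
        using N that unfolding gsubmodule_def by (metis (mono_tags) mem_Collect_eq vfun_act)
    qed (use c in auto)
    then show ?thesis using sub by (auto simp: H0_omega1)
  qed simp
qed

lemma powi_exponent_unique:
  assumes "\<And>t::'k. t \<noteq> 0 \<Longrightarrow> t powi a = t powi b"
  shows "a = b"
proof -
  have *: "a \<le> b" if "\<And>t::'k. t \<noteq> 0 \<Longrightarrow> t powi a = t powi b" for a b :: int
  proof (rule ccontr)
    assume ab: "\<not> a \<le> b"
    define m where "m = nat (a - b)"
    have m: "m > 0" "int m = a - b" using ab by (auto simp: m_def)
    have "t ^ m = 1" if "t \<noteq> 0" for t :: 'k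
    proof -
      have "t powi (int m) = t powi a / t powi b" unfolding m(2) using that by (simp add: power_int_diff)
      then show ?thesis using \<open>\<And>t::'k. t \<noteq> 0 \<Longrightarrow> t powi a = t powi b\<close>[OF that] that by simp
    qed
    then have "monom 1 m = (1 :: 'k poly)" by (intro poly_eqI_nonzero) (simp add: poly_monom)
    then have "degree (monom (1::'k) m) = 0" by simp
    then show False using m(1) by (simp add: degree_monom_eq)
  qed
  show ?thesis using *[of a b] *[of b a] assms by force
qed

lemma torus_dg: "s \<noteq> 0 \<Longrightarrow> t \<noteq> 0 \<Longrightarrow> dg s t \<in> torus"
  using dg_Sp4[of s t] by (simp add: torus_def dg_def forall_4)

lemma H0_omega1_weights:
  assumes "is_weight v (H0 \<omega>\<^sub>1 :: ('k, _) gmodule)"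
  shows "weight_le v \<omega>\<^sub>1"
proof -
  obtain a b where v: "v = (a, b)" by fastforce
  obtain c where c: "c \<noteq> 0" and "\<And>t. t \<in> torus \<Longrightarrow> act (H0 \<omega>\<^sub>1) t (vfun c) = weight_char v t \<odot>\<^bsub>H0 \<omega>\<^sub>1\<^esub> vfun (c :: 'k ^ 4)"
    using assms unfolding is_weight_def H0_omega1 vfun_zero by (metis rangeE)
  then have wt: "t *v c = weight_char v t *s c" if "t \<in> torus" for t
    using that by (simp add: vfun_act vfun_smult vfun_inj torus_def)
  obtain i where i: "c $ i \<noteq> 0" using c by (auto simp: vec_eq_iff)
  have "(dg s t *v c) $ i = dg s t $ i $ i * c $ i" for s t
    using exhaust_4[of i] by (elim disjE) (simp_all add: matrix_vector_mult_def sum_4 dg_def)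
  then have eq: "dg s t $ i $ i = s powi a * (s * t) powi b" if "s \<noteq> 0" "t \<noteq> 0" for s t
    using wt[OF torus_dg[OF that]] i by (simp add: vec_eq_iff weight_char_def v dg_def) (metis mult_cancel_right)
  have A: "dg 1 t $ i $ i = t powi b" if "t \<noteq> 0" for t using eq[of 1 t] that by simp
  have B: "dg s 1 $ i $ i = s powi (a + b)" if "s \<noteq> 0" for s using eq[of s 1] that by (simp add: power_int_add)
  \<comment> \<open>The weights of the natural module, \<open>\<epsilon>\<^sub>1\<close>,
    \<open>\<epsilon>\<^sub>2\<close> and their negatives, in fundamental coordinates.\<close>
  have "v \<in> {(1, 0), (-1, 1), (1, -1), (-1, 0)}"
  proof -
    consider "i = 1" | "i = 2" | "i = 3" | "i = 4" using exhaust_4[of i] by blast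
    then show ?thesis
    proof cases
      case 1
      have "b = 0" by (rule powi_exponent_unique) (use A 1 in \<open>simp add: dg_def\<close>)
      moreover have "a + b = 1" by (rule powi_exponent_unique) (use B 1 in \<open>simp add: dg_def\<close>)
      ultimately show ?thesis by (simp add: v)
    next
      case 2
      have "b = 1" by (rule powi_exponent_unique) (use A 2 in \<open>simp add: dg_def\<close>)
      moreover have "a + b = 0" by (rule powi_exponent_unique) (use B 2 in \<open>simp add: dg_def\<close>)
      ultimately show ?thesis by (simp add: v)
    next
      case 3
      have "b = - 1" by (rule powi_exponent_unique) (use A 3 in \<open>simp add: dg_def power_int_minus\<close>)
      moreover have "a + b = 0" by (rule powi_exponent_unique) (use B 3 in \<open>simp add: dg_def\<close>)
      ultimately show ?thesis by (simp add: v)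
    next
      case 4
      have "b = 0" by (rule powi_exponent_unique) (use A 4 in \<open>simp add: dg_def\<close>)
      moreover have "a + b = - 1" by (rule powi_exponent_unique) (use B 4 in \<open>simp add: dg_def power_int_minus\<close>)
      ultimately show ?thesis by (simp add: v)
    qed
  qed
  \<comment> \<open>The differences from \<open>\<omega>\<^sub>1\<close> are 0,
    \<open>\<alpha>\<^sub>1\<close>, \<open>\<alpha>\<^sub>1 + \<alpha>\<^sub>2\<close> and
    \<open>2\<alpha>\<^sub>1 + \<alpha>\<^sub>2\<close>.\<close>
  moreover have "weight_le (1, 0) \<omega>\<^sub>1" "weight_le (-1, 1) \<omega>\<^sub>1" "weight_le (1, -1) \<omega>\<^sub>1" "weight_le (-1, 0) \<omega>\<^sub>1"
    unfolding weight_le_def \<omega>\<^sub>1_def \<alpha>\<^sub>1_def \<alpha>\<^sub>2_def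
    by (rule exI[of _ 0], rule exI[of _ 0], simp) (rule exI[of _ 1], rule exI[of _ 0], simp,
      rule exI[of _ 1], rule exI[of _ 1], simp, rule exI[of _ 2], rule exI[of _ 1], simp)
  ultimately show ?thesis by auto
qed

lemma H0_omega1_is_L: "is_L \<omega>\<^sub>1 (H0 \<omega>\<^sub>1 :: ('k, _) gmodule)"
proof -
  have "act (H0 \<omega>\<^sub>1) t (vfun (axis 1 1)) = weight_char \<omega>\<^sub>1 t \<odot>\<^bsub>H0 \<omega>\<^sub>1\<^esub> vfun (axis 1 1)" if "t \<in> torus" for t :: "'k mat4"
  proof -
    have "t \<in> carrier Sp4" "t *v axis 1 1 = t $ 1 $ 1 *s axis 1 1"
      using that by (auto simp: torus_def vec_eq_iff forall_4 matrix_vector_mult_def sum_4 axis_def)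
    then show ?thesis by (simp add: vfun_act vfun_smult weight_char_def \<omega>\<^sub>1_def)
  qed
  moreover have "vfun (axis 1 1) \<noteq> \<zero>\<^bsub>H0 \<omega>\<^sub>1\<^esub>" by (simp add: vfun_zero vfun_inj axis_eq_0_iff)
  ultimately have "is_weight \<omega>\<^sub>1 (H0 \<omega>\<^sub>1 :: ('k, _) gmodule)" unfolding is_weight_def using vfun_carrier by blast
  then show ?thesis by (simp add: is_L_def H0_omega1_simple H0_omega1_weights)
qed

end

section \<open>The first cohomology group\<close>

lemma zero_gmodule_gmodule: "is_gmodule (zero_gmodule :: ('k::field, unit) gmodule)"
proof -
  have ag: "abelian_group (zero_gmodule :: ('k, unit) gmodule)"
    by (rule abelian_groupI) (auto simp: zero_gmodule_def)
  have "Module.module base_field (zero_gmodule :: ('k, unit) gmodule)"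
    by (rule moduleI[OF base_field_cring ag]) (auto simp: zero_gmodule_def)
  moreover have "(\<lambda>g\<in>carrier Sp4. act zero_gmodule g v) \<in> tensor_maps (carrier Sp4) (carrier coord_ring) (zero_gmodule :: ('k, unit) gmodule)" for v
    unfolding tensor_maps_def by (intro CollectI exI[of _ "0::nat"] exI) auto
  ultimately show ?thesis by (auto simp: is_gmodule_def zero_gmodule_def)
qed

section \<open>Functions of two variables modulo the kernel, and cochains in coordinates\<close>

context char2
begin

inductive_set ptens :: "('k mat4 \<Rightarrow> 'k mat4 \<Rightarrow> 'k) set" where
  prod: "a \<in> poly_funs \<Longrightarrow> b \<in> poly_funs \<Longrightarrow> (\<lambda>g h. a g * b h) \<in> ptens"
| add: "U \<in> ptens \<Longrightarrow> V \<in> ptens \<Longrightarrow> (\<lambda>g h. U g h + V g h) \<in> ptens"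

text \<open>Lifts of the ideal of the product of two kernels. The rule \<open>cong\<close> admits
  any change off \<open>Sp4\<close>, where values are irrelevant.\<close>

inductive_set ktens :: "('k mat4 \<Rightarrow> 'k mat4 \<Rightarrow> 'k) set" where
  prod: "a \<in> poly_funs \<Longrightarrow> b \<in> poly_funs \<Longrightarrow> a \<in> kid \<or> b \<in> kid \<Longrightarrow> (\<lambda>g h. a g * b h) \<in> ktens"
| add: "U \<in> ktens \<Longrightarrow> V \<in> ktens \<Longrightarrow> (\<lambda>g h. U g h + V g h) \<in> ktens"
| cong: "U \<in> ktens \<Longrightarrow> (\<And>g h. g \<in> carrier Sp4 \<Longrightarrow> h \<in> carrier Sp4 \<Longrightarrow> V g h = U g h) \<Longrightarrow> V \<in> ktens"

lemma ptens_mult: "U \<in> ptens \<Longrightarrow> V \<in> ptens \<Longrightarrow> (\<lambda>g h. U g h * V g h) \<in> ptens"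
proof (induction U rule: ptens.induct)
  case (prod a b)
  from prod(3) show ?case
  proof (induction V rule: ptens.induct)
    case (prod a' b')
    then show ?case
      using ptens.prod[of "\<lambda>g. a g * a' g" "\<lambda>h. b h * b' h"] prod.hyps \<open>a \<in> poly_funs\<close> \<open>b \<in> poly_funs\<close>
      by (simp add: pf mult_ac)
  next
    case (add U V)
    then show ?case using ptens.add[OF add.IH] by (simp add: distrib_left)
  qed
next
  case (add U U')
  then show ?case using ptens.add[OF add.IH] by (simp add: distrib_right)
qed

lemma comult_ptens: "f \<in> poly_funs \<Longrightarrow> (\<lambda>g h. f (g ** h)) \<in> ptens"
proof (induction rule: poly_funs.induct)
  case (const c)
  show ?case using ptens.prod[OF pf(1)[of c] pf(1)[of 1]] by simp
next
  case (entry i j)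
  have p: "(\<lambda>g h. g $ i $ l * h $ l $ j) \<in> ptens" for l by (rule ptens.prod) (rule pf)+
  show ?case unfolding mult4 by (rule ptens.add[OF ptens.add[OF ptens.add[OF p p] p] p])
qed (auto intro: ptens.add ptens_mult)

lemma ktens_mult: "U \<in> ptens \<Longrightarrow> V \<in> ktens \<Longrightarrow> (\<lambda>g h. U g h * V g h) \<in> ktens"
proof (induction U rule: ptens.induct)
  case (prod a b)
  from prod(3) show ?case
  proof (induction V rule: ktens.induct)
    case (prod a' b')
    then have "(\<lambda>g. a g * a' g) \<in> kid \<or> (\<lambda>h. b h * b' h) \<in> kid"
      using \<open>a \<in> poly_funs\<close> \<open>b \<in> poly_funs\<close> kid_mult by blast
    then show ?case
      using ktens.prod[of "\<lambda>g. a g * a' g" "\<lambda>h. b h * b' h"] prod.hyps \<open>a \<in> poly_funs\<close> \<open>b \<in> poly_funs\<close>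
      by (simp add: pf mult_ac)
  next
    case (add U V)
    then show ?case using ktens.add[OF add.IH] by (simp add: distrib_left)
  next
    case (cong U V)
    then show ?case using ktens.cong[OF cong.IH] by simp
  qed
next
  case (add U U')
  from ktens.add[OF add.IH(1)[OF add.prems] add.IH(2)[OF add.prems]] show ?case by (simp add: distrib_right)
qed

lemma ktens_zero: "(\<lambda>g h. 0) \<in> ktens"
  using ktens.prod[OF pf(1) pf(1), of 0 0] kid_zero by simp

lemma ktens_sum: "(\<And>i. i \<in> I \<Longrightarrow> U i \<in> ktens) \<Longrightarrow> (\<lambda>g h. \<Sum>i\<in>I. U i g h) \<in> ktens"
  by (induction I rule: infinite_finite_induct) (auto intro: ktens_zero ktens.add)

lemma ktens_left: "k \<in> kid \<Longrightarrow> (\<lambda>g h. k g) \<in> ktens"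
  and ktens_right: "k \<in> kid \<Longrightarrow> (\<lambda>g h. k h) \<in> ktens"
  using ktens.prod[of k "\<lambda>_. 1"] ktens.prod[of "\<lambda>_. 1" k] by (auto simp: kid_poly pf)

text \<open>The kernel is a subgroup scheme, so its ideal is a coideal.\<close>

lemma comult_ktens: "k \<in> kid \<Longrightarrow> (\<lambda>g h. k (g ** h)) \<in> ktens"
proof (induction rule: kid.induct)
  case (vanish f)
  then show ?case by (intro ktens.cong[OF ktens_zero]) auto
next
  case (minor f i j)
  \<comment> \<open>On \<open>Sp4\<close> the entry of \<open>minors (g ** h) - 1\<close> splits as
    that of \<open>(minors g - 1) ** minors h\<close> plus that of
    \<open>minors h - 1\<close>.\<close>
  have "(\<lambda>g h. (\<Sum>l\<in>UNIV. (minors g $ i $ l + mat 1 $ i $ l) * minors h $ l $ j) + (minors h $ i $ j + mat 1 $ i $ j)) \<in> ktens"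
    by (intro ktens.add ktens_sum ktens.prod disjI1 kid_minors pf minors_in_poly_funs ktens_right)
  from ktens_mult[OF comult_ptens[OF minor] this] show ?case
  proof (rule ktens.cong)
    fix g h assume gh: "g \<in> carrier (Sp4 :: 'k mat4 monoid)" "h \<in> carrier (Sp4 :: 'k mat4 monoid)"
    have "(\<Sum>l\<in>UNIV. mat 1 $ i $ l * minors h $ l $ j) = minors h $ i $ j"
      using exhaust_4[of i] by (elim disjE) (simp_all add: sum_4 mat_nth)
    then show "f (g ** h) * (minors (g ** h) $ i $ j + mat 1 $ i $ j) = f (g ** h) *
        ((\<Sum>l\<in>UNIV. (minors g $ i $ l + mat 1 $ i $ l) * minors h $ l $ j) + (minors h $ i $ j + mat 1 $ i $ j))"
      using gh by (simp add: minors_mult matrix_mult_nth distrib_right sum.distrib add.assoc)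
  qed
qed (rule ktens.add)

text \<open>An explicit finite sum of products, as \<open>tensor_maps\<close> requires.\<close>

lemma ktens_list:
  "U \<in> ktens \<Longrightarrow> \<exists>xs. (\<forall>(a, b)\<in>set xs. a \<in> poly_funs \<and> b \<in> poly_funs \<and> (a \<in> kid \<or> b \<in> kid)) \<and>
    (\<forall>g\<in>carrier Sp4. \<forall>h\<in>carrier Sp4. U g h = (\<Sum>(a, b)\<leftarrow>xs. a g * b h))"
proof (induction rule: ktens.induct)
  case (prod a b)
  then show ?case by (intro exI[of _ "[(a, b)]"]) simp
next
  case (add U V)
  then obtain xs ys where
    "\<forall>(a, b)\<in>set xs. a \<in> poly_funs \<and> b \<in> poly_funs \<and> (a \<in> kid \<or> b \<in> kid)" "\<forall>g\<in>carrier Sp4. \<forall>h\<in>carrier Sp4. U g h = (\<Sum>(a, b)\<leftarrow>xs. a g * b h)"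
    "\<forall>(a, b)\<in>set ys. a \<in> poly_funs \<and> b \<in> poly_funs \<and> (a \<in> kid \<or> b \<in> kid)" "\<forall>g\<in>carrier Sp4. \<forall>h\<in>carrier Sp4. V g h = (\<Sum>(a, b)\<leftarrow>ys. a g * b h)"
    by blast
  then show ?case by (intro exI[of _ "xs @ ys"]) auto
next
  case (cong U V)
  then obtain xs where "\<forall>(a, b)\<in>set xs. a \<in> poly_funs \<and> b \<in> poly_funs \<and> (a \<in> kid \<or> b \<in> kid)"
    "\<forall>g\<in>carrier Sp4. \<forall>h\<in>carrier Sp4. U g h = (\<Sum>(a, b)\<leftarrow>xs. a g * b h)" by blast
  then show ?case using cong.hyps by (intro exI[of _ xs]) simp
qed

text \<open>The set \<open>K\<close> stands for \<open>poly_funs\<close> or \<open>kid\<close>, so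
  that cochains and cochains with coefficients in the ideal are treated alike.\<close>

lemma cochain_coordinate:
  assumes K: "\<And>a c. a \<in> K \<Longrightarrow> (\<lambda>g. a g * c) \<in> K" "\<And>(n::nat) a. (\<And>i. i < n \<Longrightarrow> a i \<in> K) \<Longrightarrow> (\<lambda>g. \<Sum>i<n. a i g) \<in> K"
    and \<phi>: "\<phi> \<in> tensor_maps (carrier Sp4) ((\<lambda>f. restrict f (carrier Sp4)) ` K) (H0 w :: ('k, _) gmodule)"
    and p: "p \<in> carrier Sp4"
  shows "\<exists>u\<in>K. \<forall>g\<in>carrier Sp4. \<phi> g p = u g"
proof -
  obtain n a v where a: "\<And>i. i < (n::nat) \<Longrightarrow> a i \<in> (\<lambda>f. restrict f (carrier Sp4)) ` K"
    and "\<And>i. i < n \<Longrightarrow> v i \<in> carrier (H0 w)" and "\<And>x. x \<in> carrier Sp4 \<Longrightarrow> \<phi> x \<in> carrier (H0 w)"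
    and eq: "\<And>x p. x \<in> carrier Sp4 \<Longrightarrow> p \<in> carrier Sp4 \<Longrightarrow> \<phi> x p = (\<Sum>i<n. a i x * v i p)"
    and "\<phi> \<in> extensional (carrier Sp4)"
    by (rule tensor_H0_E[OF \<phi>], rule that)
  have "\<forall>i. \<exists>b. i < n \<longrightarrow> b \<in> K \<and> a i = restrict b (carrier Sp4)" using a by blast
  then obtain b where b: "\<And>i. i < n \<Longrightarrow> b i \<in> K \<and> a i = restrict (b i) (carrier Sp4)" by metis
  show ?thesis
  proof (intro bexI ballI)
    show "(\<lambda>g. \<Sum>i<n. b i g * v i p) \<in> K" using b by (intro K) auto
    show "\<phi> g p = (\<Sum>i<n. b i g * v i p)" if "g \<in> carrier Sp4" for g
      unfolding eq[OF that p] by (rule sum.cong) (use b that in auto)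
  qed
qed

lemma poly_cochain: "(\<lambda>g. a g * c) \<in> poly_funs" if "a \<in> poly_funs" for a c
  using that by (intro pf)

lemma kid_cochain: "(\<lambda>g. a g * c) \<in> kid" if "a \<in> kid" for a c
  using that by (intro kid_mult' pf)

definition lift0 :: "('k mat4 \<Rightarrow> 'k) \<Rightarrow> 'k mat4 \<Rightarrow> 'k mat4 \<Rightarrow> 'k" where
  "lift0 u = (\<lambda>g\<in>carrier Sp4. cfun (u g))"

definition lift1 :: "('k mat4 \<Rightarrow> 'k ^ 4) \<Rightarrow> 'k mat4 \<Rightarrow> 'k mat4 \<Rightarrow> 'k" where
  "lift1 u = (\<lambda>g\<in>carrier Sp4. vfun (u g))"

lemma cfun_carrier [simp, intro]: "cfun c \<in> carrier (H0 0)"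
  by (simp add: H0_zero)

lemma lift1_cong: "(\<And>g. g \<in> carrier Sp4 \<Longrightarrow> u g = u' g) \<Longrightarrow> lift1 u = lift1 u'"
  by (auto simp: lift1_def intro!: restrict_ext)

lemma tensor_maps_H0_zero:
  assumes K: "\<And>a c. a \<in> K \<Longrightarrow> (\<lambda>g. a g * c) \<in> K" "\<And>(n::nat) a. (\<And>i. i < n \<Longrightarrow> a i \<in> K) \<Longrightarrow> (\<lambda>g. \<Sum>i<n. a i g) \<in> K"
  shows "tensor_maps (carrier Sp4) ((\<lambda>f. restrict f (carrier Sp4)) ` K) (H0 0 :: ('k, _) gmodule) = lift0 ` K"
proof (intro equalityI subsetI)
  fix \<phi> assume \<phi>: "\<phi> \<in> tensor_maps (carrier Sp4) ((\<lambda>f. restrict f (carrier Sp4)) ` K) (H0 0 :: ('k, _) gmodule)"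
  then obtain u where u: "u \<in> K" "\<And>g. g \<in> carrier Sp4 \<Longrightarrow> \<phi> g (mat 1) = u g"
    using cochain_coordinate[OF K \<phi> Sp4_one] by blast
  have ext: "\<phi> \<in> extensional (carrier Sp4)" and car: "\<And>g. g \<in> carrier Sp4 \<Longrightarrow> \<phi> g \<in> carrier (H0 0)"
    using tensor_H0D[OF \<phi>] by blast+
  have "\<phi> g = cfun (u g)" if "g \<in> carrier Sp4" for g
    using car[OF that] u(2)[OF that] by (auto simp: H0_zero cfun_def)
  then have "\<phi> = lift0 u" using ext by (auto simp: lift0_def extensional_def restrict_def)
  then show "\<phi> \<in> lift0 ` K" using u(1) by blast
next
  fix \<phi> assume "\<phi> \<in> lift0 ` K"
  then obtain u where u: "u \<in> K" "\<phi> = lift0 u" by blast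
  show "\<phi> \<in> tensor_maps (carrier Sp4) ((\<lambda>f. restrict f (carrier Sp4)) ` K) (H0 0 :: ('k, _) gmodule)"
    by (rule tensor_H0_I[where xs = "[(restrict u (carrier Sp4), cfun 1)]"])
       (use u in \<open>auto simp: lift0_def, simp add: cfun_def\<close>)
qed

lemma tensor_maps_H0_omega1:
  assumes K: "\<And>a c. a \<in> K \<Longrightarrow> (\<lambda>g. a g * c) \<in> K" "\<And>(n::nat) a. (\<And>i. i < n \<Longrightarrow> a i \<in> K) \<Longrightarrow> (\<lambda>g. \<Sum>i<n. a i g) \<in> K"
  shows "tensor_maps (carrier Sp4) ((\<lambda>f. restrict f (carrier Sp4)) ` K) (H0 \<omega>\<^sub>1 :: ('k, _) gmodule) =
    lift1 ` {u. \<forall>i. (\<lambda>g. u g $ i) \<in> K}"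
proof (intro equalityI subsetI)
  fix \<phi> assume \<phi>: "\<phi> \<in> tensor_maps (carrier Sp4) ((\<lambda>f. restrict f (carrier Sp4)) ` K) (H0 \<omega>\<^sub>1 :: ('k, _) gmodule)"
  have "\<forall>i. \<exists>u\<in>K. \<forall>g\<in>carrier Sp4. \<phi> g (pt i) = u g"
    using cochain_coordinate[OF K \<phi> pt_Sp4] by blast
  then obtain u where u: "\<And>i. u i \<in> K" "\<And>i g. g \<in> carrier Sp4 \<Longrightarrow> \<phi> g (pt i) = u i g" by metis
  have ext: "\<phi> \<in> extensional (carrier Sp4)" and car: "\<And>g. g \<in> carrier Sp4 \<Longrightarrow> \<phi> g \<in> carrier (H0 \<omega>\<^sub>1)"
    using tensor_H0D[OF \<phi>] by blast+
  have "\<phi> g = vfun (\<chi> i. u i g)" if g: "g \<in> carrier Sp4" for g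
  proof -
    obtain c where c: "\<phi> g = vfun c" using car[OF g] by (auto simp: H0_omega1)
    then have "c = (\<chi> i. u i g)" using u(2)[OF g] by (simp add: vec_eq_iff)
    then show ?thesis using c by simp
  qed
  then have "\<phi> = lift1 (\<lambda>g. \<chi> i. u i g)" using ext by (auto simp: lift1_def extensional_def restrict_def)
  then show "\<phi> \<in> lift1 ` {u. \<forall>i. (\<lambda>g. u g $ i) \<in> K}" using u(1) by auto
next
  fix \<phi> assume "\<phi> \<in> lift1 ` {u. \<forall>i. (\<lambda>g. u g $ i) \<in> K}"
  then obtain u where u: "\<And>i. (\<lambda>g. u g $ i) \<in> K" "\<phi> = lift1 u" by blast
  let ?t = "\<lambda>i::4. (restrict (\<lambda>g. u g $ i) (carrier Sp4), vfun (axis i 1))"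
  show "\<phi> \<in> tensor_maps (carrier Sp4) ((\<lambda>f. restrict f (carrier Sp4)) ` K) (H0 \<omega>\<^sub>1 :: ('k, _) gmodule)"
  proof (rule tensor_H0_I[where xs = "[?t 1, ?t 2, ?t 3, ?t 4]"])
    show "\<phi> x p = (\<Sum>(a, v)\<leftarrow>[?t 1, ?t 2, ?t 3, ?t 4]. a x * v p)" if "x \<in> carrier Sp4" "p \<in> carrier Sp4" for x p
      using that by (simp add: u(2) lift1_def) (simp add: vfun_def sum_4 axis_def)
  qed (use u in \<open>auto simp: lift1_def\<close>)
qed

lemma carrier_coord_ring: "carrier coord_ring = (\<lambda>f. restrict f (carrier Sp4)) ` poly_funs"
  by (simp add: coord_ring_def)

lemmas K_poly = poly_cochain poly_funs_sum[where I = "{..<n::nat}" for n, simplified]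
lemmas K_kid = kid_cochain kid_sum[where A = "{..<n::nat}" for n, simplified]

lemma cochains_H0_zero: "carrier (cochains1 (H0 0 :: ('k, _) gmodule)) = lift0 ` poly_funs"
  using tensor_maps_H0_zero[of poly_funs, OF K_poly] by (simp add: cochains1_def carrier_coord_ring)

lemma cochains_H0_omega1:
  "carrier (cochains1 (H0 \<omega>\<^sub>1 :: ('k, _) gmodule)) = lift1 ` {u. \<forall>i. (\<lambda>g. u g $ i) \<in> poly_funs}"
  using tensor_maps_H0_omega1[of poly_funs, OF K_poly] by (simp add: cochains1_def carrier_coord_ring)

lemma cfun_ops:
  "add (H0 w) (cfun c) (cfun d) = cfun (c + d)" "smult (H0 w) a (cfun c) = cfun (a * c)"
  "zero (H0 w) = cfun 0" "x \<in> carrier Sp4 \<Longrightarrow> act (H0 w) x (cfun c) = cfun c"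
  by (auto simp: H0_simps(2-) cfun_def Sp4_inv intro!: restrict_ext)

lemma diff1_lift0:
  "diff1 (H0 0) (lift0 u) = (\<lambda>(g, h)\<in>carrier Sp4 \<times> carrier Sp4. cfun (u h + u (g ** h) + u g))"
  unfolding diff1_def
  by (rule restrict_ext) (auto simp: lift0_def a_minus_def H0_minus cfun_ops)

lemma diff1_lift1:
  "diff1 (H0 \<omega>\<^sub>1) (lift1 u) = (\<lambda>(g, h)\<in>carrier Sp4 \<times> carrier Sp4. vfun (g *v u h + u (g ** h) + u g))"
  unfolding diff1_def
  by (rule restrict_ext) (auto simp: lift1_def a_minus_def H0_minus vfun_add vfun_act)

lemma lift0_ops:
  "add (cochains1 (H0 0)) (lift0 u) (lift0 u') = lift0 (\<lambda>g. u g + u' g)"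
  "smult (cochains1 (H0 0)) a (lift0 u) = lift0 (\<lambda>g. a * u g)"
  "x \<in> carrier Sp4 \<Longrightarrow> act (cochains1 (H0 0)) x (lift0 u) = lift0 (\<lambda>g. u (sinv x ** g ** x))"
  by (auto simp: cochains1_def lift0_def cfun_ops Sp4_inv intro!: restrict_ext)

lemma lift1_ops:
  "add (cochains1 (H0 \<omega>\<^sub>1)) (lift1 u) (lift1 u') = lift1 (\<lambda>g. u g + u' g)"
  "smult (cochains1 (H0 \<omega>\<^sub>1)) a (lift1 u) = lift1 (\<lambda>g. a *s u g)"
  "x \<in> carrier Sp4 \<Longrightarrow> act (cochains1 (H0 \<omega>\<^sub>1)) x (lift1 u) = lift1 (\<lambda>g. x *v u (sinv x ** g ** x))"
  by (auto simp: cochains1_def lift1_def vfun_add vfun_smult vfun_act Sp4_inv intro!: restrict_ext)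

lemma frobenius_mult: "frobenius (A ** B) = frobenius A ** (frobenius B :: 'k mat4)"
proof -
  have *: "(x + y) ^ 2 = x ^ 2 + y ^ 2" for x y :: 'k by (simp add: power2_sum)
  show ?thesis by (simp add: vec_eq_iff frobenius_def mult4 * power_mult_distrib)
qed

text \<open>Take square roots entrywise. The result is symplectic because Frobenius is
  multiplicative, fixes \<open>symp_form\<close> and is injective.\<close>

lemma frobenius_surj:
  assumes g: "g \<in> carrier (Sp4 :: 'k mat4 monoid)"
  shows "\<exists>h\<in>carrier Sp4. frobenius h = g"
proof -
  define h :: "'k mat4" where "h = (\<chi> i j. SOME y. y ^ 2 = g $ i $ j)"
  have "h $ i $ j ^ 2 = g $ i $ j" for i j
    unfolding h_def by (simp, rule someI_ex[OF alg_closed_square_root])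
  then have h: "frobenius h = g" by (simp add: frobenius_def vec_eq_iff)
  have J: "frobenius symp_form = (symp_form :: 'k mat4)" by (simp add: frobenius_def vec_eq_iff forall_4)
  have t: "frobenius (transpose h) = transpose (frobenius h)" by (simp add: frobenius_def transpose_def vec_eq_iff)
  have "frobenius (transpose h ** symp_form ** h) = frobenius symp_form"
    using g by (simp add: frobenius_mult t h J Sp4_def)
  then have "transpose h ** symp_form ** h = symp_form" using frobenius_inj[OF CHAR2] by (simp add: inj_eq)
  then show ?thesis using h by (auto simp: Sp4_def)
qed

end

section \<open>Cocycles, coboundaries and the cohomology groups\<close>

context special
begin

text \<open>The square of the isogeny is Frobenius, which is surjective on points, so the isogeny is
  surjective too.\<close>

lemma tau_inv_into:
  assumes g: "g \<in> carrier Sp4"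
  shows "inv_into (carrier Sp4) \<tau> g \<in> carrier Sp4" "\<tau> (inv_into (carrier Sp4) \<tau> g) = g"
proof -
  obtain h where h: "h \<in> carrier Sp4" "frobenius h = g" using frobenius_surj[OF g] by blast
  then have "g \<in> \<tau> ` carrier Sp4" using tau_tau[OF h(1)] tau_Sp4[OF h(1)] by (metis imageI)
  then show "inv_into (carrier Sp4) \<tau> g \<in> carrier Sp4" "\<tau> (inv_into (carrier Sp4) \<tau> g) = g"
    by (rule inv_into_into, rule f_inv_into_f)
qed

lemma ker_ideal2_gensE:
  assumes "x \<in> ker_ideal2_gens \<tau>"
  obtains a b where "a \<in> poly_funs" "b \<in> poly_funs" "a \<in> kid \<or> b \<in> kid"
    "\<And>g h. g \<in> carrier Sp4 \<Longrightarrow> h \<in> carrier Sp4 \<Longrightarrow> x (g, h) = a g * b h"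
proof -
  obtain a b where x: "x = (\<lambda>(g, h). a g * b h)" and ab: "a \<in> carrier coord_ring" "b \<in> carrier coord_ring"
    and k: "a \<in> ker_ideal \<tau> \<or> b \<in> ker_ideal \<tau>" using assms by (auto simp: ker_ideal2_gens_def)
  have "\<exists>a'\<in>poly_funs. a = restrict a' (carrier Sp4) \<and> (a \<in> ker_ideal \<tau> \<longrightarrow> a' \<in> kid)"
    if "a \<in> carrier coord_ring" for a
  proof (cases "a \<in> ker_ideal \<tau>")
    case True
    then show ?thesis unfolding ker_ideal_eq using kid_poly by blast
  next
    case False
    then show ?thesis using that by (auto simp: carrier_coord_ring)
  qed
  from this[OF ab(1)] this[OF ab(2)] obtain a' b' where
    "a' \<in> poly_funs" "a = restrict a' (carrier Sp4)" "a \<in> ker_ideal \<tau> \<longrightarrow> a' \<in> kid"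
    "b' \<in> poly_funs" "b = restrict b' (carrier Sp4)" "b \<in> ker_ideal \<tau> \<longrightarrow> b' \<in> kid" by blast
  then show ?thesis using that[of a' b'] k by (auto simp: x)
qed

lemma tensor2_E:
  assumes "\<phi> \<in> tensor_maps (carrier Sp4 \<times> carrier Sp4) (ker_ideal2_gens \<tau>) (H0 w :: ('k, _) gmodule)"
  obtains n a b v where "\<And>i. i < (n::nat) \<Longrightarrow> a i \<in> poly_funs" "\<And>i. i < n \<Longrightarrow> b i \<in> poly_funs"
    "\<And>i. i < n \<Longrightarrow> a i \<in> kid \<or> b i \<in> kid"
    "\<And>g h p. g \<in> carrier Sp4 \<Longrightarrow> h \<in> carrier Sp4 \<Longrightarrow> p \<in> carrier Sp4 \<Longrightarrow> \<phi> (g, h) p = (\<Sum>i<n. a i g * b i h * v i p)"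
proof -
  obtain n x v where x: "\<And>i. i < (n::nat) \<Longrightarrow> x i \<in> ker_ideal2_gens \<tau>"
    and "\<And>i. i < n \<Longrightarrow> v i \<in> carrier (H0 w)" and "\<And>y. y \<in> carrier Sp4 \<times> carrier Sp4 \<Longrightarrow> \<phi> y \<in> carrier (H0 w)"
    and eq: "\<And>y p. y \<in> carrier Sp4 \<times> carrier Sp4 \<Longrightarrow> p \<in> carrier Sp4 \<Longrightarrow> \<phi> y p = (\<Sum>i<n. x i y * v i p)"
    and "\<phi> \<in> extensional (carrier Sp4 \<times> carrier Sp4)"
    by (rule tensor_H0_E[OF assms], rule that)
  have "\<forall>i. \<exists>a b. i < n \<longrightarrow> a \<in> poly_funs \<and> b \<in> poly_funs \<and> (a \<in> kid \<or> b \<in> kid) \<and>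
    (\<forall>g\<in>carrier Sp4. \<forall>h\<in>carrier Sp4. x i (g, h) = a g * b h)"
    using x ker_ideal2_gensE by metis
  then obtain a b where ab: "\<And>i. i < n \<Longrightarrow> a i \<in> poly_funs \<and> b i \<in> poly_funs \<and> (a i \<in> kid \<or> b i \<in> kid) \<and>
    (\<forall>g\<in>carrier Sp4. \<forall>h\<in>carrier Sp4. x i (g, h) = a i g * b i h)" by metis
  have "\<phi> (g, h) p = (\<Sum>i<n. a i g * b i h * v i p)" if "g \<in> carrier Sp4" "h \<in> carrier Sp4" "p \<in> carrier Sp4" for g h p
    using that eq[of "(g, h)" p] ab by simp
  then show ?thesis using that[of n a b v] ab by blast
qed

lemma tensor2_I:
  fixes Us :: "(('k mat4 \<Rightarrow> 'k mat4 \<Rightarrow> 'k) \<times> ('k mat4 \<Rightarrow> 'k)) list"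
  assumes Us: "\<And>U v. (U, v) \<in> set Us \<Longrightarrow> U \<in> ktens \<and> v \<in> carrier (H0 w)"
    and \<phi>: "\<phi> \<in> extensional (carrier Sp4 \<times> carrier Sp4)"
      "\<And>g h. g \<in> carrier Sp4 \<Longrightarrow> h \<in> carrier Sp4 \<Longrightarrow> \<phi> (g, h) \<in> carrier (H0 w)"
      "\<And>g h p. g \<in> carrier Sp4 \<Longrightarrow> h \<in> carrier Sp4 \<Longrightarrow> p \<in> carrier Sp4 \<Longrightarrow> \<phi> (g, h) p = (\<Sum>(U, v)\<leftarrow>Us. U g h * v p)"
  shows "\<phi> \<in> tensor_maps (carrier Sp4 \<times> carrier Sp4) (ker_ideal2_gens \<tau>) (H0 w :: ('k, _) gmodule)"
proof -
  have "\<exists>ys. (\<forall>(a, v)\<in>set ys. a \<in> ker_ideal2_gens \<tau> \<and> v \<in> carrier (H0 w)) \<and>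
    (\<forall>g\<in>carrier Sp4. \<forall>h\<in>carrier Sp4. \<forall>p. (\<Sum>(U, v)\<leftarrow>Us. U g h * v p) = (\<Sum>(a, v)\<leftarrow>ys. a (g, h) * v p))"
    using Us
  proof (induction Us)
    case Nil
    then show ?case by (intro exI[of _ "[]"]) simp
  next
    case (Cons Uv Us)
    obtain U v where Uv: "Uv = (U, v)" by fastforce
    have U: "U \<in> ktens" and v: "v \<in> carrier (H0 w)" using Cons.prems[of U v] by (simp_all add: Uv)
    obtain ys where ys: "\<forall>(a, v)\<in>set ys. a \<in> ker_ideal2_gens \<tau> \<and> v \<in> carrier (H0 w)"
      "\<forall>g\<in>carrier Sp4. \<forall>h\<in>carrier Sp4. \<forall>p. (\<Sum>(U, v)\<leftarrow>Us. U g h * v p) = (\<Sum>(a, v)\<leftarrow>ys. a (g, h) * v p)"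
      using Cons.IH Cons.prems by (metis list.set_intros(2))
    obtain xs where xs: "\<forall>(a, b)\<in>set xs. a \<in> poly_funs \<and> b \<in> poly_funs \<and> (a \<in> kid \<or> b \<in> kid)"
      "\<forall>g\<in>carrier Sp4. \<forall>h\<in>carrier Sp4. U g h = (\<Sum>(a, b)\<leftarrow>xs. a g * b h)"
      using ktens_list[OF U] by blast
    define \<gamma> where "\<gamma> = (\<lambda>(a :: 'k mat4 \<Rightarrow> 'k, b :: 'k mat4 \<Rightarrow> 'k). (\<lambda>(g, h). restrict a (carrier Sp4) g * restrict b (carrier Sp4) h :: 'k, v))"
    have gens: "\<forall>(a, v)\<in>set (map \<gamma> xs). a \<in> ker_ideal2_gens \<tau> \<and> v \<in> carrier (H0 w)"
    proof -
      have "(\<lambda>(g, h). restrict a (carrier Sp4) g * restrict b (carrier Sp4) h) \<in> ker_ideal2_gens \<tau>" if "(a, b) \<in> set xs" for a b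
        unfolding ker_ideal2_gens_def mem_Collect_eq
        by (rule exI[of _ "restrict a (carrier Sp4)"], rule exI[of _ "restrict b (carrier Sp4)"])
           (use xs(1) that in \<open>auto simp: ker_ideal_eq\<close>)
      then show ?thesis using v by (auto simp: \<gamma>_def)
    qed
    have sum: "(\<Sum>(a, v)\<leftarrow>map \<gamma> xs. a (g, h) * v p) = U g h * v p" if "g \<in> carrier Sp4" "h \<in> carrier Sp4" for g h p
    proof -
      have "(\<Sum>(a, v)\<leftarrow>map \<gamma> xs. a (g, h) * v p) = (\<Sum>(a, b)\<leftarrow>xs. a g * b h) * v p"
        using that by (induction xs) (auto simp: \<gamma>_def distrib_right)
      then show ?thesis using xs(2) that by simp
    qed
    show ?case
      by (rule exI[of _ "map \<gamma> xs @ ys"]) (use gens ys sum in \<open>auto simp: Uv\<close>)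
  qed
  then obtain ys where ys: "\<forall>(a, v)\<in>set ys. a \<in> ker_ideal2_gens \<tau> \<and> v \<in> carrier (H0 w)"
    "\<forall>g\<in>carrier Sp4. \<forall>h\<in>carrier Sp4. \<forall>p. (\<Sum>(U, v)\<leftarrow>Us. U g h * v p) = (\<Sum>(a, v)\<leftarrow>ys. a (g, h) * v p)" by blast
  show ?thesis by (rule tensor_H0_I[where xs = ys]) (use ys \<phi> in auto)
qed

lemma cocycles_H0_zero:
  "cocycles1 \<tau> (H0 0 :: ('k, _) gmodule) =
    lift0 ` {u \<in> poly_funs. \<exists>c. (\<lambda>g. u g + (\<Sum>j\<in>UNIV. c $ j * phi j g)) \<in> kid}" (is "_ = lift0 ` ?Z")
proof (intro equalityI subsetI)
  fix f assume f: "f \<in> cocycles1 \<tau> (H0 0 :: ('k, _) gmodule)"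
  then obtain u where u: "u \<in> poly_funs" "f = lift0 u" by (auto simp: cocycles1_def cochains_H0_zero)
  have D: "diff1 (H0 0) f \<in> tensor_maps (carrier Sp4 \<times> carrier Sp4) (ker_ideal2_gens \<tau>) (H0 0)"
    using f by (simp add: cocycles1_def)
  obtain n a b v where ab: "\<And>i. i < (n::nat) \<Longrightarrow> a i \<in> poly_funs" "\<And>i. i < n \<Longrightarrow> b i \<in> poly_funs"
    "\<And>i. i < n \<Longrightarrow> a i \<in> kid \<or> b i \<in> kid"
    and eq: "\<And>g h p. g \<in> carrier Sp4 \<Longrightarrow> h \<in> carrier Sp4 \<Longrightarrow> p \<in> carrier Sp4 \<Longrightarrow>
      diff1 (H0 0) f (g, h) p = (\<Sum>i<n. a i g * b i h * v i p)" by (rule tensor2_E[OF D], rule that)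
  have "(\<lambda>g. u g + (\<Sum>j\<in>UNIV. tang j u * phi j g)) \<in> kid"
  proof (rule primitive_eqv_phi[OF u(1) ab])
    show "u h + u (g ** h) + u g = (\<Sum>i<n. a i g * b i h * v i (mat 1))" if "g \<in> carrier Sp4" "h \<in> carrier Sp4" for g h
      using eq[OF that Sp4_one] that by (simp add: u(2) diff1_lift0 cfun_def)
  qed
  then have "u \<in> ?Z" using u(1) by (auto intro!: exI[of _ "\<chi> j. tang j u"])
  then show "f \<in> lift0 ` ?Z" using u(2) by blast
next
  fix f assume "f \<in> lift0 ` ?Z"
  then obtain u c where u: "u \<in> poly_funs" "f = lift0 u" and k: "(\<lambda>g. u g + (\<Sum>j\<in>UNIV. c $ j * phi j g)) \<in> kid" by blast
  define k where "k g = u g + (\<Sum>j\<in>UNIV. c $ j * phi j g)" for g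
  have k: "k \<in> kid" using k by (simp add: k_def[abs_def])
  have u_eq: "u g = k g + (\<Sum>j\<in>UNIV. c $ j * phi j g)" for g by (simp add: k_def)
  \<comment> \<open>By \<open>phi_mult\<close> the failure of \<open>phi j\<close> to be additive is
    the sum of \<open>phi l g\<close> times entries of \<open>minors h - 1\<close>; the part
    \<open>k\<close> contributes its own failure.\<close>
  define U where "U g h = (k h + k (g ** h)) + k g + (\<Sum>j\<in>UNIV. \<Sum>l\<in>UNIV. (c $ j * phi l g) * (minors h $ l $ j + mat 1 $ l $ j))" for g h
  have U: "U \<in> ktens" unfolding U_def[abs_def]
    by (intro ktens.add ktens_sum ktens_left ktens_right comult_ktens k ktens.prod disjI2 kid_minors pf phi_in_poly_funs minors_in_poly_funs)
  have U_eq: "u h + u (g ** h) + u g = U g h" if "g \<in> carrier Sp4" "h \<in> carrier Sp4" for g h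
    using that by (simp add: U_def u_eq phi_mult sum_4 mat_nth algebra_simps)
  have "diff1 (H0 0) f \<in> tensor_maps (carrier Sp4 \<times> carrier Sp4) (ker_ideal2_gens \<tau>) (H0 0)"
    by (rule tensor2_I[where Us = "[(U, cfun 1)]"])
       (use U U_eq in \<open>auto simp: u(2) diff1_lift0, simp add: cfun_def\<close>)
  then show "f \<in> cocycles1 \<tau> (H0 0)" using u by (auto simp: cocycles1_def cochains_H0_zero)
qed

lemma coboundaries_H0_zero: "coboundaries1 \<tau> (H0 0 :: ('k, _) gmodule) = lift0 ` kid"
proof -
  have d0: "diff0 (H0 0) ` carrier (H0 0 :: ('k, _) gmodule) = {lift0 (\<lambda>_. 0)}"
  proof -
    have "diff0 (H0 0) (cfun c) = lift0 (\<lambda>_. 0)" for c :: 'k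
      by (auto simp: diff0_def lift0_def a_minus_def H0_minus cfun_ops intro!: restrict_ext)
    then show ?thesis unfolding H0_zero image_image by simp
  qed
  have "tensor_maps (carrier Sp4) (ker_ideal \<tau>) (H0 0 :: ('k, _) gmodule) = lift0 ` kid"
    unfolding ker_ideal_eq by (rule tensor_maps_H0_zero[OF K_kid])
  then show ?thesis by (auto simp: coboundaries1_def d0 set_add_def' lift0_ops)
qed

lemma cocycles_H0_omega1:
  "cocycles1 \<tau> (H0 \<omega>\<^sub>1 :: ('k, _) gmodule) =
    lift1 ` {u. (\<forall>i. (\<lambda>g. u g $ i) \<in> poly_funs) \<and> (\<exists>v. \<forall>i. (\<lambda>g. (u g + (g *v v + v)) $ i) \<in> kid)}" (is "_ = lift1 ` ?Z")
proof (intro equalityI subsetI)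
  fix f assume f: "f \<in> cocycles1 \<tau> (H0 \<omega>\<^sub>1 :: ('k, _) gmodule)"
  then obtain u where u: "\<And>i. (\<lambda>g. u g $ i) \<in> poly_funs" "f = lift1 u" by (auto simp: cocycles1_def cochains_H0_omega1)
  have D: "diff1 (H0 \<omega>\<^sub>1) f \<in> tensor_maps (carrier Sp4 \<times> carrier Sp4) (ker_ideal2_gens \<tau>) (H0 \<omega>\<^sub>1)"
    using f by (simp add: cocycles1_def)
  obtain n a b v where ab: "\<And>i. i < (n::nat) \<Longrightarrow> a i \<in> poly_funs" "\<And>i. i < n \<Longrightarrow> b i \<in> poly_funs"
    "\<And>i. i < n \<Longrightarrow> a i \<in> kid \<or> b i \<in> kid"
    and eq: "\<And>g h p. g \<in> carrier Sp4 \<Longrightarrow> h \<in> carrier Sp4 \<Longrightarrow> p \<in> carrier Sp4 \<Longrightarrow>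
      diff1 (H0 \<omega>\<^sub>1) f (g, h) p = (\<Sum>i<n. a i g * b i h * v i p)" by (rule tensor2_E[OF D], rule that)
  have "\<exists>v. \<forall>i. (\<lambda>g. u g $ i + ((\<Sum>l\<in>UNIV. g $ i $ l * v $ l) + v $ i)) \<in> kid"
  proof (rule natural_cocycle_mod_kid[OF u(1) ab])
    show "(\<Sum>l\<in>UNIV. g $ i $ l * u h $ l) + u (g ** h) $ i + u g $ i = (\<Sum>k<n. a k g * b k h * v k (pt i))"
      if "g \<in> carrier Sp4" "h \<in> carrier Sp4" for g h i
      using eq[OF that pt_Sp4, of i] that by (simp add: u(2) diff1_lift1) (simp add: matrix_vector_mult_def)
  qed
  then have "u \<in> ?Z" using u(1) by (simp add: matrix_vector_mult_def)
  then show "f \<in> lift1 ` ?Z" using u(2) by blast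
next
  fix f assume "f \<in> lift1 ` ?Z"
  then obtain u v where u: "\<And>i. (\<lambda>g. u g $ i) \<in> poly_funs" "f = lift1 u" and k: "\<And>i. (\<lambda>g. (u g + (g *v v + v)) $ i) \<in> kid" by blast
  define k where "k i g = (u g + (g *v v + v)) $ i" for i g
  have k: "k i \<in> kid" for i using k by (simp add: k_def[abs_def])
  \<comment> \<open>The coboundary of \<open>v\<close> satisfies the cocycle identity exactly, so
    only the part \<open>k\<close> in the ideal contributes.\<close>
  define U where "U i g h = (\<Sum>l\<in>UNIV. g $ i $ l * k l h) + k i (g ** h) + k i g" for i g h
  have U: "U i \<in> ktens" for i unfolding U_def[abs_def]
    by (intro ktens.add ktens_sum ktens_left comult_ktens k ktens.prod disjI2 pf kid_poly)
  have U_eq: "(g *v u h + u (g ** h) + u g) $ i = U i g h" for g h i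
  proof -
    have u_eq: "u g = (\<chi> i. k i g) + (g *v v + v)" for g
      by (simp add: vec_eq_iff k_def)
    have "g *v u h + u (g ** h) + u g = (g *v (\<chi> i. k i h)) + (\<chi> i. k i (g ** h)) + (\<chi> i. k i g)"
      unfolding u_eq by (simp add: vec_eq_iff matrix_vector_right_distrib matrix_vector_mul_assoc algebra_simps)
    then show ?thesis by (simp add: U_def matrix_vector_mult_def)
  qed
  have "diff1 (H0 \<omega>\<^sub>1) f \<in> tensor_maps (carrier Sp4 \<times> carrier Sp4) (ker_ideal2_gens \<tau>) (H0 \<omega>\<^sub>1)"
  proof (rule tensor2_I[where Us = "map (\<lambda>i. (U i, vfun (axis i 1))) [1, 2, 3, 4]"])
    fix g h p :: "'k mat4" assume gh: "g \<in> carrier Sp4" "h \<in> carrier Sp4" "p \<in> carrier Sp4"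
    have "diff1 (H0 \<omega>\<^sub>1) f (g, h) p = vfun (\<chi> i. U i g h) p"
    proof -
      have "g *v u h + u (g ** h) + u g = (\<chi> i. U i g h)" using U_eq[of g h] by (simp add: vec_eq_iff)
      then show ?thesis using gh by (simp add: u(2) diff1_lift1)
    qed
    then show "diff1 (H0 \<omega>\<^sub>1) f (g, h) p = (\<Sum>(U, v)\<leftarrow>map (\<lambda>i. (U i, vfun (axis i 1))) [1, 2, 3, 4]. U g h * v p)"
      using gh by (simp add: vfun_def sum_4 axis_def)
  qed (use U in \<open>auto simp: u(2) diff1_lift1\<close>)
  then show "f \<in> cocycles1 \<tau> (H0 \<omega>\<^sub>1)" using u by (auto simp: cocycles1_def cochains_H0_omega1)
qed

lemma coboundaries_H0_omega1: "coboundaries1 \<tau> (H0 \<omega>\<^sub>1 :: ('k, _) gmodule) = cocycles1 \<tau> (H0 \<omega>\<^sub>1)"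
proof -
  have T: "tensor_maps (carrier Sp4) (ker_ideal \<tau>) (H0 \<omega>\<^sub>1 :: ('k, _) gmodule) = lift1 ` {u. \<forall>i. (\<lambda>g. u g $ i) \<in> kid}"
    unfolding ker_ideal_eq by (rule tensor_maps_H0_omega1[OF K_kid])
  have d0: "diff0 (H0 \<omega>\<^sub>1) (vfun v) = lift1 (\<lambda>g. g *v v + v)" for v
    by (auto simp: diff0_def lift1_def a_minus_def H0_minus vfun_add vfun_act intro!: restrict_ext)
  have vv: "(g *v v + v) + (g *v v + v) = 0" for g :: "'k mat4" and v by (simp add: vec_eq_iff)
  have pol: "(\<lambda>g. (g *v v + v) $ i) \<in> poly_funs" for v :: "'k ^ 4" and i
    unfolding matrix_vector_mult_def by (simp, intro pf poly_funs_sum)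
  show ?thesis
  proof (intro equalityI subsetI)
    fix f assume "f \<in> coboundaries1 \<tau> (H0 \<omega>\<^sub>1 :: ('k, _) gmodule)"
    then obtain v k where k: "\<And>i. (\<lambda>g. k g $ i) \<in> kid" and f: "f = lift1 (\<lambda>g. (g *v v + v) + k g)"
      by (auto simp: coboundaries1_def set_add_def' T H0_omega1 d0 lift1_ops)
    have "(\<lambda>g. ((g *v v + v) + k g) $ i) \<in> poly_funs" for i
      using pf(3)[OF pol kid_poly[OF k]] by simp
    moreover have "(\<lambda>g. (((g *v v + v) + k g) + (g *v v + v)) $ i) \<in> kid" for i
      using k[of i] vv[of _ v] by (simp add: algebra_simps)
    ultimately show "f \<in> cocycles1 \<tau> (H0 \<omega>\<^sub>1)" unfolding cocycles_H0_omega1 f by blast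
  next
    fix f assume "f \<in> cocycles1 \<tau> (H0 \<omega>\<^sub>1 :: ('k, _) gmodule)"
    then obtain u v where f: "f = lift1 u" and k: "\<And>i. (\<lambda>g. (u g + (g *v v + v)) $ i) \<in> kid"
      unfolding cocycles_H0_omega1 by blast
    have "f = lift1 (\<lambda>g. (g *v v + v) + (u g + (g *v v + v)))"
      unfolding f by (rule lift1_cong) (use vv[of _ v] in \<open>simp add: algebra_simps\<close>)
    then have "f = diff0 (H0 \<omega>\<^sub>1) (vfun v) \<oplus>\<^bsub>cochains1 (H0 \<omega>\<^sub>1)\<^esub> lift1 (\<lambda>g. u g + (g *v v + v))"
      by (simp add: d0 lift1_ops)
    moreover have "lift1 (\<lambda>g. u g + (g *v v + v)) \<in> lift1 ` {u. \<forall>i. (\<lambda>g. u g $ i) \<in> kid}" using k by blast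
    ultimately show "f \<in> coboundaries1 \<tau> (H0 \<omega>\<^sub>1)"
      unfolding coboundaries1_def set_add_def' T using vfun_carrier by blast
  qed
qed

lemma H1_omega1: "untwist \<tau> (H1_ker \<tau> (H0 \<omega>\<^sub>1 :: ('k, _) gmodule)) \<cong>\<^sub>G (zero_gmodule :: ('k, _) gmodule)"
  unfolding H1_ker_def
proof (rule quotient_iso[where \<Psi> = "\<lambda>_. ()", OF zero_gmodule_gmodule])
  let ?A = "(cochains1 (H0 \<omega>\<^sub>1 :: ('k, _) gmodule))\<lparr>carrier := cocycles1 \<tau> (H0 \<omega>\<^sub>1)\<rparr>"
  let ?Z = "{u. (\<forall>i. (\<lambda>g. u g $ i) \<in> poly_funs) \<and> (\<exists>v. \<forall>i. (\<lambda>g. (u g + (g *v v + v)) $ i :: 'k) \<in> kid)}"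
  have Z: "carrier ?A = lift1 ` ?Z" by (simp add: cocycles_H0_omega1)
  have pol: "(\<lambda>g. (g *v v + v) $ i) \<in> poly_funs" for v :: "'k ^ 4" and i
    unfolding matrix_vector_mult_def by (simp, intro pf poly_funs_sum)
  have zero: "lift1 (\<lambda>_. 0) \<in> carrier ?A"
    unfolding Z by (intro imageI CollectI conjI allI exI[of _ 0]) (simp_all add: pf kid_zero)
  show "(\<lambda>_. ()) ` carrier ?A = carrier zero_gmodule" using zero by (auto simp: zero_gmodule_def)
  show "coboundaries1 \<tau> (H0 \<omega>\<^sub>1) = {z \<in> carrier ?A. () = \<zero>\<^bsub>zero_gmodule\<^esub>}"
    by (simp add: coboundaries_H0_omega1)
  have add: "x \<oplus>\<^bsub>?A\<^esub> y \<in> carrier ?A" if xy: "x \<in> carrier ?A" "y \<in> carrier ?A" for x y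
  proof -
    obtain u u' v v' where x: "x = lift1 u" "\<And>i. (\<lambda>g. u g $ i) \<in> poly_funs" "\<And>i. (\<lambda>g. (u g + (g *v v + v)) $ i) \<in> kid"
      and y: "y = lift1 u'" "\<And>i. (\<lambda>g. u' g $ i) \<in> poly_funs" "\<And>i. (\<lambda>g. (u' g + (g *v v' + v')) $ i) \<in> kid"
      using xy unfolding Z by blast
    have k: "(\<lambda>g. ((u g + u' g) + (g *v (v + v') + (v + v'))) $ i) \<in> kid" for i
      using kid.add[OF x(3)[of i] y(3)[of i]] by (simp add: matrix_vector_right_distrib add_ac)
    have "(\<lambda>g. (u g + u' g) $ i) \<in> poly_funs" for i using pf(3)[OF x(2) y(2)] by simp
    then have "lift1 (\<lambda>g. u g + u' g) \<in> lift1 ` ?Z" using k by blast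
    then show ?thesis unfolding Z by (simp add: x(1) y(1) lift1_ops)
  qed
  then show "x \<oplus>\<^bsub>?A\<^esub> y \<in> carrier ?A \<and> () = () \<oplus>\<^bsub>zero_gmodule\<^esub> ()" if "x \<in> carrier ?A" "y \<in> carrier ?A" for x y
    using that by simp
  show "x \<oplus>\<^bsub>?A\<^esub> y \<oplus>\<^bsub>?A\<^esub> z = x \<oplus>\<^bsub>?A\<^esub> (y \<oplus>\<^bsub>?A\<^esub> z)" if "x \<in> carrier ?A" "y \<in> carrier ?A" "z \<in> carrier ?A" for x y z
    using that unfolding Z by (auto simp: lift1_ops add.assoc)
  show "a \<odot>\<^bsub>?A\<^esub> x \<in> carrier ?A \<and> () = a \<odot>\<^bsub>zero_gmodule\<^esub> ()" if xy: "x \<in> carrier ?A" for a x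
  proof -
    obtain u v where x: "x = lift1 u" "\<And>i. (\<lambda>g. u g $ i) \<in> poly_funs" "\<And>i. (\<lambda>g. (u g + (g *v v + v)) $ i) \<in> kid"
      using xy unfolding Z by blast
    have k: "(\<lambda>g. (a *s u g + (g *v (a *s v) + a *s v)) $ i) \<in> kid" for i
      using kid_cmult[OF x(3)[of i], of a] by (simp add: vector_scalar_commute distrib_left)
    have "(\<lambda>g. (a *s u g) $ i) \<in> poly_funs" for i using poly_funs_cmult[OF x(2)] by simp
    then have "lift1 (\<lambda>g. a *s u g) \<in> lift1 ` ?Z" using k by blast
    then show ?thesis unfolding Z by (simp add: x(1) lift1_ops)
  qed
  show "act ?A (inv_into (carrier Sp4) \<tau> g) x \<in> carrier ?A \<and> () = act zero_gmodule g ()"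
    if g: "g \<in> carrier Sp4" and x: "x \<in> carrier ?A" for g x
  proof -
    define y where "y = inv_into (carrier Sp4) \<tau> g"
    have y: "y \<in> carrier Sp4" using tau_inv_into[OF g] by (simp add: y_def)
    have yy: "sinv y \<in> carrier Sp4" "sinv y ** y = mat 1" "y ** sinv y = mat 1" using y by (simp_all add: sinv_left sinv_right)
    obtain u v where x: "x = lift1 u" "\<And>i. (\<lambda>g. u g $ i) \<in> poly_funs" "\<And>i. (\<lambda>g. (u g + (g *v v + v)) $ i) \<in> kid"
      using x unfolding Z by blast
    let ?u = "\<lambda>g. y *v u (sinv y ** g ** y)"
    have mv: "(y *v w) $ i = (\<Sum>l\<in>UNIV. y $ i $ l * w $ l)" for w i by (simp add: matrix_vector_mult_def)
    have "(\<lambda>g. ?u g $ i) \<in> poly_funs" for i unfolding mv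
      using conj_poly[OF x(2)] by (intro poly_funs_sum pf)
    moreover have "(\<lambda>g. (?u g + (g *v (y *v v) + (y *v v))) $ i) \<in> kid" for i
    proof -
      have "(\<lambda>g. (y *v (u (sinv y ** g ** y) + ((sinv y ** g ** y) *v v + v))) $ i) \<in> kid"
        unfolding mv using kid_conj[OF yy(1) y yy(2) x(3)] by (intro kid_sum kid_cmult)
      \<comment> \<open>Conjugation by \<open>y\<close> takes the coboundary of \<open>v\<close> to
        the coboundary of \<open>y *v v\<close>.\<close>
      moreover have "y *v (u (sinv y ** g ** y) + ((sinv y ** g ** y) *v v + v)) = ?u g + (g *v (y *v v) + (y *v v))" for g
      proof -
        have "y *v ((sinv y ** g ** y) *v v) = (y ** sinv y ** g ** y) *v v"
          by (simp only: matrix_vector_mul_assoc matrix_mul_assoc)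
        then show ?thesis by (simp add: matrix_vector_right_distrib yy(3) matrix_vector_mul_assoc)
      qed
      ultimately show ?thesis by simp
    qed
    ultimately have "lift1 ?u \<in> lift1 ` ?Z" by blast
    then show ?thesis unfolding Z y_def[symmetric] by (simp add: x(1) lift1_ops y)
  qed
  show "\<exists>b\<in>coboundaries1 \<tau> (H0 \<omega>\<^sub>1). z' = b \<oplus>\<^bsub>?A\<^esub> z" if "z \<in> carrier ?A" "z' \<in> carrier ?A" for z z'
  proof
    show "z' \<oplus>\<^bsub>?A\<^esub> z \<in> coboundaries1 \<tau> (H0 \<omega>\<^sub>1)" using add[OF that(2,1)] by (simp add: coboundaries_H0_omega1)
    show "z' = z' \<oplus>\<^bsub>?A\<^esub> z \<oplus>\<^bsub>?A\<^esub> z" using that unfolding Z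
    proof safe
      fix u u' :: "'k mat4 \<Rightarrow> 'k ^ 4"
      have "u' g + u g + u g = u' g" for g by (simp add: vec_eq_iff add.assoc)
      then show "lift1 u' = lift1 u' \<oplus>\<^bsub>?A\<^esub> lift1 u \<oplus>\<^bsub>?A\<^esub> lift1 u" by (simp add: lift1_ops)
    qed
  qed
qed

lemma H1_zero: "untwist \<tau> (H1_ker \<tau> (H0 0 :: ('k, _) gmodule)) \<cong>\<^sub>G (H0 \<omega>\<^sub>1 :: ('k, _) gmodule)"
proof -
  let ?A = "(cochains1 (H0 0 :: ('k, _) gmodule))\<lparr>carrier := cocycles1 \<tau> (H0 0)\<rparr>"
  let ?Z = "{u \<in> poly_funs. \<exists>c. (\<lambda>g. u g + (\<Sum>j\<in>UNIV. c $ j * phi j g)) \<in> kid}"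
  \<comment> \<open>The cohomology classes transform by \<open>minors y\<close>, the target by
    \<open>\<tau> y\<close>; \<open>d\<close> intertwines the two.\<close>
  define d where "d = dg 1 (inverse tau_scalar)"
  define d' where "d' = dg 1 tau_scalar"
  have dd: "d ** d' = mat 1" "d' ** d = mat 1" by (simp_all add: d_def d'_def dg_scalar_inverse)
  define tv where "tv u = (\<chi> j. tang j u)" for u
  \<comment> \<open>The values of a cochain are constant functions, so evaluation at the identity
    recovers the scalar function; its short root derivatives are the coordinates of the
    class.\<close>
  define \<Psi> where "\<Psi> f = vfun (d *v tv (\<lambda>g. f g (mat 1)))" for f :: "'k mat4 \<Rightarrow> 'k mat4 \<Rightarrow> 'k"
  have Z: "carrier ?A = lift0 ` ?Z" by (simp add: cocycles_H0_zero)
  have tv_cong: "tv u = tv u'" if "\<And>g. g \<in> carrier Sp4 \<Longrightarrow> u g = u' g" for u u'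
    unfolding tv_def using tang_cong[OF that] by simp
  have \<Psi>: "\<Psi> (lift0 u) = vfun (d *v tv u)" for u
    unfolding \<Psi>_def by (rule arg_cong[where f = "\<lambda>v. vfun (d *v v)"], rule tv_cong) (simp add: lift0_def cfun_def)
  have tv_phi: "tang j (\<lambda>g. \<Sum>i\<in>UNIV. c $ i * phi i g) = c $ j" for j c
  proof -
    have "tang j (\<lambda>g. \<Sum>i\<in>UNIV. c $ i * phi i g) = (\<Sum>i\<in>UNIV. c $ i * (if i = j then 1 else 0))"
      by (subst lin_sum) (auto simp: pf lin_phi_one)
    then show ?thesis using exhaust_4[of j] by (elim disjE) (simp_all add: sum_4)
  qed
  have phi_pol: "(\<lambda>g. \<Sum>i\<in>UNIV. c $ i * phi i g) \<in> poly_funs" for c :: "'k ^ 4"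
    by (intro poly_funs_sum pf phi_in_poly_funs)
  \<comment> \<open>Elements of the ideal have zero derivatives at the identity and the
    \<open>phi j\<close> are dual to the derivatives, so \<open>c\<close> is determined by
    \<open>u\<close>.\<close>
  have tv_c: "tv u = c" if "u \<in> poly_funs" "(\<lambda>g. u g + (\<Sum>j\<in>UNIV. c $ j * phi j g)) \<in> kid" for u c
  proof -
    have "tang j u + c $ j = 0" for j
      using tang_kid[OF that(2), of j] by (subst (asm) lin_add) (auto simp: that(1) phi_pol tv_phi)
    then show ?thesis by (simp add: tv_def vec_eq_iff)
  qed
  have phi_Z: "(\<lambda>g. \<Sum>i\<in>UNIV. c $ i * phi i g) \<in> ?Z" for c
    using phi_pol[of c] by (auto intro!: exI[of _ c] simp: kid_zero)
  have add_Z: "(\<lambda>g. u g + u' g) \<in> ?Z" if uu: "u \<in> ?Z" "u' \<in> ?Z" for u u'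
  proof -
    obtain c c' where "(\<lambda>g. u g + (\<Sum>j\<in>UNIV. c $ j * phi j g)) \<in> kid" "(\<lambda>g. u' g + (\<Sum>j\<in>UNIV. c' $ j * phi j g)) \<in> kid"
      using uu by blast
    from kid.add[OF this] have k: "(\<lambda>g. (u g + u' g) + (\<Sum>j\<in>UNIV. (c + c') $ j * phi j g)) \<in> kid"
      by (simp add: distrib_right sum.distrib add_ac)
    show ?thesis by (intro CollectI conjI exI[of _ "c + c'"] k pf) (use uu in auto)
  qed
  have tv_add: "tv (\<lambda>g. u g + u' g) = tv u + tv u'" if "u \<in> poly_funs" "u' \<in> poly_funs" for u u'
    using that by (simp add: tv_def vec_eq_iff)
  show ?thesis
    unfolding H1_ker_def
  proof (rule quotient_iso[where \<Psi> = \<Psi>, OF H0_omega1_gmodule])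
    show "\<Psi> ` carrier ?A = carrier (H0 \<omega>\<^sub>1)"
    proof (intro equalityI subsetI)
      fix f assume "f \<in> \<Psi> ` carrier ?A"
      then show "f \<in> carrier (H0 \<omega>\<^sub>1)" by (auto simp: \<Psi>_def)
    next
      fix f :: "'k mat4 \<Rightarrow> 'k" assume "f \<in> carrier (H0 \<omega>\<^sub>1)"
      then obtain c where c: "f = vfun c" by (auto simp: H0_omega1)
      have "tv (\<lambda>g. \<Sum>i\<in>UNIV. (d' *v c) $ i * phi i g) = d' *v c"
        unfolding tv_def tv_phi by simp
      then have "\<Psi> (lift0 (\<lambda>g. \<Sum>i\<in>UNIV. (d' *v c) $ i * phi i g)) = f"
        by (simp add: \<Psi> matrix_vector_mul_assoc dd c)
      then show "f \<in> \<Psi> ` carrier ?A" unfolding Z using phi_Z[of "d' *v c"] by blast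
    qed
  next
    have inj: "tv u = 0" if "\<Psi> (lift0 u) = \<zero>\<^bsub>H0 \<omega>\<^sub>1\<^esub>" for u
    proof -
      have "d *v tv u = 0" using that by (simp add: \<Psi> vfun_zero vfun_inj)
      then have "d' *v (d *v tv u) = d' *v 0" by simp
      then show ?thesis by (simp add: matrix_vector_mul_assoc dd)
    qed
    show "coboundaries1 \<tau> (H0 0) = {z \<in> carrier ?A. \<Psi> z = \<zero>\<^bsub>H0 \<omega>\<^sub>1\<^esub>}"
    proof (intro equalityI subsetI)
      fix z assume "z \<in> coboundaries1 \<tau> (H0 0 :: ('k, _) gmodule)"
      then obtain k where k: "k \<in> kid" "z = lift0 k" by (auto simp: coboundaries_H0_zero)
      then have "k \<in> ?Z" by (auto intro!: exI[of _ 0] kid_poly)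
      moreover have "tv k = 0" using tang_kid[OF k(1)] by (simp add: tv_def vec_eq_iff)
      ultimately show "z \<in> {z \<in> carrier ?A. \<Psi> z = \<zero>\<^bsub>H0 \<omega>\<^sub>1\<^esub>}"
        unfolding Z using k(2) by (auto simp: \<Psi> vfun_zero)
    next
      fix z assume z: "z \<in> {z \<in> carrier ?A. \<Psi> z = \<zero>\<^bsub>H0 \<omega>\<^sub>1\<^esub>}"
      then obtain u c where u: "u \<in> poly_funs" "(\<lambda>g. u g + (\<Sum>j\<in>UNIV. c $ j * phi j g)) \<in> kid" "z = lift0 u"
        unfolding Z by blast
      have "tv u = 0" using inj z u(3) by blast
      then have "c = 0" using tv_c[OF u(1,2)] by simp
      then have "u \<in> kid" using u(2) by simp
      then show "z \<in> coboundaries1 \<tau> (H0 0)" using u(3) by (simp add: coboundaries_H0_zero)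
    qed
  next
    show "x \<oplus>\<^bsub>?A\<^esub> y \<in> carrier ?A \<and> \<Psi> (x \<oplus>\<^bsub>?A\<^esub> y) = \<Psi> x \<oplus>\<^bsub>H0 \<omega>\<^sub>1\<^esub> \<Psi> y" if xy: "x \<in> carrier ?A" "y \<in> carrier ?A" for x y
    proof -
      obtain u u' where u: "u \<in> ?Z" "x = lift0 u" "u' \<in> ?Z" "y = lift0 u'" using xy unfolding Z by blast
      then have "x \<oplus>\<^bsub>?A\<^esub> y = lift0 (\<lambda>g. u g + u' g)" by (simp add: lift0_ops)
      then show ?thesis unfolding Z using add_Z[OF u(1,3)] u
        by (simp add: \<Psi> tv_add vfun_add matrix_vector_right_distrib)
    qed
    show "x \<oplus>\<^bsub>?A\<^esub> y \<oplus>\<^bsub>?A\<^esub> z = x \<oplus>\<^bsub>?A\<^esub> (y \<oplus>\<^bsub>?A\<^esub> z)" if "x \<in> carrier ?A" "y \<in> carrier ?A" "z \<in> carrier ?A" for x y z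
      using that unfolding Z by (auto simp: lift0_ops add.assoc)
    show "a \<odot>\<^bsub>?A\<^esub> x \<in> carrier ?A \<and> \<Psi> (a \<odot>\<^bsub>?A\<^esub> x) = a \<odot>\<^bsub>H0 \<omega>\<^sub>1\<^esub> \<Psi> x" if xy: "x \<in> carrier ?A" for a x
    proof -
      obtain u c where u: "u \<in> poly_funs" "(\<lambda>g. u g + (\<Sum>j\<in>UNIV. c $ j * phi j g)) \<in> kid" "x = lift0 u"
        using xy unfolding Z by blast
      have "(\<lambda>g. a * u g + (\<Sum>j\<in>UNIV. (a *s c) $ j * phi j g)) \<in> kid"
        using kid_cmult[OF u(2), of a] by (simp add: distrib_left sum_distrib_left mult.assoc)
      then have "(\<lambda>g. a * u g) \<in> ?Z" using poly_funs_cmult[OF u(1)] by blast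
      moreover have "tv (\<lambda>g. a * u g) = a *s tv u" using u(1) by (simp add: tv_def vec_eq_iff lin_cmult)
      ultimately show ?thesis unfolding Z u(3)
        by (simp add: lift0_ops \<Psi> vfun_smult vector_scalar_commute)
    qed
    show "act ?A (inv_into (carrier Sp4) \<tau> g) x \<in> carrier ?A \<and>
        \<Psi> (act ?A (inv_into (carrier Sp4) \<tau> g) x) = act (H0 \<omega>\<^sub>1) g (\<Psi> x)"
      if g: "g \<in> carrier Sp4" and x: "x \<in> carrier ?A" for g x
    proof -
      define y where "y = inv_into (carrier Sp4) \<tau> g"
      have y: "y \<in> carrier Sp4" "\<tau> y = g" using tau_inv_into[OF g] by (simp_all add: y_def)
      have yy: "sinv y \<in> carrier Sp4" "sinv y ** y = mat 1" using y(1) by (simp_all add: sinv_left)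
      obtain u c where u: "u \<in> poly_funs" "(\<lambda>g. u g + (\<Sum>j\<in>UNIV. c $ j * phi j g)) \<in> kid" "x = lift0 u"
        using x unfolding Z by blast
      let ?u = "\<lambda>g. u (sinv y ** g ** y)" and ?c = "minors y *v c"
      have pol: "?u \<in> poly_funs" using conj_poly[OF u(1)] .
      have e1: "(\<lambda>g. \<Sum>j\<in>UNIV. c $ j * phi j (sinv y ** g ** y)) \<doteq> (\<lambda>g. \<Sum>j\<in>UNIV. c $ j * (\<Sum>l\<in>UNIV. minors y $ l $ j * phi l g))"
      proof -
        have e: "(\<lambda>g. c $ j * phi j (sinv y ** g ** y)) \<doteq> (\<lambda>g. c $ j * (\<Sum>l\<in>UNIV. minors y $ l $ j * phi l g))" for j
          by (rule eqv_mult[OF eqv_refl[OF pf(1)] phi_conj[OF yy(1) y(1) yy(2)]])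
        show ?thesis unfolding sum_4[of "\<lambda>j. c $ j * _ j"] by (intro eqv_add e)
      qed
      have e2: "(\<lambda>g. \<Sum>j\<in>UNIV. c $ j * (\<Sum>l\<in>UNIV. minors y $ l $ j * phi l g)) = (\<lambda>g. \<Sum>l\<in>UNIV. ?c $ l * phi l g)"
        by (simp add: sum_4 matrix_vector_mult_def algebra_simps)
      have e3: "?u \<doteq> (\<lambda>g. \<Sum>j\<in>UNIV. c $ j * phi j (sinv y ** g ** y))"
        using kid_conj[OF yy(1) y(1) yy(2) u(2)] pol conj_poly[OF phi_pol] by (simp add: eqv_def)
      have "?u \<doteq> (\<lambda>g. \<Sum>l\<in>UNIV. ?c $ l * phi l g)"
        using eqv_trans[OF e3 e1] unfolding e2 .
      then have k: "(\<lambda>g. ?u g + (\<Sum>l\<in>UNIV. ?c $ l * phi l g)) \<in> kid" by (simp add: eqv_def)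
      \<comment> \<open>Equivariance rests on \<open>d ** minors y = \<tau> y ** d\<close>, where
        \<open>\<tau> y\<close> is \<open>g\<close>.\<close>
      have "d *v ?c = g *v (d *v c)"
      proof -
        have "d ** minors y = d ** minors y ** (d' ** d)" by (simp add: dd)
        also have "\<dots> = g ** d" using tau_scalar(2)[OF y(1)] y(2) by (simp add: d_def d'_def matrix_mul_assoc)
        finally show ?thesis by (simp add: matrix_vector_mul_assoc)
      qed
      then have "\<Psi> (lift0 ?u) = act (H0 \<omega>\<^sub>1) g (\<Psi> x)"
        by (simp add: u(3) \<Psi> tv_c[OF pol k] tv_c[OF u(1,2)] vfun_act g)
      moreover have "?u \<in> ?Z" using pol k by blast
      ultimately show ?thesis unfolding Z y_def[symmetric] u(3) by (simp add: lift0_ops y(1))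
    qed
    show "\<exists>b\<in>coboundaries1 \<tau> (H0 0). z' = b \<oplus>\<^bsub>?A\<^esub> z"
      if zz: "z \<in> carrier ?A" "z' \<in> carrier ?A" "\<Psi> z = \<Psi> z'" for z z'
    proof -
      obtain u c where u: "u \<in> poly_funs" "(\<lambda>g. u g + (\<Sum>j\<in>UNIV. c $ j * phi j g)) \<in> kid" "z = lift0 u"
        using zz(1) unfolding Z by blast
      obtain u' c' where u': "u' \<in> poly_funs" "(\<lambda>g. u' g + (\<Sum>j\<in>UNIV. c' $ j * phi j g)) \<in> kid" "z' = lift0 u'"
        using zz(2) unfolding Z by blast
      have "d *v c = d *v c'" using zz(3) by (simp add: u(3) u'(3) \<Psi> vfun_inj tv_c[OF u(1,2)] tv_c[OF u'(1,2)])
      then have "d' *v (d *v c) = d' *v (d *v c')" by simp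
      then have "c = c'" by (simp add: matrix_vector_mul_assoc dd)
      then have "(\<lambda>g. u' g + u g) \<in> kid" using kid.add[OF u'(2) u(2)] by (simp add: add_ac)
      moreover have "z' = lift0 (\<lambda>g. u' g + u g) \<oplus>\<^bsub>?A\<^esub> z" by (simp add: u(3) u'(3) lift0_ops add.assoc)
      ultimately show ?thesis by (auto simp: coboundaries_H0_zero)
    qed
  qed
qed

end

theorem theorem3p2p6:
  fixes \<tau> :: "'k::alg_closed_field mat4 \<Rightarrow> 'k mat4" and w :: weight
  assumes "CHAR('k) = 2" and "special_isogeny \<tau>" and "w \<in> tau_restricted"
  shows "(w = 0 \<longrightarrow> untwist \<tau> (H1_ker \<tau> (H0 w)) \<cong>\<^sub>G (H0 \<omega>\<^sub>1 :: ('k, _) gmodule)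
                    \<and> is_L \<omega>\<^sub>1 (H0 \<omega>\<^sub>1 :: ('k, _) gmodule)) \<and>
         (w \<noteq> 0 \<longrightarrow> untwist \<tau> (H1_ker \<tau> (H0 w)) \<cong>\<^sub>G (zero_gmodule :: ('k, _) gmodule))"
proof -
  interpret special "TYPE('k)" \<tau>
    using assms(1,2) by unfold_locales
  have "w = 0 \<or> w = \<omega>\<^sub>1" using assms(3) by (simp add: tau_restricted_eq)
  then show ?thesis using H1_zero H1_omega1 H0_omega1_is_L by blast
qed

end
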